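(* Let $\underline C$ be a row contraction on a Hilbert space $\mathcal H_C$. The characteristic function $\mathcal M(\underline E)$ of a minimal contractive lifting $\underline E$ of $\underline C$ always has an injective symbol. Conversely, if $M:\Gamma\otimes\mathcal D\to\Gamma\otimes\mathcal D_C$ is any contractive multi-analytic operator with an injective symbol, then $\mathcal E(M)$ is a minimal contractive lifting of $\underline C$ and $M$ is its characteristic function.
   Context: Hilbert spaces are complex; $d\ge 1$ is a fixed integer. $P_X$ denotes the orthogonal projection onto $X$. **Multi-analytic operators.** $\Gamma=\bigoplus_{n\ge0}(\mathbb C^d)^{\otimes n}$ is the full Fock space, $e_\emptyset$ its vacuum vector, $L_j$ the left creation operator $L_jx=e_j\otimes x$. A bounded operator $M_\Theta:\Gamma\otimes\mathcal D\to\Gamma\otimes\mathcal L$ is multi-analytic if $M_\Theta(L_j\otimes I)=(L_j\otimes I)M_\Theta$ for all $j$; its symbol is $\Theta:\mathcal D\to\Gamma\otimes\mathcal L$, $\Theta(\delta)=M_\Theta(e_\emptyset\otimes\delta)$. It is contractive if $\|M_\Theta\|\le1$. **Row contractions and liftings.** A $d$-tuple $\underline T$ on $\mathcal H_T$ is a row contraction if $\sum_jT_jT_j^*\le I$, and a row isometry if the $T_j$ are isometries with orthogonal ranges. $D_T=(\delta_{ij}I-T_i^*T_j)^{1/2}_{d\times d}$ on $\bigoplus_1^d\mathcal H_T$ is the defect operator, $\mathcal D_T=\overline{\mathrm{range}\,D_T}$ the defect space. A lifting of $\underline C$ is a $d$-tuple $\underline E$ on $\mathcal H_E=\mathcal H_C\oplus\mathcal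 H_A$ of the form $E_j=\begin{pmatrix} C_j & 0 \\ B_j & A_j \end{pmatrix}$; it is contractive if $\underline E$ is a row contraction, and minimal if $\mathcal H_E$ is the smallest closed subspace invariant under all $E_j$ and containing $\mathcal H_C$. **Minimal isometric dilation.** For a word $\alpha=\alpha_1\cdots\alpha_m$ in $\{1,\dots,d\}$ put $T_\alpha=T_{\alpha_1}\cdots T_{\alpha_m}$, $T_\emptyset=I$. An isometric dilation of $\underline T$ is a row isometry $\underline V$ on a space containing $\mathcal H_T$ with $T_\alpha=P_{\mathcal H_T}V_\alpha|_{\mathcal H_T}$ for all $\alpha$; it is minimal if the space is the smallest closed $\underline V$-invariant subspace containing $\mathcal H_T$. The minimal isometric dilation, unique up to unitary equivalence, is denoted $\underline V^T$; it is realized on $\mathcal H_T\oplus(\Gamma\otimes\mathcal D_T)$ by $V^T_j(h\oplus\eta)=T_jh\oplus\big(e_\emptyset\otimes D_T\iota_jh+(L_j\otimes I)\eta\big)$, with $\iota_j:\mathcal H_T\to\bigoplus_1^d\mathcal H_T$ the $j$-th inclusion. In any isometric dilation $\underline V$, put $\mathcal L_T=\overline{\mathrm{span}}\{\mathcal H_T,V_1\mathcal H_T,\dots,V_d\mathcal H_T\}\ominus\mathcal H_T$; it is wandering, there is a canonical unitary $\kappa_T:\mathcal D_T\to\mathcal L_T$, $D_T(\bigoplus_i\xi_i)\mapsto\sum_i(V_i-T_i)\xi_i$, extending to $K_T:\Gamma\otimes\mathcal D_T\to\bigoplus_\alpha V_\alpha\mathcal L_T$, $(L_\alpha\otimes I)(e_\emptyset\otimes\delta)\mapsto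 V_\alpha\kappa_T\delta$. **The map $\mathcal E$.** Given a contractive multi-analytic $M_\Theta:\Gamma\otimes\mathcal D\to\Gamma\otimes\mathcal D_C$, let $\Delta_\Theta=(I-M_\Theta^*M_\Theta)^{1/2}$, $\mathcal H_\Theta=(\Gamma\otimes\mathcal D_C)\oplus\overline{\Delta_\Theta(\Gamma\otimes\mathcal D)}$, with row isometry $V_j(\eta\oplus\Delta_\Theta\xi)=(L_j\otimes I)\eta\oplus\Delta_\Theta(L_j\otimes I)\xi$. Let $W_\Theta\xi=M_\Theta\xi\oplus\Delta_\Theta\xi$ (an isometry $\Gamma\otimes\mathcal D\to\mathcal H_\Theta$), $\mathcal H_{\mathcal D}=W_\Theta(\Gamma\otimes\mathcal D)$, $\mathcal H_A=\mathcal H_\Theta\ominus\mathcal H_{\mathcal D}$, $\hat{\mathcal H}=\mathcal H_C\oplus\mathcal H_\Theta$. Let $\hat{\underline V}$ be the row isometry on $\hat{\mathcal H}$ which restricts to $\underline V$ on $\mathcal H_\Theta$ and to $\underline V^C$ (in the realization $V^C_j(h\oplus\eta)=C_jh\oplus\big(e_\emptyset\otimes D_C\iota_jh+(L_j\otimes I)\eta\big)$, with $\iota_j:\mathcal H_C\to\bigoplus_1^d\mathcal H_C$ the $j$-th inclusion) on $\mathcal H_C\oplus(\Gamma\otimes\mathcal D_C)$. With $\mathcal H_E=\mathcal H_C\oplus\mathcal H_A$, $\mathcal E(M_\Theta)=\underline E$ is given by $E_j=P_{\mathcal H_E}\hat V_j|_{\mathcal H_E}$, a contractive lifting of $\underline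 C$. **The map $\mathcal M$ (characteristic function).** Given a contractive lifting $\underline E$ of $\underline C$, $\underline V^E$ is also an isometric dilation of $\underline C$; form $\mathcal L_E,\mathcal L_C$, $K_E,K_C$ with respect to $\underline V^E$. Then $\mathcal M(\underline E)=K_C^*PK_E:\Gamma\otimes\mathcal D_E\to\Gamma\otimes\mathcal D_C$, where $P$ is the orthogonal projection onto $\bigoplus_\alpha V^E_\alpha\mathcal L_C$; it is a contractive multi-analytic operator. For minimal $\underline E$ it is called the characteristic function of the lifting $\underline E$. **Convention.** "$M$ is the characteristic function of $\underline E=\mathcal E(M)$" means $\mathcal M(\underline E)=M$ after identifying $\mathcal D$ with $\mathcal D_E$ by a unitary, namely the one obtained from $\mathcal L_E=W_\Theta(e_\emptyset\otimes\mathcal D)$ in $\hat{\mathcal H}$ and the canonical unitary $\kappa_E:\mathcal D_E\to\mathcal L_E$. *)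

theory Defs
  imports "HOL-Analysis.Analysis"
begin

section \<open>Complex Hilbert spaces\<close>

text \<open>
  A complex inner product space is a real one (which supplies norm and topology) with a complex
  scalar multiplication extending the real one and a sesquilinear form, linear in the first
  argument, whose real part is the real inner product.
\<close>

class complex_inner = real_inner +
  fixes scaleC :: "complex \<Rightarrow> 'a \<Rightarrow> 'a" (infixr "*\<^sub>C" 75)
    and cinner :: "'a \<Rightarrow> 'a \<Rightarrow> complex"
  assumes scaleC_add_right: "a *\<^sub>C (x + y) = a *\<^sub>C x + a *\<^sub>C y"
    and scaleC_add_left: "(a + b) *\<^sub>C x = a *\<^sub>C x + b *\<^sub>C x"
    and scaleC_scaleC: "a *\<^sub>C b *\<^sub>C x = (a * b) *\<^sub>C x"
    and scaleC_of_real: "complex_of_real r *\<^sub>C x = r *\<^sub>R x"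
    and cinner_commute: "cinner x y = cnj (cinner y x)"
    and cinner_add_left: "cinner (x + y) z = cinner x z + cinner y z"
    and cinner_scaleC_left: "cinner (a *\<^sub>C x) y = a * cinner x y"
    and Re_cinner: "Re (cinner x y) = inner x y"

class chilbert_space = complex_inner + complete_space

lemma scaleC_one [simp]: "1 *\<^sub>C (x :: 'a :: complex_inner) = x"
  using scaleC_of_real[of 1 x] by simp

lemma scaleC_zero_left [simp]: "0 *\<^sub>C (x :: 'a :: complex_inner) = 0"
  using scaleC_of_real[of 0 x] by simp

lemma scaleC_zero_right [simp]: "a *\<^sub>C (0 :: 'a :: complex_inner) = 0"
  using scaleC_add_right[of a 0 0] by simp

lemma cinner_scaleC_right: "cinner (x :: 'a :: complex_inner) (a *\<^sub>C y) = cnj a * cinner x y"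
  by (metis cinner_commute cinner_scaleC_left complex_cnj_mult)

lemma cinner_self: "cinner (x :: 'a :: complex_inner) x = complex_of_real ((norm x)\<^sup>2)"
proof -
  have "Im (cinner x x) = 0"
    using cinner_commute[of x x] by (metis cnj.simps(2) neg_equal_zero)
  then show ?thesis
    by (simp add: complex_eq_iff Re_cinner power2_norm_eq_inner)
qed

lemma Im_cinner: "Im (cinner (x :: 'a :: complex_inner) y) = inner x (\<i> *\<^sub>C y)"
  by (simp flip: Re_cinner add: cinner_scaleC_right)

lemma cinner_eq: "cinner (x :: 'a :: complex_inner) y = Complex (inner x y) (inner x (\<i> *\<^sub>C y))"
  by (simp add: complex_eq_iff Re_cinner Im_cinner)

lemma norm_scaleC [simp]: "norm (a *\<^sub>C (x :: 'a :: complex_inner)) = cmod a * norm x"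
proof -
  have "complex_of_real ((norm (a *\<^sub>C x))\<^sup>2) = complex_of_real ((cmod a * norm x)\<^sup>2)"
    unfolding cinner_self[symmetric] cinner_scaleC_left cinner_scaleC_right
    by (simp only: cinner_self power_mult_distrib of_real_mult complex_norm_square mult_ac)
  then have "(norm (a *\<^sub>C x))\<^sup>2 = (cmod a * norm x)\<^sup>2"
    by (simp only: of_real_eq_iff)
  then show ?thesis
    by simp
qed

instantiation complex :: complex_inner
begin

definition scaleC_complex :: "complex \<Rightarrow> complex \<Rightarrow> complex"
  where "scaleC_complex a x = a * x"

definition cinner_complex :: "complex \<Rightarrow> complex \<Rightarrow> complex"
  where "cinner_complex x y = x * cnj y"

instance
  by standard
    (auto simp: scaleC_complex_def cinner_complex_def algebra_simps scaleR_conv_of_real inner_complex_def)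

end

instance complex :: chilbert_space ..

instantiation prod :: (complex_inner, complex_inner) complex_inner
begin

definition scaleC_prod :: "complex \<Rightarrow> 'a \<times> 'b \<Rightarrow> 'a \<times> 'b"
  where "scaleC_prod a x = (a *\<^sub>C fst x, a *\<^sub>C snd x)"

definition cinner_prod :: "'a \<times> 'b \<Rightarrow> 'a \<times> 'b \<Rightarrow> complex"
  where "cinner_prod x y = cinner (fst x) (fst y) + cinner (snd x) (snd y)"

instance
proof
  show "cinner x y = cnj (cinner y x)" for x y :: "'a \<times> 'b"
    unfolding cinner_prod_def by (metis cinner_commute complex_cnj_add)
qed (auto simp: scaleC_prod_def cinner_prod_def scaleC_add_right scaleC_add_left scaleC_scaleC
    scaleC_of_real cinner_add_left cinner_scaleC_left Re_cinner inner_prod_def algebra_simps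
    prod_eq_iff)

end

instance prod :: (chilbert_space, chilbert_space) chilbert_space ..

instantiation vec :: (complex_inner, finite) complex_inner
begin

definition scaleC_vec :: "complex \<Rightarrow> 'a ^ 'b \<Rightarrow> 'a ^ 'b"
  where "scaleC_vec a x = (\<chi> i. a *\<^sub>C x $ i)"

definition cinner_vec :: "'a ^ 'b \<Rightarrow> 'a ^ 'b \<Rightarrow> complex"
  where "cinner_vec x y = (\<Sum>i\<in>UNIV. cinner (x $ i) (y $ i))"

instance
proof
  show "cinner x y = cnj (cinner y x)" for x y :: "'a ^ 'b"
    unfolding cinner_vec_def cnj_sum by (rule sum.cong[OF refl], rule cinner_commute)
qed (auto simp: scaleC_vec_def cinner_vec_def scaleC_add_right scaleC_add_left scaleC_scaleC
    scaleC_of_real cinner_add_left cinner_scaleC_left Re_cinner inner_vec_def vec_eq_iff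
    sum.distrib sum_distrib_left)

end

instance vec :: (chilbert_space, finite) chilbert_space ..


section \<open>The Fock space with coefficients\<close>

text \<open>
  Since the \<open>e\<^sub>\<alpha>\<close>, for \<open>\<alpha>\<close> a word over the index type \<open>'d\<close>, form an orthonormal basis of the full
  Fock space, its Hilbert tensor product with \<open>'a\<close> consists of the square summable families
  \<open>\<Sum>\<alpha>. e\<^sub>\<alpha> \<otimes> f \<alpha>\<close>. The lemmas \<open>cinner_fock_tensor\<close> and \<open>fock_on_eq_closure\<close> below
  identify it as the tensor product.
\<close>

definition square_summable :: "('d list \<Rightarrow> 'a :: real_normed_vector) \<Rightarrow> bool"
  where "square_summable f \<longleftrightarrow> (\<lambda>\<alpha>. (norm (f \<alpha>))\<^sup>2) summable_on UNIV"

lemma square_summable_zero [simp]: "square_summable (\<lambda>_. 0)"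
  by (simp add: square_summable_def)

lemma square_summable_add:
  assumes "square_summable f" "square_summable g"
  shows "square_summable (\<lambda>\<alpha>. f \<alpha> + g \<alpha>)"
proof -
  have "(\<lambda>\<alpha>. 2 * (norm (f \<alpha>))\<^sup>2 + 2 * (norm (g \<alpha>))\<^sup>2) summable_on UNIV"
    using assms unfolding square_summable_def
    by (intro summable_on_add summable_on_cmult_right)
  moreover have "(norm (f \<alpha> + g \<alpha>))\<^sup>2 \<le> 2 * (norm (f \<alpha>))\<^sup>2 + 2 * (norm (g \<alpha>))\<^sup>2" for \<alpha>
  proof -
    have "(norm (f \<alpha> + g \<alpha>))\<^sup>2 \<le> (norm (f \<alpha>) + norm (g \<alpha>))\<^sup>2"
      by (intro power_mono norm_triangle_ineq) auto
    also have "\<dots> \<le> 2 * (norm (f \<alpha>))\<^sup>2 + 2 * (norm (g \<alpha>))\<^sup>2"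
      using sum_squares_bound[of "norm (f \<alpha>)" "norm (g \<alpha>)"] by (simp add: power2_sum)
    finally show ?thesis .
  qed
  ultimately show ?thesis
    unfolding square_summable_def by (rule summable_on_comparison_test) auto
qed

lemma square_summable_mono:
  assumes "square_summable f" "\<And>\<alpha>. norm (g \<alpha>) \<le> c * norm (f \<alpha>)"
  shows "square_summable g"
proof -
  have "(\<lambda>\<alpha>. c\<^sup>2 * (norm (f \<alpha>))\<^sup>2) summable_on UNIV"
    using assms unfolding square_summable_def by (intro summable_on_cmult_right)
  moreover have "(norm (g \<alpha>))\<^sup>2 \<le> c\<^sup>2 * (norm (f \<alpha>))\<^sup>2" for \<alpha>
    using power_mono[OF assms(2)[of \<alpha>], of 2] by (simp add: power_mult_distrib)
  ultimately show ?thesis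
    unfolding square_summable_def by (rule summable_on_comparison_test) auto
qed

lemma square_summable_diff:
  assumes "square_summable f" "square_summable g"
  shows "square_summable (\<lambda>\<alpha>. f \<alpha> - g \<alpha>)"
  using square_summable_add[OF assms(1) square_summable_mono[OF assms(2), of "\<lambda>\<alpha>. - g \<alpha>" 1]]
  by simp

lemma square_summable_bounded:
  assumes "\<And>F. finite F \<Longrightarrow> (\<Sum>\<alpha>\<in>F. (norm (f \<alpha>))\<^sup>2) \<le> B"
  shows "square_summable f"
  unfolding square_summable_def
  by (rule nonneg_bdd_above_summable_on) (auto intro!: bdd_aboveI2 assms)

lemma summable_on_inner:
  fixes f g :: "'d list \<Rightarrow> 'a :: real_inner"
  assumes "square_summable f" "square_summable g"
  shows "(\<lambda>\<alpha>. inner (f \<alpha>) (g \<alpha>)) summable_on UNIV"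
proof -
  have "(\<lambda>\<alpha>. (norm (f \<alpha>))\<^sup>2 + (norm (g \<alpha>))\<^sup>2) summable_on UNIV"
    using assms unfolding square_summable_def by (intro summable_on_add)
  moreover have "norm (inner (f \<alpha>) (g \<alpha>)) \<le> (norm (f \<alpha>))\<^sup>2 + (norm (g \<alpha>))\<^sup>2" for \<alpha>
  proof -
    have "\<bar>inner (f \<alpha>) (g \<alpha>)\<bar> \<le> norm (f \<alpha>) * norm (g \<alpha>)"
      by (rule Cauchy_Schwarz_ineq2)
    also have "\<dots> \<le> 2 * norm (f \<alpha>) * norm (g \<alpha>)"
      by simp
    also have "\<dots> \<le> (norm (f \<alpha>))\<^sup>2 + (norm (g \<alpha>))\<^sup>2"
      by (rule sum_squares_bound)
    finally show ?thesis
      by simp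
  qed
  ultimately have "(\<lambda>\<alpha>. norm (inner (f \<alpha>) (g \<alpha>))) summable_on UNIV"
    by (rule summable_on_comparison_test) auto
  then show ?thesis
    by (rule abs_summable_summable)
qed

typedef (overloaded) ('d, 'a) fock = "{f :: 'd list \<Rightarrow> 'a :: complex_inner. square_summable f}"
  morphisms fock_coeff Abs_fock
  by (rule exI[of _ "\<lambda>_. 0"]) simp

setup_lifting type_definition_fock

lemma square_summable_coeff [simp]: "square_summable (fock_coeff f)"
  using fock_coeff[of f] by simp

lemma fock_eqI: "(\<And>\<alpha>. fock_coeff f \<alpha> = fock_coeff g \<alpha>) \<Longrightarrow> f = g"
  by (metis ext fock_coeff_inject)

instantiation fock :: (type, complex_inner) complex_inner
begin

lift_definition zero_fock :: "('a, 'b) fock" is "\<lambda>_. 0"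
  by simp

lift_definition plus_fock :: "('a, 'b) fock \<Rightarrow> ('a, 'b) fock \<Rightarrow> ('a, 'b) fock"
  is "\<lambda>f g \<alpha>. f \<alpha> + g \<alpha>"
  by (rule square_summable_add)

lift_definition minus_fock :: "('a, 'b) fock \<Rightarrow> ('a, 'b) fock \<Rightarrow> ('a, 'b) fock"
  is "\<lambda>f g \<alpha>. f \<alpha> - g \<alpha>"
  by (rule square_summable_diff)

lift_definition uminus_fock :: "('a, 'b) fock \<Rightarrow> ('a, 'b) fock"
  is "\<lambda>f \<alpha>. - f \<alpha>"
  by (erule square_summable_mono[where c = 1]) simp

lift_definition scaleR_fock :: "real \<Rightarrow> ('a, 'b) fock \<Rightarrow> ('a, 'b) fock"
  is "\<lambda>r f \<alpha>. r *\<^sub>R f \<alpha>"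
  subgoal for r f by (erule square_summable_mono[where c = "\<bar>r\<bar>"]) simp
  done

lift_definition scaleC_fock :: "complex \<Rightarrow> ('a, 'b) fock \<Rightarrow> ('a, 'b) fock"
  is "\<lambda>a f \<alpha>. a *\<^sub>C f \<alpha>"
  subgoal for a f by (erule square_summable_mono[where c = "cmod a"]) simp
  done

definition inner_fock :: "('a, 'b) fock \<Rightarrow> ('a, 'b) fock \<Rightarrow> real"
  where "inner_fock f g = (\<Sum>\<^sub>\<infinity>\<alpha>. inner (fock_coeff f \<alpha>) (fock_coeff g \<alpha>))"

definition cinner_fock :: "('a, 'b) fock \<Rightarrow> ('a, 'b) fock \<Rightarrow> complex"
  where "cinner_fock f g = (\<Sum>\<^sub>\<infinity>\<alpha>. cinner (fock_coeff f \<alpha>) (fock_coeff g \<alpha>))"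

definition norm_fock :: "('a, 'b) fock \<Rightarrow> real"
  where "norm_fock f = sqrt (inner f f)"

definition sgn_fock :: "('a, 'b) fock \<Rightarrow> ('a, 'b) fock"
  where "sgn_fock f = scaleR (inverse (norm f)) f"

definition dist_fock :: "('a, 'b) fock \<Rightarrow> ('a, 'b) fock \<Rightarrow> real"
  where "dist_fock f g = norm (f - g)"

definition uniformity_fock :: "(('a, 'b) fock \<times> ('a, 'b) fock) filter"
  where "uniformity_fock = (INF e\<in>{0<..}. principal {(x, y). dist x y < e})"

definition open_fock :: "('a, 'b) fock set \<Rightarrow> bool"
  where "open_fock U \<longleftrightarrow> (\<forall>x\<in>U. eventually (\<lambda>(x', y). x' = x \<longrightarrow> y \<in> U) uniformity)"

lemma summable_on_inner_fock:
  fixes f g :: "('a, 'b) fock"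
  shows "(\<lambda>\<alpha>. inner (fock_coeff f \<alpha>) (fock_coeff g \<alpha>)) summable_on UNIV"
  by (rule summable_on_inner) simp_all

lemma summable_on_cinner_fock:
  fixes f g :: "('a, 'b) fock"
  shows "(\<lambda>\<alpha>. cinner (fock_coeff f \<alpha>) (fock_coeff g \<alpha>)) summable_on UNIV"
proof -
  have "(\<lambda>\<alpha>. complex_of_real (inner (fock_coeff f \<alpha>) (fock_coeff g \<alpha>)) +
      \<i> * complex_of_real (inner (fock_coeff f \<alpha>) (fock_coeff (\<i> *\<^sub>C g) \<alpha>))) summable_on UNIV"
    by (intro summable_on_add summable_on_cmult_right summable_on_of_real summable_on_inner_fock)
  then show ?thesis
    by (simp add: cinner_eq scaleC_fock.rep_eq Complex_eq)
qed

instance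
proof
  fix x y z :: "('a, 'b) fock" and a b :: complex and r s :: real
  note reps = plus_fock.rep_eq minus_fock.rep_eq uminus_fock.rep_eq zero_fock.rep_eq
    scaleR_fock.rep_eq scaleC_fock.rep_eq
  show "x + y + z = x + (y + z)" "x + y = y + x" "0 + x = x" "- x + x = 0" "x - y = x + - y"
    "r *\<^sub>R (x + y) = r *\<^sub>R x + r *\<^sub>R y" "(r + s) *\<^sub>R x = r *\<^sub>R x + s *\<^sub>R x"
    "r *\<^sub>R s *\<^sub>R x = (r * s) *\<^sub>R x" "1 *\<^sub>R x = x"
    by (rule fock_eqI; simp add: reps algebra_simps)+
  show "a *\<^sub>C (x + y) = a *\<^sub>C x + a *\<^sub>C y" "(a + b) *\<^sub>C x = a *\<^sub>C x + b *\<^sub>C x"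
    "a *\<^sub>C b *\<^sub>C x = (a * b) *\<^sub>C x" "complex_of_real r *\<^sub>C x = r *\<^sub>R x"
    by (rule fock_eqI;
        simp add: reps scaleC_add_right scaleC_add_left scaleC_scaleC scaleC_of_real)+
  show "sgn x = scaleR (inverse (norm x)) x"
    by (rule sgn_fock_def)
  show "dist x y = norm (x - y)"
    by (rule dist_fock_def)
  show "norm x = sqrt (inner x x)"
    by (rule norm_fock_def)
  show "(uniformity :: (('a, 'b) fock \<times> ('a, 'b) fock) filter) =
      (INF e\<in>{0<..}. principal {(x, y). dist x y < e})"
    by (rule uniformity_fock_def)
  show "open U = (\<forall>x\<in>U. \<forall>\<^sub>F (x', y) in uniformity. x' = x \<longrightarrow> y \<in> U)" for U :: "('a, 'b) fock set"
    by (rule open_fock_def)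
  show "inner x y = inner y x"
    by (simp add: inner_fock_def inner_commute)
  show "inner (x + y) z = inner x z + inner y z"
    by (simp add: inner_fock_def reps inner_add_left infsum_add summable_on_inner_fock)
  show "inner (r *\<^sub>R x) y = r * inner x y"
    by (simp add: inner_fock_def reps infsum_cmult_right')
  show "0 \<le> inner x x"
    by (simp add: inner_fock_def infsum_nonneg)
  show "inner x x = 0 \<longleftrightarrow> x = 0"
  proof
    assume "inner x x = 0"
    then have "inner (fock_coeff x \<alpha>) (fock_coeff x \<alpha>) = 0" for \<alpha>
      by (intro nonneg_infsum_le_0D[OF _ summable_on_inner_fock[of x x]]) (auto simp: inner_fock_def)
    then show "x = 0"
      by (intro fock_eqI) (simp add: reps)
  qed (simp add: inner_fock_def reps)
  show "cinner x y = cnj (cinner y x)"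
    unfolding cinner_fock_def infsum_cnj[symmetric] by (rule infsum_cong, rule cinner_commute)
  show "cinner (x + y) z = cinner x z + cinner y z"
    by (simp add: cinner_fock_def reps cinner_add_left infsum_add summable_on_cinner_fock)
  show "cinner (a *\<^sub>C x) y = a * cinner x y"
    by (simp add: cinner_fock_def reps cinner_scaleC_left infsum_cmult_right')
  show "Re (cinner x y) = inner x y"
    by (simp add: cinner_fock_def inner_fock_def Re_cinner flip: infsum_Re[OF summable_on_cinner_fock])
qed

end

lemma norm_fock_power2: "(norm f)\<^sup>2 = (\<Sum>\<^sub>\<infinity>\<alpha>. (norm (fock_coeff f \<alpha>))\<^sup>2)"
  by (simp add: power2_norm_eq_inner inner_fock_def)

lemma sum_fock_coeff_le: "finite F \<Longrightarrow> (\<Sum>\<alpha>\<in>F. (norm (fock_coeff f \<alpha>))\<^sup>2) \<le> (norm f)\<^sup>2"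
  using square_summable_coeff[of f] unfolding norm_fock_power2 square_summable_def
  by (intro finite_sum_le_infsum) auto

lemma norm_fock_le:
  assumes "\<And>F. finite F \<Longrightarrow> (\<Sum>\<alpha>\<in>F. (norm (fock_coeff f \<alpha>))\<^sup>2) \<le> B\<^sup>2" "0 \<le> B"
  shows "norm f \<le> B"
proof -
  have "(norm f)\<^sup>2 \<le> B\<^sup>2"
    using square_summable_coeff[of f] assms(1) unfolding norm_fock_power2 square_summable_def
    by (intro infsum_le_finite_sums) auto
  then show ?thesis
    using assms(2) by (rule power2_le_imp_le)
qed

lemma norm_fock_coeff_le: "norm (fock_coeff f \<alpha>) \<le> norm f"
  using sum_fock_coeff_le[of "{\<alpha>}" f] by (simp add: power2_le_iff_abs_le)

lemma bounded_linear_fock_coeff: "bounded_linear (\<lambda>f. fock_coeff f \<alpha>)"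
  by (rule bounded_linear_intro[where K = 1])
    (auto simp: plus_fock.rep_eq scaleR_fock.rep_eq norm_fock_coeff_le)

instance fock :: (type, chilbert_space) chilbert_space
proof
  fix X :: "nat \<Rightarrow> ('a, 'b) fock"
  assume X: "Cauchy X"
  define g where "g \<alpha> = lim (\<lambda>n. fock_coeff (X n) \<alpha>)" for \<alpha>
  have g: "(\<lambda>n. fock_coeff (X n) \<alpha>) \<longlonglongrightarrow> g \<alpha>" for \<alpha>
    unfolding g_def
    using bounded_linear.Cauchy[OF bounded_linear_fock_coeff X, of \<alpha>]
    by (simp add: Cauchy_convergent_iff convergent_LIMSEQ_iff)
  have *: "\<exists>N. \<forall>n\<ge>N. \<forall>F. finite F \<longrightarrow> (\<Sum>\<alpha>\<in>F. (norm (fock_coeff (X n) \<alpha> - g \<alpha>))\<^sup>2) \<le> e\<^sup>2"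
    if "e > 0" for e
  proof -
    obtain N where N: "norm (X n - X m) < e" if "n \<ge> N" "m \<ge> N" for n m
      using X \<open>e > 0\<close> unfolding Cauchy_iff by blast
    have "(\<Sum>\<alpha>\<in>F. (norm (fock_coeff (X n) \<alpha> - g \<alpha>))\<^sup>2) \<le> e\<^sup>2" if "n \<ge> N" "finite F" for n F
    proof (rule tendsto_upperbound)
      show "(\<lambda>m. \<Sum>\<alpha>\<in>F. (norm (fock_coeff (X n) \<alpha> - fock_coeff (X m) \<alpha>))\<^sup>2)
          \<longlonglongrightarrow> (\<Sum>\<alpha>\<in>F. (norm (fock_coeff (X n) \<alpha> - g \<alpha>))\<^sup>2)"
        by (intro tendsto_intros g)
      have "(\<Sum>\<alpha>\<in>F. (norm (fock_coeff (X n) \<alpha> - fock_coeff (X m) \<alpha>))\<^sup>2) \<le> e\<^sup>2" if "m \<ge> N" for m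
      proof -
        have "(\<Sum>\<alpha>\<in>F. (norm (fock_coeff (X n) \<alpha> - fock_coeff (X m) \<alpha>))\<^sup>2) \<le> (norm (X n - X m))\<^sup>2"
          using sum_fock_coeff_le[OF \<open>finite F\<close>, of "X n - X m"] by (simp add: minus_fock.rep_eq)
        also have "\<dots> \<le> e\<^sup>2"
          using N[OF \<open>n \<ge> N\<close> that] by (intro power_mono) auto
        finally show ?thesis .
      qed
      then show "\<forall>\<^sub>F m in sequentially.
          (\<Sum>\<alpha>\<in>F. (norm (fock_coeff (X n) \<alpha> - fock_coeff (X m) \<alpha>))\<^sup>2) \<le> e\<^sup>2"
        by (auto simp: eventually_sequentially)
    qed simp
    then show ?thesis
      by blast
  qed
  obtain N where "\<And>F. finite F \<Longrightarrow> (\<Sum>\<alpha>\<in>F. (norm (fock_coeff (X N) \<alpha> - g \<alpha>))\<^sup>2) \<le> 1\<^sup>2"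
    using *[of 1] by auto
  then have "square_summable (\<lambda>\<alpha>. fock_coeff (X N) \<alpha> - g \<alpha>)"
    by (rule square_summable_bounded)
  from square_summable_diff[OF square_summable_coeff[of "X N"] this]
  have coeff: "fock_coeff (Abs_fock g) = g"
    by (intro Abs_fock_inverse) simp
  have "X \<longlonglongrightarrow> Abs_fock g"
    unfolding LIMSEQ_iff
  proof (intro allI impI)
    fix r :: real
    assume "r > 0"
    then obtain N where N: "\<And>n F. n \<ge> N \<Longrightarrow> finite F \<Longrightarrow>
        (\<Sum>\<alpha>\<in>F. (norm (fock_coeff (X n) \<alpha> - g \<alpha>))\<^sup>2) \<le> (r / 2)\<^sup>2"
      using *[of "r / 2"] by auto
    have "norm (X n - Abs_fock g) \<le> r / 2" if "n \<ge> N" for n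
      using N[OF that] \<open>r > 0\<close> by (intro norm_fock_le) (auto simp: minus_fock.rep_eq coeff)
    then show "\<exists>N. \<forall>n\<ge>N. norm (X n - Abs_fock g) < r"
      using \<open>r > 0\<close> by (intro exI[of _ N]) force
  qed
  then show "convergent X"
    unfolding convergent_def by blast
qed

lift_definition creation :: "'d \<Rightarrow> ('d, 'a :: complex_inner) fock \<Rightarrow> ('d, 'a) fock"
  is "\<lambda>j f \<alpha>. case \<alpha> of [] \<Rightarrow> 0 | i # \<beta> \<Rightarrow> if i = j then f \<beta> else 0"
proof -
  fix j :: 'd and f :: "'d list \<Rightarrow> 'a"
  assume "square_summable f"
  then have "((\<lambda>\<alpha>. (norm (f (tl \<alpha>)))\<^sup>2) \<circ> (#) j) summable_on UNIV"
    by (simp add: square_summable_def o_def)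
  then have "(\<lambda>\<alpha>. (norm (f (tl \<alpha>)))\<^sup>2) summable_on range ((#) j)"
    by (subst summable_on_reindex) (auto simp: inj_on_def)
  then show "square_summable (\<lambda>\<alpha>. case \<alpha> of [] \<Rightarrow> 0 | i # \<beta> \<Rightarrow> if i = j then f \<beta> else 0)"
    unfolding square_summable_def
    by (rule summable_on_cong_neutral[THEN iffD1, rotated -1]) (auto split: list.split if_splits)
qed

lift_definition fock_single :: "'d list \<Rightarrow> ('d, complex) fock"
  is "\<lambda>\<alpha> \<beta>. if \<beta> = \<alpha> then 1 else 0"
  by (rule square_summable_bounded[of _ 1])
    (simp add: if_distrib[of "\<lambda>x. (cmod x)\<^sup>2"] sum.delta cong: if_cong)

abbreviation vacuum :: "('d, complex) fock"
  where "vacuum \<equiv> fock_single []"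

lift_definition fock_tensor ::
    "('d, complex) fock \<Rightarrow> 'a :: complex_inner \<Rightarrow> ('d, 'a) fock" (infixr "\<otimes>\<^sub>F" 75)
  is "\<lambda>x v \<alpha>. x \<alpha> *\<^sub>C v"
  subgoal for x v by (erule square_summable_mono[where c = "norm v"]) simp
  done

lemma cinner_fock_tensor:
  fixes u v :: "'a :: complex_inner"
  shows "cinner (x \<otimes>\<^sub>F u) (y \<otimes>\<^sub>F v) = cinner x y * cinner u v"
  proof -
  have "cinner (x \<otimes>\<^sub>F u) (y \<otimes>\<^sub>F v) =
      (\<Sum>\<^sub>\<infinity>\<alpha>. fock_coeff x \<alpha> * cnj (fock_coeff y \<alpha>) * cinner u v)"
    by (simp add: cinner_fock_def fock_tensor.rep_eq cinner_scaleC_left cinner_scaleC_right mult_ac)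
  then show ?thesis
    by (simp only: infsum_cmult_left' cinner_fock_def cinner_complex_def)
qed

lemma creation_fock_tensor: "creation j (x \<otimes>\<^sub>F v) = creation j x \<otimes>\<^sub>F v"
  by (rule fock_eqI) (auto simp: creation.rep_eq fock_tensor.rep_eq split: list.split)


section \<open>Subspaces and operators\<close>

text \<open>
  Hilbert spaces are closed subspaces of types in \<^class>\<open>chilbert_space\<close>; an operator between
  them is a HOL function that is only considered on its domain.
\<close>

definition csubspace :: "'a :: complex_inner set \<Rightarrow> bool"
  where "csubspace S \<longleftrightarrow> 0 \<in> S \<and> (\<forall>x\<in>S. \<forall>y\<in>S. x + y \<in> S) \<and> (\<forall>a. \<forall>x\<in>S. a *\<^sub>C x \<in> S)"

definition closed_csubspace :: "'a :: complex_inner set \<Rightarrow> bool"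
  where "closed_csubspace S \<longleftrightarrow> csubspace S \<and> closed S"

definition closed_cspan :: "'a :: complex_inner set \<Rightarrow> 'a set"
  where "closed_cspan X = closure (csubspace hull X)"

definition ominus :: "'a :: complex_inner set \<Rightarrow> 'a set \<Rightarrow> 'a set" (infixl "\<ominus>" 65)
  where "S \<ominus> X = {x \<in> S. \<forall>y\<in>X. cinner x y = 0}"

definition proj :: "'a :: complex_inner set \<Rightarrow> 'a \<Rightarrow> 'a"
  where "proj X x = (THE p. p \<in> X \<and> (\<forall>y\<in>X. cinner (x - p) y = 0))"

definition bounded_op ::
    "'a :: complex_inner set \<Rightarrow> 'b :: complex_inner set \<Rightarrow> ('a \<Rightarrow> 'b) \<Rightarrow> bool"
  where "bounded_op S R f \<longleftrightarrow>
    f ` S \<subseteq> R \<and>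
    (\<forall>x\<in>S. \<forall>y\<in>S. f (x + y) = f x + f y) \<and>
    (\<forall>a. \<forall>x\<in>S. f (a *\<^sub>C x) = a *\<^sub>C f x) \<and>
    (\<exists>K. \<forall>x\<in>S. norm (f x) \<le> K * norm x)"

definition unitary_op ::
    "'a :: complex_inner set \<Rightarrow> 'b :: complex_inner set \<Rightarrow> ('a \<Rightarrow> 'b) \<Rightarrow> bool"
  where "unitary_op S R U \<longleftrightarrow>
    bounded_op S R U \<and> U ` S = R \<and> (\<forall>x\<in>S. \<forall>y\<in>S. cinner (U x) (U y) = cinner x y)"

definition adj ::
    "'a :: complex_inner set \<Rightarrow> 'b :: complex_inner set \<Rightarrow> ('a \<Rightarrow> 'b) \<Rightarrow> 'b \<Rightarrow> 'a"
  where "adj S R f y = (THE x. x \<in> S \<and> (\<forall>s\<in>S. cinner (f s) y = cinner s x))"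

definition op_le :: "'a :: complex_inner set \<Rightarrow> ('a \<Rightarrow> 'a) \<Rightarrow> ('a \<Rightarrow> 'a) \<Rightarrow> bool"
  where "op_le S A B \<longleftrightarrow> (\<forall>x\<in>S. cinner (B x - A x) x \<in> \<real>\<^sub>\<ge>\<^sub>0)"

text \<open>The positive square root; it exists and is unique on \<open>S\<close> for positive bounded \<open>A\<close>.\<close>

definition op_sqrt :: "'a :: complex_inner set \<Rightarrow> ('a \<Rightarrow> 'a) \<Rightarrow> 'a \<Rightarrow> 'a"
  where "op_sqrt S A =
    (SOME R. bounded_op S S R \<and> op_le S (\<lambda>_. 0) R \<and> (\<forall>x\<in>S. R (R x) = A x))"

text \<open>The subspace \<open>\<Gamma> \<otimes> D\<close> of \<open>\<Gamma> \<otimes> 'a\<close>.\<close>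

definition fock_on :: "'a :: complex_inner set \<Rightarrow> ('d, 'a) fock set"
  where "fock_on D = {f. \<forall>\<alpha>. fock_coeff f \<alpha> \<in> D}"

lemma csubspace_fock_on: "csubspace D \<Longrightarrow> csubspace (fock_on D)"
  by (auto simp: csubspace_def fock_on_def zero_fock.rep_eq plus_fock.rep_eq scaleC_fock.rep_eq)

lemma closed_fock_on: "closed D \<Longrightarrow> closed (fock_on D)"
proof -
  assume "closed D"
  then have "closed {f :: ('d, 'a) fock. fock_coeff f \<alpha> \<in> D}" for \<alpha>
    using continuous_closed_vimage[of D "\<lambda>f :: ('d, 'a) fock. fock_coeff f \<alpha>"]
      linear_continuous_at[OF bounded_linear_fock_coeff[of \<alpha>, where ?'b = 'a]]
    by (simp add: vimage_def)
  then show ?thesis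
    unfolding fock_on_def by (rule closed_Collect_all)
qed

lemma fock_on_eq_closure:
  assumes D: "closed_csubspace (D :: 'a :: complex_inner set)"
  shows "(fock_on D :: ('d, 'a) fock set) = closed_cspan {x \<otimes>\<^sub>F v | x v. v \<in> D}"
    (is "_ = closed_cspan ?X")
proof
  have "csubspace hull ?X \<subseteq> fock_on D"
    using D by (intro hull_minimal csubspace_fock_on)
      (auto simp: closed_csubspace_def csubspace_def fock_on_def fock_tensor.rep_eq)
  then show "closed_cspan ?X \<subseteq> fock_on D"
    unfolding closed_cspan_def using D
    by (intro closure_minimal closed_fock_on) (auto simp: closed_csubspace_def)
next
  have sub: "csubspace (csubspace hull ?X)"
    by (rule hull_in) (auto simp: csubspace_def)
  have zero: "0 \<in> csubspace hull ?X"
    using sub by (subst (asm) csubspace_def) blast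
  have add: "x + y \<in> csubspace hull ?X" if "x \<in> csubspace hull ?X" "y \<in> csubspace hull ?X" for x y
    using sub that by (subst (asm) csubspace_def) blast
  show "fock_on D \<subseteq> closed_cspan ?X"
  proof
    fix f :: "('d, 'a) fock"
    assume f: "f \<in> fock_on D"
    define s where "s F = (\<Sum>\<alpha>\<in>F. fock_single \<alpha> \<otimes>\<^sub>F fock_coeff f \<alpha>)" for F
    have s_in: "s F \<in> csubspace hull ?X" if "finite F" for F
      unfolding s_def using that
    proof induction
      case (insert \<alpha> F)
      have "fock_single \<alpha> \<otimes>\<^sub>F fock_coeff f \<alpha> \<in> csubspace hull ?X"
        using f by (intro hull_inc) (auto simp: fock_on_def)
      with insert show ?case
        by (simp add: add)
    qed (simp add: zero)
    have s_coeff: "fock_coeff (s F) \<beta> = (if \<beta> \<in> F then fock_coeff f \<beta> else 0)" if "finite F" for F \<beta>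
      unfolding s_def using that
      by induction (auto simp: zero_fock.rep_eq plus_fock.rep_eq fock_tensor.rep_eq fock_single.rep_eq)
    show "f \<in> closed_cspan ?X"
      unfolding closed_cspan_def closure_approachable
    proof (intro allI impI)
      fix e :: real
      assume "e > 0"
      have summable: "(\<lambda>\<alpha>. (norm (fock_coeff f \<alpha>))\<^sup>2) summable_on UNIV"
        using square_summable_coeff[of f] by (simp add: square_summable_def)
      obtain F where F: "finite F"
        "dist (\<Sum>\<alpha>\<in>F. (norm (fock_coeff f \<alpha>))\<^sup>2) (\<Sum>\<^sub>\<infinity>\<alpha>. (norm (fock_coeff f \<alpha>))\<^sup>2) \<le> (e / 2)\<^sup>2"
        using infsum_finite_approximation[OF summable, of "(e / 2)\<^sup>2"] \<open>e > 0\<close> by auto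
      have "norm (s F - f) \<le> e / 2"
      proof (rule norm_fock_le)
        fix G :: "'d list set"
        assume G: "finite G"
        have "(\<Sum>\<alpha>\<in>G. (norm (fock_coeff (s F - f) \<alpha>))\<^sup>2) = (\<Sum>\<alpha>\<in>G - F. (norm (fock_coeff f \<alpha>))\<^sup>2)"
          using G F by (intro sum.mono_neutral_cong_right) (auto simp: minus_fock.rep_eq s_coeff)
        also have "\<dots> = (\<Sum>\<alpha>\<in>G \<union> F. (norm (fock_coeff f \<alpha>))\<^sup>2) - (\<Sum>\<alpha>\<in>F. (norm (fock_coeff f \<alpha>))\<^sup>2)"
          using G F sum_diff[of "G \<union> F" F "\<lambda>\<alpha>. (norm (fock_coeff f \<alpha>))\<^sup>2"]
          by (simp add: Un_Diff)
        also have "\<dots> \<le> (\<Sum>\<^sub>\<infinity>\<alpha>. (norm (fock_coeff f \<alpha>))\<^sup>2) - (\<Sum>\<alpha>\<in>F. (norm (fock_coeff f \<alpha>))\<^sup>2)"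
          using G F summable by (intro diff_right_mono finite_sum_le_infsum) auto
        also have "\<dots> \<le> (e / 2)\<^sup>2"
          using F by (simp add: dist_real_def)
        finally show "(\<Sum>\<alpha>\<in>G. (norm (fock_coeff (s F - f) \<alpha>))\<^sup>2) \<le> (e / 2)\<^sup>2" .
      qed (use \<open>e > 0\<close> in simp)
      then show "\<exists>y\<in>csubspace hull ?X. dist y f < e"
        using s_in[OF F(1)] \<open>e > 0\<close> by (intro bexI[of _ "s F"]) (auto simp: dist_norm)
    qed
  qed
qed

text \<open>The operator \<open>I \<otimes> U\<close>.\<close>

definition fock_map :: "('a :: complex_inner \<Rightarrow> 'b :: complex_inner) \<Rightarrow> ('d, 'a) fock \<Rightarrow> ('d, 'b) fock"
  where "fock_map U f = Abs_fock (\<lambda>\<alpha>. U (fock_coeff f \<alpha>))"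


section \<open>Multi-analytic operators\<close>

definition multi_analytic ::
    "'a :: complex_inner set \<Rightarrow> 'b :: complex_inner set \<Rightarrow> (('d, 'a) fock \<Rightarrow> ('d, 'b) fock) \<Rightarrow> bool"
  where "multi_analytic D L M \<longleftrightarrow>
    bounded_op (fock_on D) (fock_on L) M \<and>
    (\<forall>j. \<forall>f\<in>fock_on D. M (creation j f) = creation j (M f))"

definition contractive :: "'a :: complex_inner set \<Rightarrow> ('a \<Rightarrow> 'b :: complex_inner) \<Rightarrow> bool"
  where "contractive S f \<longleftrightarrow> (\<forall>x\<in>S. norm (f x) \<le> norm x)"

definition symbol ::
    "(('d, 'a :: complex_inner) fock \<Rightarrow> ('d, 'b :: complex_inner) fock) \<Rightarrow> 'a \<Rightarrow> ('d, 'b) fock"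
  where "symbol M v = M (vacuum \<otimes>\<^sub>F v)"


section \<open>Row contractions and liftings\<close>

definition row_contraction :: "'a :: complex_inner set \<Rightarrow> ('d :: finite \<Rightarrow> 'a \<Rightarrow> 'a) \<Rightarrow> bool"
  where "row_contraction H T \<longleftrightarrow>
    (\<forall>j. bounded_op H H (T j)) \<and> op_le H (\<lambda>x. \<Sum>j\<in>UNIV. T j (adj H H (T j) x)) (\<lambda>x. x)"

definition column_space :: "'a :: complex_inner set \<Rightarrow> ('a ^ 'd :: finite) set"
  where "column_space H = {x. \<forall>i. x $ i \<in> H}"

definition defect_op ::
    "'a :: complex_inner set \<Rightarrow> ('d :: finite \<Rightarrow> 'a \<Rightarrow> 'a) \<Rightarrow> 'a ^ 'd \<Rightarrow> 'a ^ 'd"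
  where "defect_op H T = op_sqrt (column_space H)
    (\<lambda>x. \<chi> i. \<Sum>j\<in>UNIV. (if i = j then x $ j else 0) - adj H H (T i) (T j (x $ j)))"

definition defect_space ::
    "'a :: complex_inner set \<Rightarrow> ('d :: finite \<Rightarrow> 'a \<Rightarrow> 'a) \<Rightarrow> ('a ^ 'd) set"
  where "defect_space H T = closure (defect_op H T ` column_space H)"

definition lifting ::
    "'c :: complex_inner set \<Rightarrow> 'a :: complex_inner set \<Rightarrow> ('d \<Rightarrow> 'c \<Rightarrow> 'c) \<Rightarrow> ('d \<Rightarrow> 'c \<times> 'a \<Rightarrow> 'c \<times> 'a) \<Rightarrow> bool"
  where "lifting HC HA C E \<longleftrightarrow> closed_csubspace HA \<and>
    (\<exists>B A. (\<forall>j. bounded_op HC HA (B j)) \<and> (\<forall>j. bounded_op HA HA (A j)) \<and>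
      (\<forall>j. \<forall>h\<in>HC. \<forall>a\<in>HA. E j (h, a) = (C j h, B j h + A j a)))"

definition contractive_lifting ::
    "'c :: complex_inner set \<Rightarrow> 'a :: complex_inner set \<Rightarrow> ('d :: finite \<Rightarrow> 'c \<Rightarrow> 'c) \<Rightarrow>
      ('d \<Rightarrow> 'c \<times> 'a \<Rightarrow> 'c \<times> 'a) \<Rightarrow> bool"
  where "contractive_lifting HC HA C E \<longleftrightarrow> lifting HC HA C E \<and> row_contraction (HC \<times> HA) E"

definition minimal_lifting ::
    "'c :: complex_inner set \<Rightarrow> 'a :: complex_inner set \<Rightarrow> ('d \<Rightarrow> 'c \<times> 'a \<Rightarrow> 'c \<times> 'a) \<Rightarrow> bool"
  where "minimal_lifting HC HA E \<longleftrightarrow>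
    (\<lambda>S. closed_csubspace S \<and> S \<subseteq> HC \<times> HA \<and> (\<forall>j. E j ` S \<subseteq> S)) hull (HC \<times> {0}) = HC \<times> HA"


section \<open>Isometric dilations\<close>

text \<open>\<open>T\<^sub>\<alpha> = T\<^bsub>\<alpha>\<^sub>1\<^esub> \<cdots> T\<^bsub>\<alpha>\<^sub>m\<^esub>\<close> for a word \<open>\<alpha>\<close>.\<close>

definition word_op :: "('d \<Rightarrow> 'a \<Rightarrow> 'a) \<Rightarrow> 'd list \<Rightarrow> 'a \<Rightarrow> 'a"
  where "word_op T \<alpha> = foldr (\<lambda>j g. T j \<circ> g) \<alpha> id"

text \<open>The minimal isometric dilation \<open>V\<^sup>T\<close> on \<open>H \<oplus> (\<Gamma> \<otimes> defect_space H T)\<close>.\<close>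

definition min_dilation ::
    "'a :: complex_inner set \<Rightarrow> ('d :: finite \<Rightarrow> 'a \<Rightarrow> 'a) \<Rightarrow>
      'd \<Rightarrow> 'a \<times> ('d, 'a ^ 'd) fock \<Rightarrow> 'a \<times> ('d, 'a ^ 'd) fock"
  where "min_dilation H T j =
    (\<lambda>(h, \<eta>). (T j h, vacuum \<otimes>\<^sub>F defect_op H T (axis j h) + creation j \<eta>))"

text \<open>
  In the following, \<open>V\<close> is an isometric dilation of the tuple \<open>T\<close> on \<open>H\<close>, where \<open>\<iota>\<close> embeds \<open>H\<close>
  into the space of \<open>V\<close>.
\<close>

definition wandering ::
    "'a :: complex_inner set \<Rightarrow> ('a \<Rightarrow> 'v :: complex_inner) \<Rightarrow> ('d \<Rightarrow> 'v \<Rightarrow> 'v) \<Rightarrow> 'v set"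
  where "wandering H \<iota> V = closed_cspan (\<iota> ` H \<union> (\<Union>j. V j ` \<iota> ` H)) \<ominus> \<iota> ` H"

definition wandering_sum ::
    "'a :: complex_inner set \<Rightarrow> ('a \<Rightarrow> 'v :: complex_inner) \<Rightarrow> ('d \<Rightarrow> 'v \<Rightarrow> 'v) \<Rightarrow> 'v set"
  where "wandering_sum H \<iota> V = closed_cspan (\<Union>\<alpha>. word_op V \<alpha> ` wandering H \<iota> V)"

definition canonical_kappa ::
    "'a :: complex_inner set \<Rightarrow> ('d :: finite \<Rightarrow> 'a \<Rightarrow> 'a) \<Rightarrow> ('a \<Rightarrow> 'v :: complex_inner) \<Rightarrow>
      ('d \<Rightarrow> 'v \<Rightarrow> 'v) \<Rightarrow> 'a ^ 'd \<Rightarrow> 'v"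
  where "canonical_kappa H T \<iota> V = (SOME \<kappa>.
    unitary_op (defect_space H T) (wandering H \<iota> V) \<kappa> \<and>
    (\<forall>\<xi>\<in>column_space H. \<kappa> (defect_op H T \<xi>) = (\<Sum>i\<in>UNIV. V i (\<iota> (\<xi> $ i)) - \<iota> (T i (\<xi> $ i)))))"

definition canonical_K ::
    "'a :: complex_inner set \<Rightarrow> ('d :: finite \<Rightarrow> 'a \<Rightarrow> 'a) \<Rightarrow> ('a \<Rightarrow> 'v :: complex_inner) \<Rightarrow>
      ('d \<Rightarrow> 'v \<Rightarrow> 'v) \<Rightarrow> ('d, 'a ^ 'd) fock \<Rightarrow> 'v"
  where "canonical_K H T \<iota> V = (SOME K.
    unitary_op (fock_on (defect_space H T)) (wandering_sum H \<iota> V) K \<and>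
    (\<forall>\<alpha>. \<forall>\<delta>\<in>defect_space H T.
      K (word_op creation \<alpha> (vacuum \<otimes>\<^sub>F \<delta>)) = word_op V \<alpha> (canonical_kappa H T \<iota> V \<delta>)))"


section \<open>The characteristic function of a lifting\<close>

definition char_fun ::
    "'c :: complex_inner set \<Rightarrow> 'a :: complex_inner set \<Rightarrow> ('d :: finite \<Rightarrow> 'c \<Rightarrow> 'c) \<Rightarrow>
      ('d \<Rightarrow> 'c \<times> 'a \<Rightarrow> 'c \<times> 'a) \<Rightarrow> ('d, ('c \<times> 'a) ^ 'd) fock \<Rightarrow> ('d, 'c ^ 'd) fock"
  where "char_fun HC HA C E f =
    (let V = min_dilation (HC \<times> HA) E;
         \<iota>E = (\<lambda>x. (x, 0));
         \<iota>C = (\<lambda>h. ((h, 0), 0));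
         R = wandering_sum HC \<iota>C V
     in adj (fock_on (defect_space HC C)) R (canonical_K HC C \<iota>C V)
          (proj R (canonical_K (HC \<times> HA) E \<iota>E V f)))"


section \<open>The lifting associated with a multi-analytic operator\<close>

text \<open>Throughout, \<open>M : \<Gamma> \<otimes> D \<rightarrow> \<Gamma> \<otimes> L\<close>, where \<open>L\<close> will be the defect space of \<open>C\<close>.\<close>

definition model_defect ::
    "'e :: complex_inner set \<Rightarrow> 'l :: complex_inner set \<Rightarrow> (('d, 'e) fock \<Rightarrow> ('d, 'l) fock) \<Rightarrow>
      ('d, 'e) fock \<Rightarrow> ('d, 'e) fock"
  where "model_defect D L M =
    op_sqrt (fock_on D) (\<lambda>\<xi>. \<xi> - adj (fock_on D) (fock_on L) M (M \<xi>))"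

definition model_space ::
    "'e :: complex_inner set \<Rightarrow> 'l :: complex_inner set \<Rightarrow> (('d, 'e) fock \<Rightarrow> ('d, 'l) fock) \<Rightarrow>
      (('d, 'l) fock \<times> ('d, 'e) fock) set"
  where "model_space D L M = fock_on L \<times> closure (model_defect D L M ` fock_on D)"

definition model_shift ::
    "'e :: complex_inner set \<Rightarrow> 'l :: complex_inner set \<Rightarrow> (('d, 'e) fock \<Rightarrow> ('d, 'l) fock) \<Rightarrow>
      'd \<Rightarrow> ('d, 'l) fock \<times> ('d, 'e) fock \<Rightarrow> ('d, 'l) fock \<times> ('d, 'e) fock"
  where "model_shift D L M j = (SOME V.
    bounded_op (model_space D L M) (model_space D L M) V \<and>
    (\<forall>\<eta>\<in>fock_on L. \<forall>\<xi>\<in>fock_on D.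
      V (\<eta>, model_defect D L M \<xi>) = (creation j \<eta>, model_defect D L M (creation j \<xi>))))"

definition model_W ::
    "'e :: complex_inner set \<Rightarrow> 'l :: complex_inner set \<Rightarrow> (('d, 'e) fock \<Rightarrow> ('d, 'l) fock) \<Rightarrow>
      ('d, 'e) fock \<Rightarrow> ('d, 'l) fock \<times> ('d, 'e) fock"
  where "model_W D L M \<xi> = (M \<xi>, model_defect D L M \<xi>)"

definition model_HA ::
    "'e :: complex_inner set \<Rightarrow> 'l :: complex_inner set \<Rightarrow> (('d, 'e) fock \<Rightarrow> ('d, 'l) fock) \<Rightarrow>
      (('d, 'l) fock \<times> ('d, 'e) fock) set"
  where "model_HA D L M = model_space D L M \<ominus> model_W D L M ` fock_on D"

text \<open>
  The row isometry on \<open>HC \<oplus> model_space D L M\<close> that restricts to \<^const>\<open>min_dilation\<close> for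
  \<open>\<zeta> = 0\<close> and to \<^const>\<open>model_shift\<close> for \<open>h = 0\<close> (the two agree on the common part \<open>\<Gamma> \<otimes> L\<close>).
\<close>

definition model_dilation ::
    "'c :: complex_inner set \<Rightarrow> ('d :: finite \<Rightarrow> 'c \<Rightarrow> 'c) \<Rightarrow> 'e :: complex_inner set \<Rightarrow>
      (('d, 'e) fock \<Rightarrow> ('d, 'c ^ 'd) fock) \<Rightarrow>
      'd \<Rightarrow> 'c \<times> ('d, 'c ^ 'd) fock \<times> ('d, 'e) fock \<Rightarrow> 'c \<times> ('d, 'c ^ 'd) fock \<times> ('d, 'e) fock"
  where "model_dilation HC C D M j = (\<lambda>(h, \<eta>, \<zeta>).
    let (h', \<eta>') = min_dilation HC C j (h, \<eta>)
    in (h', (\<eta>', 0) + model_shift D (defect_space HC C) M j (0, \<zeta>)))"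

definition lifting_of ::
    "'c :: complex_inner set \<Rightarrow> ('d :: finite \<Rightarrow> 'c \<Rightarrow> 'c) \<Rightarrow> 'e :: complex_inner set \<Rightarrow>
      (('d, 'e) fock \<Rightarrow> ('d, 'c ^ 'd) fock) \<Rightarrow>
      'd \<Rightarrow> 'c \<times> ('d, 'c ^ 'd) fock \<times> ('d, 'e) fock \<Rightarrow> 'c \<times> ('d, 'c ^ 'd) fock \<times> ('d, 'e) fock"
  where "lifting_of HC C D M j x =
    proj (HC \<times> model_HA D (defect_space HC C) M) (model_dilation HC C D M j x)"

text \<open>
  \<open>M\<close> is the characteristic function of \<open>E = lifting_of HC C D M\<close>: with \<open>\<kappa>\<^sub>E\<close> taken in the space of
  \<^const>\<open>model_dilation\<close>, which contains the space of \<open>E\<close>, \<open>U\<close> is the unitary from \<open>D\<close> to the defect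
  space of \<open>E\<close> given by \<open>\<kappa>\<^sub>E (U \<delta>) = W (e\<^sub>\<emptyset> \<otimes> \<delta>)\<close>.
\<close>

definition is_char_fun_of_lifting ::
    "'c :: complex_inner set \<Rightarrow> ('d :: finite \<Rightarrow> 'c \<Rightarrow> 'c) \<Rightarrow> 'e :: complex_inner set \<Rightarrow>
      (('d, 'e) fock \<Rightarrow> ('d, 'c ^ 'd) fock) \<Rightarrow> bool"
  where "is_char_fun_of_lifting HC C D M \<longleftrightarrow>
    (let L = defect_space HC C;
         HA = model_HA D L M;
         E = lifting_of HC C D M;
         V = model_dilation HC C D M;
         DE = defect_space (HC \<times> HA) E;
         w = (\<lambda>\<delta>. (0, model_W D L M (vacuum \<otimes>\<^sub>F \<delta>)))
     in wandering (HC \<times> HA) id V = w ` D \<and>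
        (\<exists>U. unitary_op D DE U \<and>
             (\<forall>\<delta>\<in>D. canonical_kappa (HC \<times> HA) E id V (U \<delta>) = w \<delta>) \<and>
             (\<forall>\<xi>\<in>fock_on D. char_fun HC HA C E (fock_map U \<xi>) = M \<xi>)))"

end

(*
  For E, a vector l of the wandering subspace of the minimal isometric dilation V is orthogonal to
  every V_j E_alpha h - V_j V_alpha h. If the symbol of the characteristic function kills the
  vector of the defect space that corresponds to l, then l is also orthogonal to all V_alpha h with
  h in H_C, hence to all V_j E_alpha h; minimality of the lifting makes l orthogonal to V_j H_E, so
  l = 0.

  Conversely, in the model space the vectors W(e (x) delta) contain the wandering subspace of E.
  One that is orthogonal to it is orthogonal to all V_alpha h with h in H_C, so its first component
  M(e (x) delta) vanishes, and delta = 0 because the symbol is injective. The inner products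
  (V_alpha x, V_beta y) with x, y in H_E are the same in every isometric dilation of E, so the
  characteristic function may be computed in the model space, where it is M.
*)

theory Submission
  imports Defs
begin

section \<open>Complex inner products and closed subspaces\<close>

text \<open>The objects \<open>op_sqrt\<close>, \<open>model_shift\<close>,
  \<open>canonical_kappa\<close> and \<open>canonical_K\<close> are fixed by a choice, so only their
  defining relations are available. This shapes the proof: everything is reduced to inner products
  of generators. Equal Gram matrices produce every unitary (\<open>unitary_op_Gram\<close>), and a
  defect operator enters only through <D x, D y> = <x, y> - <T x, T y>. The link between words and
  characteristic functions is that kappa_C sends D_C(axis i h) to V_i h - C_i h. Hence the vectors
  V_\<alpha> h, with h in H_C, generate H_C together with the range of K_C. Orthogonality to that
  range, which is what vanishing of the symbol says, therefore becomes orthogonality to all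
  V_\<alpha> h by induction on the word. The obstacle in the converse is that
  \<open>char_fun\<close> lives in the space of \<open>min_dilation\<close>, while the convention
  normalizes kappa_E in the space of \<open>model_dilation\<close>. Instead of a unitary between the
  two spaces, only inner products are compared: both K_E(e_\<alpha> \<otimes> \<delta>) and
  K_C(e_\<beta> \<otimes> D_C(axis i h)) come from vectors V_\<gamma> x with x in H_E, whose Gram
  matrix depends on E alone.\<close>

lemma scaleC_minus_one [simp]: "(-1) *\<^sub>C (x :: 'a :: complex_inner) = - x"
  using scaleC_of_real[of "-1" x] by simp

lemma scaleC_minus_right: "a *\<^sub>C (- x :: 'a :: complex_inner) = - (a *\<^sub>C x)"
  using scaleC_add_right[of a x "- x"] by (simp add: eq_neg_iff_add_eq_0 add.commute)

lemma scaleC_diff_right: "a *\<^sub>C (x - y :: 'a :: complex_inner) = a *\<^sub>C x - a *\<^sub>C y"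
  using scaleC_add_right[of a x "- y"] by (simp add: scaleC_minus_right)

lemma scaleC_sum_right: "a *\<^sub>C (\<Sum>i\<in>I. f i :: 'a :: complex_inner) = (\<Sum>i\<in>I. a *\<^sub>C f i)"
  by (induction I rule: infinite_finite_induct) (auto simp: scaleC_add_right)

lemma cinner_add_right: "cinner (x :: 'a :: complex_inner) (y + z) = cinner x y + cinner x z"
  by (metis cinner_commute cinner_add_left complex_cnj_add)

lemma cinner_zero_left [simp]: "cinner 0 (x :: 'a :: complex_inner) = 0"
  using cinner_scaleC_left[of 0 0 x] by simp

lemma cinner_zero_right [simp]: "cinner (x :: 'a :: complex_inner) 0 = 0"
  using cinner_scaleC_right[of x 0 0] by simp

lemma cinner_minus_left [simp]: "cinner (- x :: 'a :: complex_inner) y = - cinner x y"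
  using cinner_scaleC_left[of "-1" x y] by simp

lemma cinner_minus_right [simp]: "cinner (x :: 'a :: complex_inner) (- y) = - cinner x y"
  using cinner_scaleC_right[of x "-1" y] by simp

lemma cinner_diff_left: "cinner (x - y :: 'a :: complex_inner) z = cinner x z - cinner y z"
  using cinner_add_left[of x "- y" z] by simp

lemma cinner_diff_right: "cinner (x :: 'a :: complex_inner) (y - z) = cinner x y - cinner x z"
  using cinner_add_right[of x y "- z"] by simp

lemma cinner_sum_left: "cinner (\<Sum>i\<in>I. f i :: 'a :: complex_inner) y = (\<Sum>i\<in>I. cinner (f i) y)"
  by (induction I rule: infinite_finite_induct) (auto simp: cinner_add_left)

lemma cinner_sum_right: "cinner (y :: 'a :: complex_inner) (\<Sum>i\<in>I. f i) = (\<Sum>i\<in>I. cinner y (f i))"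
  by (induction I rule: infinite_finite_induct) (auto simp: cinner_add_right)

lemma cinner_scaleR_left: "cinner (r *\<^sub>R x :: 'a :: complex_inner) y = of_real r * cinner x y"
  by (simp only: cinner_scaleC_left flip: scaleC_of_real)

lemma cinner_scaleR_right: "cinner (x :: 'a :: complex_inner) (r *\<^sub>R y) = of_real r * cinner x y"
  by (simp only: cinner_scaleC_right complex_cnj_complex_of_real flip: scaleC_of_real)

lemma cinner_self_eq_0 [simp]: "cinner (x :: 'a :: complex_inner) x = 0 \<longleftrightarrow> x = 0"
  by (simp add: cinner_self)

lemma cinner_eq_0_sym: "cinner (x :: 'a :: complex_inner) y = 0 \<longleftrightarrow> cinner y x = 0"
  by (metis cinner_commute complex_cnj_zero)

text \<open>The unimodular factor \<open>a\<close> rotates the inner product to a nonnegative real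
  number without changing the norm of \<open>x\<close>, which leaves the real Cauchy-Schwarz
  inequality.\<close>

lemma cmod_cinner_le: "cmod (cinner (x :: 'a :: complex_inner) y) \<le> norm x * norm y"
proof (cases "cinner x y = 0")
  case False
  define a where "a = cnj (sgn (cinner x y))"
  have a: "cmod a = 1"
    using False by (simp add: a_def norm_sgn)
  have "a * cinner x y = complex_of_real (cmod (cinner x y))"
    using False by (simp add: a_def sgn_eq mult.commute[of "cnj _"] flip: complex_norm_square)
      (simp add: power2_eq_square)
  then have "cmod (cinner x y) = Re (cinner (a *\<^sub>C x) y)"
    by (simp add: cinner_scaleC_left)
  also have "\<dots> \<le> norm (a *\<^sub>C x) * norm y"
    by (simp only: Re_cinner norm_cauchy_schwarz)
  finally show ?thesis
    by (simp add: a)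
qed simp

lemma bounded_linear_cinner_left: "bounded_linear (\<lambda>x. cinner x (y :: 'a :: complex_inner))"
proof (rule bounded_linear_intro[where K = "norm y"])
  show "cinner (r *\<^sub>R x) y = r *\<^sub>R cinner x y" for r x
    by (simp add: scaleR_conv_of_real cinner_scaleC_left flip: scaleC_of_real)
qed (simp_all add: cinner_add_left cmod_cinner_le)

lemma bounded_linear_cinner_right: "bounded_linear (\<lambda>y. cinner (x :: 'a :: complex_inner) y)"
proof (rule bounded_linear_intro[where K = "norm x"])
  show "cinner x (r *\<^sub>R y) = r *\<^sub>R cinner x y" for r y
    by (simp add: scaleR_conv_of_real cinner_scaleC_right flip: scaleC_of_real)
qed (simp_all add: cinner_add_right cmod_cinner_le mult.commute[of _ "norm x"])

lemmas tendsto_cinner_left = bounded_linear.tendsto[OF bounded_linear_cinner_left]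
lemmas tendsto_cinner_right = bounded_linear.tendsto[OF bounded_linear_cinner_right]

lemma bounded_linear_scaleC: "bounded_linear (\<lambda>x :: 'a :: complex_inner. a *\<^sub>C x)"
proof (rule bounded_linear_intro[where K = "cmod a"])
  show "a *\<^sub>C r *\<^sub>R x = r *\<^sub>R a *\<^sub>C x" for r and x :: 'a
    by (simp add: scaleC_scaleC mult.commute flip: scaleC_of_real)
qed (simp_all add: scaleC_add_right)

lemma csubspace_0: "csubspace S \<Longrightarrow> 0 \<in> S"
  and csubspace_add: "csubspace S \<Longrightarrow> x \<in> S \<Longrightarrow> y \<in> S \<Longrightarrow> x + y \<in> S"
  and csubspace_scaleC: "csubspace S \<Longrightarrow> x \<in> S \<Longrightarrow> a *\<^sub>C x \<in> S"
  by (auto simp: csubspace_def)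

lemma csubspace_scaleR: "csubspace S \<Longrightarrow> x \<in> S \<Longrightarrow> r *\<^sub>R x \<in> S"
  using csubspace_scaleC[of S x "complex_of_real r"] by (simp add: scaleC_of_real)

lemma csubspace_minus: "csubspace S \<Longrightarrow> x \<in> S \<Longrightarrow> - x \<in> S"
  using csubspace_scaleC[of S x "-1"] by simp

lemma csubspace_diff: "csubspace S \<Longrightarrow> x \<in> S \<Longrightarrow> y \<in> S \<Longrightarrow> x - y \<in> S"
  using csubspace_add[of S x "- y"] csubspace_minus[of S y] by simp

lemma csubspace_sum: "csubspace S \<Longrightarrow> (\<And>i. i \<in> I \<Longrightarrow> f i \<in> S) \<Longrightarrow> (\<Sum>i\<in>I. f i) \<in> S"
  by (induction I rule: infinite_finite_induct) (auto intro: csubspace_0 csubspace_add)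

lemma csubspace_UNIV [simp]: "csubspace UNIV"
  by (simp add: csubspace_def)

lemma closed_csubspace_csubspace: "closed_csubspace S \<Longrightarrow> csubspace S"
  and closed_csubspace_closed: "closed_csubspace S \<Longrightarrow> closed S"
  by (simp_all add: closed_csubspace_def)

lemma csubspace_Int: "csubspace S \<Longrightarrow> csubspace T \<Longrightarrow> csubspace (S \<inter> T)"
  by (simp add: csubspace_def)

lemma closed_csubspace_Int: "closed_csubspace S \<Longrightarrow> closed_csubspace T \<Longrightarrow> closed_csubspace (S \<inter> T)"
  by (simp add: closed_csubspace_def csubspace_Int closed_Int)

lemma csubspace_Times: "csubspace S \<Longrightarrow> csubspace T \<Longrightarrow> csubspace (S \<times> T)"
  by (auto simp: csubspace_def scaleC_prod_def zero_prod_def)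

lemma closed_csubspace_Times: "closed_csubspace S \<Longrightarrow> closed_csubspace T \<Longrightarrow> closed_csubspace (S \<times> T)"
  by (simp add: closed_csubspace_def csubspace_Times closed_Times)

lemma closed_csubspace_fock_on: "closed_csubspace D \<Longrightarrow> closed_csubspace (fock_on D)"
  by (simp add: closed_csubspace_def csubspace_fock_on closed_fock_on)

lemma closed_csubspace_orthogonal: "closed_csubspace {x. \<forall>y\<in>Y. cinner x y = 0}"
proof -
  have "closed {x. cinner x y = 0}" for y :: 'a
    by (intro closed_Collect_eq continuous_intros
        linear_continuous_on bounded_linear_cinner_left)
  then have "closed {x :: 'a. \<forall>y. y \<in> Y \<longrightarrow> cinner x y = 0}"
    by (intro closed_Collect_all closed_Collect_imp) auto
  then show ?thesis
    by (auto simp: closed_csubspace_def csubspace_def cinner_add_left cinner_scaleC_left Ball_def)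
qed

lemma closed_csubspace_ominus: "closed_csubspace S \<Longrightarrow> closed_csubspace (S \<ominus> Y)"
  using closed_csubspace_Int[OF _ closed_csubspace_orthogonal[of Y], of S]
  by (simp add: ominus_def Int_def)

lemma csubspace_hull: "csubspace (csubspace hull X)"
  by (rule hull_in) (auto simp: csubspace_def)

lemma csubspace_closure:
  fixes S :: "'a :: complex_inner set"
  assumes "csubspace S"
  shows "csubspace (closure S)"
  unfolding csubspace_def
proof (intro conjI ballI allI)
  show "0 \<in> closure S"
    using csubspace_0[OF assms] closure_subset by blast
next
  fix x y
  assume "x \<in> closure S" "y \<in> closure S"
  then obtain f g where "\<forall>n. f n \<in> S" "f \<longlonglongrightarrow> x" "\<forall>n. g n \<in> S" "g \<longlonglongrightarrow> y"
    by (auto simp: closure_sequential)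
  then show "x + y \<in> closure S"
    unfolding closure_sequential
    by (intro exI[of _ "\<lambda>n. f n + g n"] conjI tendsto_add allI csubspace_add[OF assms]) auto
next
  fix a x
  assume "x \<in> closure S"
  then obtain f where "\<forall>n. f n \<in> S" "f \<longlonglongrightarrow> x"
    by (auto simp: closure_sequential)
  then show "a *\<^sub>C x \<in> closure S"
    unfolding closure_sequential
    by (intro exI[of _ "\<lambda>n. a *\<^sub>C f n"] conjI allI csubspace_scaleC[OF assms]
        bounded_linear.tendsto[OF bounded_linear_scaleC]) auto
qed

lemma closed_csubspace_closed_cspan: "closed_csubspace (closed_cspan X)"
  by (simp add: closed_cspan_def closed_csubspace_def csubspace_closure csubspace_hull)

lemma closed_cspan_superset: "X \<subseteq> closed_cspan X"
  unfolding closed_cspan_def using hull_subset[of X csubspace] closure_subset by blast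

lemma closed_cspan_minimal: "X \<subseteq> S \<Longrightarrow> closed_csubspace S \<Longrightarrow> closed_cspan X \<subseteq> S"
  unfolding closed_cspan_def closed_csubspace_def
  by (intro closure_minimal hull_minimal) auto

lemma closed_cspan_closed_csubspace: "closed_csubspace S \<Longrightarrow> closed_cspan S = S"
  using closed_cspan_superset[of S] closed_cspan_minimal[OF order_refl] by blast

lemma closed_cspan_eq_closure: "csubspace X \<Longrightarrow> closed_cspan X = closure X"
  by (simp add: closed_cspan_def hull_same)

lemma closed_cspan_cinner_eq_0:
  assumes "z \<in> closed_cspan X" "\<And>x. x \<in> X \<Longrightarrow> cinner x y = 0"
  shows "cinner z y = 0"
  using closed_cspan_minimal[OF _ closed_csubspace_orthogonal[of "{y}"], of X] assms by auto

lemma closed_cspan_orthogonal_self: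
  assumes "z \<in> closed_cspan X" "\<And>x. x \<in> X \<Longrightarrow> cinner x z = 0"
  shows "z = 0"
  using closed_cspan_cinner_eq_0[OF assms(1), of z] assms(2) by simp

section \<open>Orthogonal projections and the representation of functionals\<close>

lemma projection_exists:
  fixes S :: "'a :: chilbert_space set"
  assumes S: "closed_csubspace S"
  shows "\<exists>p\<in>S. \<forall>y\<in>S. cinner (x - p) y = 0"
proof -
  note sub = closed_csubspace_csubspace[OF S]
  have ne: "S \<noteq> {}"
    using csubspace_0[OF sub] by auto
  define d where "d = infdist x S"
  have d: "d \<le> norm (x - y)" if "y \<in> S" for y
    using infdist_le[OF that, of x] by (simp add: d_def dist_norm)
  have d0: "0 \<le> d"
    by (simp add: d_def infdist_nonneg)
  have "\<exists>y\<in>S. norm (x - y) < d + 1 / Suc n" for n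
  proof (rule ccontr)
    assume "\<not> ?thesis"
    then have "d + 1 / Suc n \<le> d"
      unfolding d_def infdist_notempty[OF ne]
      by (intro cINF_greatest ne) (auto simp: dist_norm d_def infdist_notempty[OF ne] not_less)
    then show False
      by simp
  qed
  then obtain y where y: "\<And>n. y n \<in> S" "\<And>n. norm (x - y n) < d + 1 / Suc n"
    by metis
  have lim_d: "(\<lambda>n. d + 1 / real (Suc n)) \<longlonglongrightarrow> d"
    using tendsto_add[OF tendsto_const LIMSEQ_Suc[OF lim_1_over_n], of d] by simp
  have lim: "(\<lambda>n. norm (x - y n)) \<longlonglongrightarrow> d"
    by (intro tendsto_sandwich[OF _ _ tendsto_const lim_d] always_eventually allI d y less_imp_le)
  \<comment> \<open>The midpoint of \<open>y m\<close> and \<open>y n\<close> lies in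
    \<open>S\<close>, hence at distance at least \<open>d\<close> from \<open>x\<close>; the
    parallelogram law then bounds \<open>y m - y n\<close> by the excess of both distances over
    \<open>d\<close>.\<close>
  have par: "(norm (y m - y n))\<^sup>2 \<le> 2 * ((norm (x - y m))\<^sup>2 - d\<^sup>2) + 2 * ((norm (x - y n))\<^sup>2 - d\<^sup>2)" for m n
  proof -
    have "d \<le> norm (x - (1 / 2) *\<^sub>R (y m + y n))"
      by (intro d csubspace_scaleR csubspace_add sub y)
    then have "(2 * d)\<^sup>2 \<le> (norm (2 *\<^sub>R (x - (1 / 2) *\<^sub>R (y m + y n))))\<^sup>2"
      using d0 by (intro power_mono) auto
    also have "2 *\<^sub>R (x - (1 / 2) *\<^sub>R (y m + y n)) = (x - y m) + (x - y n)"
      by (simp add: algebra_simps scaleR_2)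
    also have "(norm ((x - y m) + (x - y n)))\<^sup>2 =
        2 * (norm (x - y m))\<^sup>2 + 2 * (norm (x - y n))\<^sup>2 - (norm (y m - y n))\<^sup>2"
      by (simp add: power2_norm_eq_inner algebra_simps inner_commute)
    finally show ?thesis
      by (simp add: power_mult_distrib)
  qed
  have "Cauchy y"
    unfolding Cauchy_iff
  proof (intro allI impI)
    fix e :: real
    assume "e > 0"
    have "(\<lambda>n. 4 * ((norm (x - y n))\<^sup>2 - d\<^sup>2)) \<longlonglongrightarrow> 4 * (d\<^sup>2 - d\<^sup>2)"
      by (intro tendsto_intros lim)
    then have "\<forall>\<^sub>F n in sequentially. 4 * ((norm (x - y n))\<^sup>2 - d\<^sup>2) < e\<^sup>2"
      by (rule order_tendstoD) (use \<open>e > 0\<close> in simp)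
    then obtain N where N: "\<And>n. n \<ge> N \<Longrightarrow> 4 * ((norm (x - y n))\<^sup>2 - d\<^sup>2) < e\<^sup>2"
      by (auto simp: eventually_sequentially)
    have "norm (y m - y n) < e" if "m \<ge> N" "n \<ge> N" for m n
    proof (rule power2_less_imp_less)
      show "(norm (y m - y n))\<^sup>2 < e\<^sup>2"
        using par[of m n] N[OF that(1)] N[OF that(2)] by simp
    qed (use \<open>e > 0\<close> in simp)
    then show "\<exists>M. \<forall>m\<ge>M. \<forall>n\<ge>M. norm (y m - y n) < e"
      by blast
  qed
  then obtain p where p: "y \<longlonglongrightarrow> p"
    by (auto simp: Cauchy_convergent_iff convergent_def)
  have pS: "p \<in> S"
    using closed_sequentially[OF closed_csubspace_closed[OF S] _ p] y by blast
  have "(\<lambda>n. norm (x - y n)) \<longlonglongrightarrow> norm (x - p)"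
    by (intro tendsto_intros p)
  with lim have pd: "norm (x - p) = d"
    using LIMSEQ_unique by blast
  have inner0: "inner (x - p) z = 0" if "z \<in> S" for z
  proof (cases "z = 0")
    case False
    \<comment> \<open>This \<open>t\<close> minimizes the squared distance from \<open>x\<close> to
      \<open>p + t *\<^sub>R z\<close>; comparison with \<open>p\<close> itself forces the inner
      product to vanish.\<close>
    define t where "t = inner (x - p) z / (norm z)\<^sup>2"
    have "(norm (x - p))\<^sup>2 \<le> (norm (x - (p + t *\<^sub>R z)))\<^sup>2"
      unfolding pd by (intro power_mono d csubspace_add csubspace_scaleR sub pS that d0)
    also have "\<dots> = (norm (x - p))\<^sup>2 - 2 * t * inner (x - p) z + t\<^sup>2 * (norm z)\<^sup>2"
      using power2_norm_eq_inner[of "(x - p) - t *\<^sub>R z"] power2_norm_eq_inner[of "x - p"]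
        power2_norm_eq_inner[of z]
      by (simp add: diff_diff_eq) (simp add: inner_commute power2_eq_square algebra_simps)
    also have "t\<^sup>2 * (norm z)\<^sup>2 = t * inner (x - p) z"
      using False by (simp add: t_def power2_eq_square)
    finally have "t * inner (x - p) z \<le> 0"
      by simp
    then have "(inner (x - p) z)\<^sup>2 / (norm z)\<^sup>2 \<le> 0"
      by (simp add: t_def power2_eq_square)
    then show ?thesis
      using False by (simp add: divide_le_0_iff)
  qed simp
  \<comment> \<open>The imaginary part is the real inner product with
    \<open>\<i> *\<^sub>C z\<close>, again a vector of \<open>S\<close>.\<close>
  have "cinner (x - p) z = 0" if "z \<in> S" for z
    using inner0[OF that] inner0[OF csubspace_scaleC[OF sub that, of \<i>]]
    by (simp add: cinner_eq complex_eq_iff)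
  with pS show ?thesis
    by blast
qed

lemma proj_eqI:
  assumes "csubspace S" "p \<in> S" "\<And>y. y \<in> S \<Longrightarrow> cinner (x - p) y = 0"
  shows "proj S x = p"
  unfolding proj_def
proof (rule the_equality)
  fix q
  assume q: "q \<in> S \<and> (\<forall>y\<in>S. cinner (x - q) y = 0)"
  then have "q - p \<in> S"
    using assms by (simp add: csubspace_diff)
  then have "cinner (q - p) (q - p) = 0"
    using q assms(3)[of "q - p"] cinner_diff_left[of "x - p" "x - q" "q - p"] by simp
  then show "q = p"
    by simp
qed (use assms in blast)

context
  fixes S :: "'a :: chilbert_space set"
  assumes S: "closed_csubspace S"
begin

lemma proj_in: "proj S x \<in> S"
  and proj_cinner_diff: "y \<in> S \<Longrightarrow> cinner (x - proj S x) y = 0"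
  using projection_exists[OF S, of x] proj_eqI[OF closed_csubspace_csubspace[OF S]] by metis+

lemma cinner_proj_left: "y \<in> S \<Longrightarrow> cinner (proj S x) y = cinner x y"
  using proj_cinner_diff[of y x] by (simp add: cinner_diff_left)

lemma cinner_proj_right: "y \<in> S \<Longrightarrow> cinner y (proj S x) = cinner y x"
  by (metis cinner_commute cinner_proj_left)

lemma proj_add: "proj S (x + y) = proj S x + proj S y"
  by (intro proj_eqI closed_csubspace_csubspace[OF S] csubspace_add proj_in)
    (simp add: cinner_diff_left cinner_add_left cinner_proj_left)

lemma proj_scaleC: "proj S (a *\<^sub>C x) = a *\<^sub>C proj S x"
  by (intro proj_eqI closed_csubspace_csubspace[OF S] csubspace_scaleC proj_in)
    (simp add: cinner_diff_left cinner_scaleC_left cinner_proj_left)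

lemma norm_proj_le: "norm (proj S x) \<le> norm x"
proof -
  have "complex_of_real ((norm (proj S x))\<^sup>2) = cinner x (proj S x)"
    using cinner_proj_left[OF proj_in, of x x] by (simp add: cinner_self)
  then have "(norm (proj S x))\<^sup>2 = Re (cinner x (proj S x))"
    by (metis Re_complex_of_real)
  also have "\<dots> \<le> norm x * norm (proj S x)"
    by (simp only: Re_cinner norm_cauchy_schwarz)
  finally show ?thesis
    by (cases "proj S x = 0") (simp_all add: power2_eq_square)
qed

lemma proj_eq_0: "(\<And>y. y \<in> S \<Longrightarrow> cinner x y = 0) \<Longrightarrow> proj S x = 0"
  by (intro proj_eqI closed_csubspace_csubspace[OF S] csubspace_0) auto

end

text \<open>A vector of \<open>S\<close> minus its projection onto the closed span stays in
  \<open>S\<close> and is orthogonal to \<open>X\<close>. Most identifications of generated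
  subspaces below are reduced to this test.\<close>

lemma closed_cspan_eqI:
  fixes S :: "'a :: chilbert_space set"
  assumes S: "closed_csubspace S" and "X \<subseteq> S"
    and orth: "\<And>z. z \<in> S \<Longrightarrow> (\<And>x. x \<in> X \<Longrightarrow> cinner z x = 0) \<Longrightarrow> z = 0"
  shows "closed_cspan X = S"
proof
  show "closed_cspan X \<subseteq> S"
    using assms by (intro closed_cspan_minimal)
next
  note X = closed_csubspace_closed_cspan[of X]
  show "S \<subseteq> closed_cspan X"
  proof
    fix z
    assume "z \<in> S"
    then have "z - proj (closed_cspan X) z \<in> S"
      using closed_cspan_minimal[OF assms(2) S] proj_in[OF X]
      by (intro csubspace_diff closed_csubspace_csubspace[OF S]) auto
    then have "z - proj (closed_cspan X) z = 0"
      using closed_cspan_superset[of X] by (intro orth proj_cinner_diff[OF X]) auto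
    then show "z \<in> closed_cspan X"
      using proj_in[OF X, of z] by simp
  qed
qed

lemma closed_csubspace_eqI:
  fixes S :: "'a :: chilbert_space set"
  assumes "closed_csubspace S" "closed_csubspace X" "X \<subseteq> S"
    and "\<And>z. z \<in> S \<Longrightarrow> (\<And>x. x \<in> X \<Longrightarrow> cinner z x = 0) \<Longrightarrow> z = 0"
  shows "X = S"
  using closed_cspan_eqI[OF assms(1,3,4)] closed_cspan_superset[of X]
    closed_cspan_minimal[OF order_refl assms(2)] by auto

text \<open>The kernel \<open>N\<close> is closed by boundedness. If it is proper, a vector
  \<open>u\<close> of \<open>S\<close> orthogonal to \<open>N\<close> exists, and every
  \<open>x\<close> differs from a multiple of \<open>u\<close> by an element of
  \<open>N\<close>.\<close>

lemma riesz_representation: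
  fixes S :: "'a :: chilbert_space set" and \<phi> :: "'a \<Rightarrow> complex"
  assumes S: "closed_csubspace S" and \<phi>: "bounded_op S UNIV \<phi>"
  shows "\<exists>z\<in>S. \<forall>x\<in>S. \<phi> x = cinner x z"
proof -
  note sub = closed_csubspace_csubspace[OF S]
  from \<phi> obtain B where add: "\<And>x y. x \<in> S \<Longrightarrow> y \<in> S \<Longrightarrow> \<phi> (x + y) = \<phi> x + \<phi> y"
    and scale: "\<And>a x. x \<in> S \<Longrightarrow> \<phi> (a *\<^sub>C x) = a * \<phi> x"
    and bound: "\<And>x. x \<in> S \<Longrightarrow> cmod (\<phi> x) \<le> B * norm x"
    unfolding bounded_op_def scaleC_complex_def by fastforce
  have diff: "\<phi> (x - y) = \<phi> x - \<phi> y" if "x \<in> S" "y \<in> S" for x y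
    using add[of "x - y" y] that csubspace_diff[OF sub] by simp
  define N where "N = {x \<in> S. \<phi> x = 0}"
  have "closed N"
    unfolding closed_sequential_limits
  proof (intro allI impI)
    fix f x
    assume f: "(\<forall>n. f n \<in> N) \<and> f \<longlonglongrightarrow> x"
    then have xS: "x \<in> S"
      using closed_sequentially[OF closed_csubspace_closed[OF S], of f x] by (auto simp: N_def)
    have "(\<lambda>n. \<phi> (x - f n)) \<longlonglongrightarrow> 0"
    proof (rule Lim_null_comparison)
      show "\<forall>\<^sub>F n in sequentially. norm (\<phi> (x - f n)) \<le> B * norm (x - f n)"
        using f xS by (intro always_eventually allI bound csubspace_diff[OF sub]) (auto simp: N_def)
      have "(\<lambda>n. B * norm (x - f n)) \<longlonglongrightarrow> B * norm (x - x)"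
        using f by (intro tendsto_intros) auto
      then show "(\<lambda>n. B * norm (x - f n)) \<longlonglongrightarrow> 0"
        by simp
    qed
    moreover have "\<phi> (x - f n) = \<phi> x" for n
      using f xS by (auto simp: diff N_def)
    ultimately show "x \<in> N"
      using xS by (simp add: N_def LIMSEQ_const_iff)
  qed
  moreover have "csubspace N"
    unfolding csubspace_def N_def
    using csubspace_0[OF sub] csubspace_add[OF sub] csubspace_scaleC[OF sub] add scale
      scale[OF csubspace_0[OF sub], of 0] by auto
  ultimately have N: "closed_csubspace N"
    by (simp add: closed_csubspace_def)
  show ?thesis
  proof (cases "S = N")
    case True
    then show ?thesis
      using csubspace_0[OF sub] by (intro bexI[of _ 0]) (auto simp: N_def)
  next
    case False
    then obtain x0 where x0: "x0 \<in> S" "x0 \<notin> N"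
      by (auto simp: N_def)
    define u where "u = x0 - proj N x0"
    have pN: "proj N x0 \<in> N"
      by (rule proj_in[OF N])
    have uS: "u \<in> S"
      unfolding u_def using x0 pN by (intro csubspace_diff sub) (auto simp: N_def)
    have un: "cinner n u = 0" if "n \<in> N" for n
      using proj_cinner_diff[OF N that, of x0] by (simp add: u_def cinner_eq_0_sym)
    have \<phi>u: "\<phi> u \<noteq> 0"
      using x0 pN by (auto simp: u_def diff N_def)
    then have u0: "cinner u u \<noteq> 0"
      using scale[OF uS, of 0] by auto
    \<comment> \<open>Scaled so that \<open>cinner u z = \<phi> u\<close>; the conjugate undoes the
      antilinearity in the second argument.\<close>
    define z where "z = cnj (\<phi> u / cinner u u) *\<^sub>C u"
    have "\<phi> x = cinner x z" if "x \<in> S" for x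
    proof -
      have "x - (\<phi> x / \<phi> u) *\<^sub>C u \<in> N"
        using that uS \<phi>u by (auto simp: N_def diff scale csubspace_scaleC[OF sub] csubspace_diff[OF sub])
      from un[OF this] have "cinner x u = \<phi> x / \<phi> u * cinner u u"
        by (simp add: cinner_diff_left cinner_scaleC_left)
      then show ?thesis
        using u0 \<phi>u by (simp add: z_def cinner_scaleC_right)
    qed
    moreover have "z \<in> S"
      unfolding z_def by (intro csubspace_scaleC sub uS)
    ultimately show ?thesis
      by blast
  qed
qed

section \<open>Bounded operators and adjoints\<close>

lemma bounded_opI:
  assumes "\<And>x. x \<in> S \<Longrightarrow> f x \<in> R"
    and "\<And>x y. x \<in> S \<Longrightarrow> y \<in> S \<Longrightarrow> f (x + y) = f x + f y"
    and "\<And>a x. x \<in> S \<Longrightarrow> f (a *\<^sub>C x) = a *\<^sub>C f x"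
    and "\<And>x. x \<in> S \<Longrightarrow> norm (f x) \<le> K * norm x"
  shows "bounded_op S R f"
  using assms unfolding bounded_op_def by blast

context
  fixes S :: "'a :: complex_inner set" and R :: "'b :: complex_inner set" and f :: "'a \<Rightarrow> 'b"
  assumes f: "bounded_op S R f"
begin

lemma bounded_op_in: "x \<in> S \<Longrightarrow> f x \<in> R"
  and bounded_op_add: "x \<in> S \<Longrightarrow> y \<in> S \<Longrightarrow> f (x + y) = f x + f y"
  and bounded_op_scaleC: "x \<in> S \<Longrightarrow> f (a *\<^sub>C x) = a *\<^sub>C f x"
  using f by (auto simp: bounded_op_def)

lemma bounded_op_minus: "x \<in> S \<Longrightarrow> f (- x) = - f x"
  using bounded_op_scaleC[of x "-1"] by simp

lemma bounded_op_diff: "csubspace S \<Longrightarrow> x \<in> S \<Longrightarrow> y \<in> S \<Longrightarrow> f (x - y) = f x - f y"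
  using bounded_op_add[of x "- y"] bounded_op_minus[of y] csubspace_minus[of S y] by simp

lemma bounded_op_0: "csubspace S \<Longrightarrow> f 0 = 0"
  using bounded_op_scaleC[of 0 0] by (simp add: csubspace_0)

lemma bounded_op_sum:
  "csubspace S \<Longrightarrow> (\<And>i. i \<in> I \<Longrightarrow> g i \<in> S) \<Longrightarrow> f (\<Sum>i\<in>I. g i) = (\<Sum>i\<in>I. f (g i))"
  by (induction I rule: infinite_finite_induct)
    (auto simp: bounded_op_0 bounded_op_add csubspace_sum)

lemma bounded_op_bound:
  obtains K where "0 \<le> K" "\<And>x. x \<in> S \<Longrightarrow> norm (f x) \<le> K * norm x"
proof -
  obtain K where K: "\<And>x. x \<in> S \<Longrightarrow> norm (f x) \<le> K * norm x"
    using f unfolding bounded_op_def by blast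
  show thesis
  proof (rule that[of "max K 0"])
    show "norm (f x) \<le> max K 0 * norm x" if "x \<in> S" for x
      using K[OF that] mult_right_mono[OF max.cobounded1[of K 0] norm_ge_zero[of x]] by linarith
  qed simp
qed

lemma bounded_op_tendsto:
  assumes "csubspace S" "\<And>n. X n \<in> S" "x \<in> S" "(X \<longlongrightarrow> x) F"
  shows "((\<lambda>n. f (X n)) \<longlongrightarrow> f x) F"
proof -
  obtain K where K: "\<And>x. x \<in> S \<Longrightarrow> norm (f x) \<le> K * norm x"
    using bounded_op_bound by blast
  have "((\<lambda>n. f (X n) - f x) \<longlongrightarrow> 0) F"
  proof (rule Lim_null_comparison)
    show "\<forall>\<^sub>F n in F. norm (f (X n) - f x) \<le> K * norm (X n - x)"
      using K[OF csubspace_diff[OF assms(1) assms(2,3)]]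
      by (simp add: bounded_op_diff assms)
    have "((\<lambda>n. K * norm (X n - x)) \<longlongrightarrow> K * norm (x - x)) F"
      by (intro tendsto_intros assms)
    then show "((\<lambda>n. K * norm (X n - x)) \<longlongrightarrow> 0) F"
      by simp
  qed
  then show ?thesis
    by (rule LIM_zero_cancel)
qed

lemma bounded_op_mono: "S' \<subseteq> S \<Longrightarrow> R \<subseteq> R' \<Longrightarrow> bounded_op S' R' f"
  using f unfolding bounded_op_def by blast

lemma bounded_op_image_csubspace:
  assumes S: "csubspace S"
  shows "csubspace (f ` S)"
  unfolding csubspace_def
proof (intro conjI ballI allI)
  show "0 \<in> f ` S"
    using bounded_op_0[OF S] csubspace_0[OF S] by (metis image_eqI)
next
  fix x y
  assume "x \<in> f ` S" "y \<in> f ` S"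
  then obtain a b where "a \<in> S" "b \<in> S" "x = f a" "y = f b"
    by blast
  then show "x + y \<in> f ` S"
    using csubspace_add[OF S] by (intro image_eqI[of _ _ "a + b"]) (auto simp: bounded_op_add)
next
  fix c x
  assume "x \<in> f ` S"
  then obtain a where "a \<in> S" "x = f a"
    by blast
  then show "c *\<^sub>C x \<in> f ` S"
    using csubspace_scaleC[OF S] by (intro image_eqI[of _ _ "c *\<^sub>C a"]) (auto simp: bounded_op_scaleC)
qed

end

lemma bounded_op_compose:
  assumes f: "bounded_op S R f" and g: "bounded_op R Q g"
  shows "bounded_op S Q (\<lambda>x. g (f x))"
proof -
  obtain K where K: "\<And>x. x \<in> S \<Longrightarrow> norm (f x) \<le> K * norm x"
    using bounded_op_bound[OF f] by blast
  obtain L where L: "0 \<le> L" "\<And>x. x \<in> R \<Longrightarrow> norm (g x) \<le> L * norm x"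
    using bounded_op_bound[OF g] by blast
  show ?thesis
  proof (rule bounded_opI[where K = "L * K"])
    show "norm (g (f x)) \<le> L * K * norm x" if "x \<in> S" for x
      using L(2)[OF bounded_op_in[OF f that]] mult_left_mono[OF K[OF that] L(1)] by simp
  qed (simp_all add: bounded_op_in[OF f] bounded_op_in[OF g] bounded_op_add[OF f]
      bounded_op_add[OF g] bounded_op_scaleC[OF f] bounded_op_scaleC[OF g])
qed

lemma bounded_op_plus:
  assumes f: "bounded_op S R f" and g: "bounded_op S R g" and R: "csubspace R"
  shows "bounded_op S R (\<lambda>x. f x + g x)"
proof -
  obtain K where K: "\<And>x. x \<in> S \<Longrightarrow> norm (f x) \<le> K * norm x"
    using bounded_op_bound[OF f] by blast
  obtain L where L: "\<And>x. x \<in> S \<Longrightarrow> norm (g x) \<le> L * norm x"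
    using bounded_op_bound[OF g] by blast
  show ?thesis
  proof (rule bounded_opI[where K = "K + L"])
    show "norm (f x + g x) \<le> (K + L) * norm x" if "x \<in> S" for x
      using norm_triangle_ineq[of "f x" "g x"] K[OF that] L[OF that] by (simp add: distrib_right)
  qed (simp_all add: csubspace_add[OF R] bounded_op_in[OF f] bounded_op_in[OF g]
      bounded_op_add[OF f] bounded_op_add[OF g] bounded_op_scaleC[OF f] bounded_op_scaleC[OF g]
      scaleC_add_right)
qed

lemma bounded_op_scaleR:
  assumes f: "bounded_op S R f" and R: "csubspace R"
  shows "bounded_op S R (\<lambda>x. r *\<^sub>R f x)"
proof -
  obtain K where K: "\<And>x. x \<in> S \<Longrightarrow> norm (f x) \<le> K * norm x"
    using bounded_op_bound[OF f] by blast
  show ?thesis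
  proof (rule bounded_opI[where K = "\<bar>r\<bar> * K"])
    show "norm (r *\<^sub>R f x) \<le> \<bar>r\<bar> * K * norm x" if "x \<in> S" for x
      using mult_left_mono[OF K[OF that], of "\<bar>r\<bar>"] by simp
    show "r *\<^sub>R f (a *\<^sub>C x) = a *\<^sub>C r *\<^sub>R f x" if "x \<in> S" for a x
      by (simp add: bounded_op_scaleC[OF f that] scaleC_scaleC mult.commute flip: scaleC_of_real)
  qed (simp_all add: csubspace_scaleR[OF R] bounded_op_in[OF f] bounded_op_add[OF f] scaleR_add_right)
qed

lemma bounded_op_id: "bounded_op S S (\<lambda>x. x)"
  by (rule bounded_opI[where K = 1]) auto

lemma bounded_op_zero: "csubspace R \<Longrightarrow> bounded_op S R (\<lambda>x. 0)"
  by (rule bounded_opI[where K = 0]) (auto simp: csubspace_0)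

lemma bounded_op_minus_fun:
  assumes "bounded_op S R f" "bounded_op S R g" "csubspace R"
  shows "bounded_op S R (\<lambda>x. f x - g x)"
proof -
  have "bounded_op S R (\<lambda>x. f x + (- 1) *\<^sub>R g x)"
    by (rule bounded_op_plus[OF assms(1) bounded_op_scaleR[OF assms(2,3)] assms(3)])
  then show ?thesis
    by simp
qed

lemma bounded_op_proj: "closed_csubspace S \<Longrightarrow> bounded_op UNIV S (proj (S :: 'a :: chilbert_space set))"
  by (rule bounded_opI[where K = 1]) (auto simp: proj_in proj_add proj_scaleC norm_proj_le)

lemma bounded_op_cinner: "bounded_op S UNIV (\<lambda>x. cinner x z)"
  by (rule bounded_opI[where K = "norm z"])
    (auto simp: cinner_add_left cinner_scaleC_left scaleC_complex_def mult.commute cmod_cinner_le)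

lemma bounded_op_fst: "bounded_op S UNIV fst"
  by (rule bounded_opI[where K = 1]) (auto simp: scaleC_prod_def norm_fst_le)

text \<open>The agreement set is a subspace and limits are preserved by boundedness. Identities on
  Fock and defect spaces are checked on generators and transported by this lemma.\<close>

lemma bounded_op_eq_on_closed_cspan:
  assumes f: "bounded_op S R f" and g: "bounded_op S R g" and S: "csubspace S" "X \<subseteq> S"
    and eq: "\<And>x. x \<in> X \<Longrightarrow> f x = g x" and x: "x \<in> S" "x \<in> closed_cspan X"
  shows "f x = g x"
proof -
  have "csubspace {x \<in> S. f x = g x}"
    using S by (auto simp: csubspace_def bounded_op_add[OF f] bounded_op_add[OF g]
        bounded_op_scaleC[OF f] bounded_op_scaleC[OF g] bounded_op_0[OF f] bounded_op_0[OF g])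
  then have hull: "csubspace hull X \<subseteq> {x \<in> S. f x = g x}"
    using S eq by (intro hull_minimal) auto
  obtain X' where X': "\<forall>n. X' n \<in> csubspace hull X" "X' \<longlonglongrightarrow> x"
    using x by (auto simp: closed_cspan_def closure_sequential)
  have "(\<lambda>n. f (X' n)) \<longlonglongrightarrow> f x" "(\<lambda>n. g (X' n)) \<longlonglongrightarrow> g x"
    using X' hull x by (auto intro!: bounded_op_tendsto[OF f] bounded_op_tendsto[OF g] S)
  moreover have "f (X' n) = g (X' n)" for n
    using X' hull by auto
  ultimately show ?thesis
    by (simp add: LIMSEQ_unique)
qed

text \<open>Used with an infinite index set, pairs of a letter and a word, to make a whole family of
  orthogonality relations into one closed subspace.\<close>

lemma closed_csubspace_kernels:
  assumes S: "closed_csubspace S" and f: "\<And>i. i \<in> I \<Longrightarrow> bounded_op S R (f i)"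
  shows "closed_csubspace {x \<in> S. \<forall>i\<in>I. f i x = 0}"
proof -
  note sub = closed_csubspace_csubspace[OF S]
  have "csubspace {x \<in> S. \<forall>i\<in>I. f i x = 0}"
    using bounded_op_add[OF f] bounded_op_scaleC[OF f] bounded_op_0[OF f sub] sub
    by (auto simp: csubspace_def)
  moreover have "closed {x \<in> S. \<forall>i\<in>I. f i x = 0}"
    unfolding closed_sequential_limits
  proof (intro allI impI)
    fix X x
    assume X: "(\<forall>n. X n \<in> {x \<in> S. \<forall>i\<in>I. f i x = 0}) \<and> X \<longlonglongrightarrow> x"
    then have x: "x \<in> S"
      using closed_sequentially[OF closed_csubspace_closed[OF S], of X x] by blast
    have "f i x = 0" if "i \<in> I" for i
    proof -
      have "(\<lambda>n. f i (X n)) \<longlonglongrightarrow> f i x"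
        using X x by (intro bounded_op_tendsto[OF f] sub that) auto
      moreover have "(\<lambda>n. f i (X n)) = (\<lambda>_. 0)"
        using X that by auto
      ultimately show ?thesis
        by (simp add: LIMSEQ_const_iff)
    qed
    with x show "x \<in> {x \<in> S. \<forall>i\<in>I. f i x = 0}"
      by blast
  qed
  ultimately show ?thesis
    by (simp add: closed_csubspace_def)
qed

context
  fixes S :: "'a :: chilbert_space set" and R :: "'b :: complex_inner set" and f :: "'a \<Rightarrow> 'b"
  assumes S: "closed_csubspace S" and f: "bounded_op S R f"
begin

lemma adj_eqI:
  assumes "x \<in> S" "\<And>s. s \<in> S \<Longrightarrow> cinner (f s) y = cinner s x"
  shows "adj S R f y = x"
  unfolding adj_def
proof (rule the_equality)
  fix z
  assume z: "z \<in> S \<and> (\<forall>s\<in>S. cinner (f s) y = cinner s z)"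
  with assms have "z - x \<in> S"
    by (simp add: csubspace_diff closed_csubspace_csubspace[OF S])
  with z have "cinner (f (z - x)) y = cinner (z - x) z"
    by blast
  with assms(2)[OF \<open>z - x \<in> S\<close>] have "cinner (z - x) (z - x) = 0"
    by (simp add: cinner_diff_right)
  then show "z = x"
    by simp
qed (use assms in blast)

text \<open>Riesz representation of \<open>s \<mapsto> cinner (f s) y\<close>. Here \<open>y\<close>
  ranges over the whole type, so the adjoint is total.\<close>

lemma adj_in: "adj S R f y \<in> S"
  and cinner_adj: "s \<in> S \<Longrightarrow> cinner s (adj S R f y) = cinner (f s) y"
proof -
  have "bounded_op S UNIV (\<lambda>s. cinner (f s) y)"
    by (rule bounded_op_compose[OF f bounded_op_cinner])
  from riesz_representation[OF S this] obtain x
    where x: "x \<in> S" "\<And>s. s \<in> S \<Longrightarrow> cinner (f s) y = cinner s x"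
    by blast
  from adj_eqI[OF this] have "adj S R f y = x"
    by blast
  with x show "adj S R f y \<in> S" "s \<in> S \<Longrightarrow> cinner s (adj S R f y) = cinner (f s) y"
    by simp_all
qed

lemma cinner_adj_left: "s \<in> S \<Longrightarrow> cinner (adj S R f y) s = cinner y (f s)"
  by (metis cinner_adj cinner_commute)

lemma bounded_op_adj: "bounded_op UNIV S (adj S R f)"
proof -
  obtain K where K: "0 \<le> K" "\<And>x. x \<in> S \<Longrightarrow> norm (f x) \<le> K * norm x"
    using bounded_op_bound[OF f] by blast
  note sub = closed_csubspace_csubspace[OF S]
  show ?thesis
  proof (rule bounded_opI[where K = K])
    show "adj S R f (x + y) = adj S R f x + adj S R f y" for x y
      by (rule adj_eqI) (auto simp: csubspace_add[OF sub] adj_in cinner_add_right cinner_adj)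
    show "adj S R f (a *\<^sub>C x) = a *\<^sub>C adj S R f x" for a x
      by (rule adj_eqI) (auto simp: csubspace_scaleC[OF sub] adj_in cinner_scaleC_right cinner_adj)
    show "norm (adj S R f y) \<le> K * norm y" for y
    proof -
      have "complex_of_real ((norm (adj S R f y))\<^sup>2) = cinner (f (adj S R f y)) y"
        using cinner_adj[OF adj_in, of y y] by (simp add: cinner_self)
      then have "(norm (adj S R f y))\<^sup>2 = cmod (cinner (f (adj S R f y)) y)"
        by (metis norm_of_real abs_of_nonneg zero_le_power2)
      also have "\<dots> \<le> norm (f (adj S R f y)) * norm y"
        by (rule cmod_cinner_le)
      also have "\<dots> \<le> K * norm (adj S R f y) * norm y"
        by (intro mult_right_mono K adj_in) simp
      finally show ?thesis
        using K by (cases "adj S R f y = 0") (simp_all add: power2_eq_square mult_ac)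
    qed
  qed (rule adj_in)
qed

end

text \<open>Polarization: reality of the quadratic form at \<open>u + v\<close> makes the imaginary
  part of \<open>cinner (f u) v\<close> antisymmetric, and replacing \<open>x\<close> by
  \<open>\<i> *\<^sub>C x\<close> turns this into symmetry of the real part.\<close>

lemma bounded_op_symmetric:
  assumes f: "bounded_op S S f" and S: "csubspace S"
    and real: "\<And>x. x \<in> S \<Longrightarrow> cinner (f x) x \<in> \<real>"
    and xy: "x \<in> S" "y \<in> S"
  shows "cinner (f x) y = cinner x (f y)"
proof -
  have Im: "Im (cinner (f u) v) = - Im (cinner (f v) u)" if "u \<in> S" "v \<in> S" for u v
    using real[OF csubspace_add[OF S that]] real[OF that(1)] real[OF that(2)] that
    by (simp add: bounded_op_add[OF f] cinner_add_left cinner_add_right complex_is_Real_iff)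
  have "Im (cinner (f x) y) = - Im (cinner (f y) x)"
    "Re (cinner (f x) y) = Re (cinner (f y) x)"
    using Im[OF xy] Im[OF csubspace_scaleC[OF S xy(1), of \<i>] xy(2)] xy
    by (simp_all add: bounded_op_scaleC[OF f] cinner_scaleC_left cinner_scaleC_right)
  then show ?thesis
    by (subst (2) cinner_commute) (simp add: complex_eq_iff)
qed

lemma nonneg_Reals_iff_Re: "z \<in> \<real>\<^sub>\<ge>\<^sub>0 \<longleftrightarrow> z \<in> \<real> \<and> 0 \<le> Re z"
  by (simp add: complex_nonneg_Reals_iff complex_is_Real_iff conj_commute)

lemma norm_eqI_cinner:
  "cinner x x = cinner y y \<Longrightarrow> norm (x :: 'a :: complex_inner) = norm (y :: 'b :: complex_inner)"
  unfolding cinner_self of_real_eq_iff by (rule power2_eq_imp_eq) auto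

lemma bounded_op_isometry:
  assumes "\<And>x. x \<in> S \<Longrightarrow> f x \<in> R"
    and "\<And>x y. x \<in> S \<Longrightarrow> y \<in> S \<Longrightarrow> f (x + y) = f x + f y"
    and "\<And>a x. x \<in> S \<Longrightarrow> f (a *\<^sub>C x) = a *\<^sub>C f x"
    and "\<And>x. x \<in> S \<Longrightarrow> cinner (f x) (f x) = cinner x x"
  shows "bounded_op S R f"
  using assms norm_eqI_cinner[OF assms(4)] by (intro bounded_opI[where K = 1]) auto

section \<open>Square roots of positive operators\<close>

text \<open>
  The square root of \<open>A = I - B\<close> is \<open>I - Y\<close> with \<open>Y = (B + Y\<^sup>2) / 2\<close>. The iterates are polynomials in
  \<open>B\<close> with nonnegative coefficients, and so are their increments; hence their norms are bounded by
  the values of these polynomials at 1, which makes the iteration converge in norm. The predicate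
  \<open>majorized B f c\<close> says that \<open>f = p(B)\<close> and \<open>c = p(1)\<close> for such a polynomial \<open>p\<close>.
\<close>

inductive majorized :: "('a :: complex_inner \<Rightarrow> 'a) \<Rightarrow> ('a \<Rightarrow> 'a) \<Rightarrow> real \<Rightarrow> bool"
  for B :: "'a \<Rightarrow> 'a"
  where
    majorized_zero: "majorized B (\<lambda>x. 0) 0"
  | majorized_base: "majorized B B 1"
  | majorized_add: "majorized B f c \<Longrightarrow> majorized B g d \<Longrightarrow> majorized B (\<lambda>x. f x + g x) (c + d)"
  | majorized_comp: "majorized B f c \<Longrightarrow> majorized B g d \<Longrightarrow> majorized B (\<lambda>x. f (g x)) (c * d)"
  | majorized_half: "majorized B f c \<Longrightarrow> majorized B (\<lambda>x. (1 / 2) *\<^sub>R f x) (c / 2)"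

primrec sqrt_iter :: "('a :: complex_inner \<Rightarrow> 'a) \<Rightarrow> nat \<Rightarrow> 'a \<Rightarrow> 'a"
  where
    "sqrt_iter B 0 = (\<lambda>x. 0)"
  | "sqrt_iter B (Suc n) = (\<lambda>x. (1 / 2) *\<^sub>R (B x + sqrt_iter B n (sqrt_iter B n x)))"

text \<open>Half the difference of squares Y_(n+1)^2 - Y_n^2, factored as (Y_(n+1) - Y_n)(Y_(n+1) +
  Y_n), which is legitimate because polynomials in \<open>B\<close> commute. In this form no
  subtraction occurs, so the coefficients are visibly nonnegative.\<close>

primrec sqrt_incr :: "('a :: complex_inner \<Rightarrow> 'a) \<Rightarrow> nat \<Rightarrow> 'a \<Rightarrow> 'a"
  where
    "sqrt_incr B 0 = (\<lambda>x. (1 / 2) *\<^sub>R B x)"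
  | "sqrt_incr B (Suc n) =
      (\<lambda>x. (1 / 2) *\<^sub>R sqrt_incr B n (sqrt_iter B (Suc n) x + sqrt_iter B n x))"

text \<open>The same iteration with the number 1 in place of \<open>B\<close>; it increases towards
  the fixed point 1 of t = (1 + t^2) / 2, so it stays below 1.\<close>

primrec sqrt_bound :: "nat \<Rightarrow> real"
  where
    "sqrt_bound 0 = 0"
  | "sqrt_bound (Suc n) = (1 + sqrt_bound n * sqrt_bound n) / 2"

lemma majorized_sqrt_iter: "majorized B (sqrt_iter B n) (sqrt_bound n)"
proof (induction n)
  case (Suc n)
  show ?case
    unfolding sqrt_iter.simps sqrt_bound.simps
    by (rule majorized_half[OF majorized_add[OF majorized_base majorized_comp[OF Suc Suc]]])
qed (simp add: majorized_zero)

lemma majorized_sqrt_incr: "majorized B (sqrt_incr B n) (sqrt_bound (Suc n) - sqrt_bound n)"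
proof (induction n)
  case 0
  then show ?case
    using majorized_half[OF majorized_base] by simp
next
  case (Suc n)
  have "sqrt_bound (Suc (Suc n)) - sqrt_bound (Suc n) =
      (sqrt_bound (Suc n) - sqrt_bound n) * (sqrt_bound (Suc n) + sqrt_bound n) / 2"
    by (simp add: field_simps)
  with majorized_half[OF majorized_comp[OF Suc
        majorized_add[OF majorized_sqrt_iter[of B "Suc n"] majorized_sqrt_iter[of B n]]]]
  show ?case
    by (simp only: sqrt_incr.simps)
qed

locale symmetric_contraction =
  fixes S :: "'a :: chilbert_space set" and B :: "'a \<Rightarrow> 'a"
  assumes S: "closed_csubspace S"
    and B: "bounded_op S S B"
    and B_le: "x \<in> S \<Longrightarrow> norm (B x) \<le> norm x"
    and B_sym: "x \<in> S \<Longrightarrow> y \<in> S \<Longrightarrow> cinner (B x) y = cinner x (B y)"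
begin

lemma sub: "csubspace S"
  by (rule closed_csubspace_csubspace[OF S])

lemma majorized_bounded:
  "majorized B f c \<Longrightarrow> bounded_op S S f \<and> 0 \<le> c \<and> (\<forall>x\<in>S. norm (f x) \<le> c * norm x)"
proof (induction rule: majorized.induct)
  case (majorized_add f c g d)
  have "norm (f x + g x) \<le> (c + d) * norm x" if "x \<in> S" for x
    using majorized_add.IH that norm_triangle_ineq[of "f x" "g x"]
    by (auto simp: distrib_right intro: order_trans[OF _ add_mono])
  with majorized_add.IH show ?case
    by (auto intro: bounded_op_plus sub)
next
  case (majorized_comp f c g d)
  have "norm (f (g x)) \<le> c * d * norm x" if "x \<in> S" for x
  proof -
    have "norm (f (g x)) \<le> c * norm (g x)"
      using majorized_comp.IH that by (auto dest: bounded_op_in)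
    also have "\<dots> \<le> c * (d * norm x)"
      using majorized_comp.IH that by (intro mult_left_mono) auto
    finally show ?thesis
      by simp
  qed
  with majorized_comp.IH show ?case
    by (auto intro: bounded_op_compose)
qed (auto simp: B B_le intro: bounded_op_zero bounded_op_scaleR sub)

lemmas majorized_op = majorized_bounded[THEN conjunct1]
lemmas majorized_nonneg = majorized_bounded[THEN conjunct2, THEN conjunct1]
lemmas majorized_norm = majorized_bounded[THEN conjunct2, THEN conjunct2, rule_format]

lemma bounded_op_half: "bounded_op S S f \<Longrightarrow> x \<in> S \<Longrightarrow> f ((1 / 2) *\<^sub>R x) = (1 / 2) *\<^sub>R f x"
  using bounded_op_scaleC[of S S f x "complex_of_real (1 / 2)"] by (simp only: scaleC_of_real)

lemma majorized_commute_base: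
  assumes "bounded_op S S g" "\<And>x. x \<in> S \<Longrightarrow> g (B x) = B (g x)" "majorized B f c" "x \<in> S"
  shows "g (f x) = f (g x)"
  using assms(3,4)
proof (induction arbitrary: x rule: majorized.induct)
  case majorized_zero
  then show ?case
    by (simp add: bounded_op_0[OF assms(1) sub])
next
  case (majorized_add f c h d)
  then show ?case
    by (simp add: bounded_op_add[OF assms(1)] bounded_op_in[OF majorized_op])
next
  case (majorized_comp f c h d)
  then show ?case
    by (simp add: bounded_op_in[OF majorized_op])
next
  case (majorized_half f c)
  then show ?case
    by (simp only: bounded_op_half[OF assms(1)] bounded_op_in[OF majorized_op])
qed (use assms in auto)

lemma majorized_commute:
  assumes "majorized B f c" "majorized B g d" "x \<in> S"
  shows "f (g x) = g (f x)"
proof (rule majorized_commute_base[OF majorized_op[OF assms(1)] _ assms(2,3)])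
  show "f (B x) = B (f x)" if "x \<in> S" for x
    by (rule majorized_commute_base[OF B refl assms(1) that, symmetric])
qed

lemma majorized_symmetric:
  "majorized B f c \<Longrightarrow> x \<in> S \<Longrightarrow> y \<in> S \<Longrightarrow> cinner (f x) y = cinner x (f y)"
proof (induction arbitrary: x y rule: majorized.induct)
  case (majorized_comp f c g d)
  then show ?case
    using majorized_commute[of f c g d y] by (simp add: bounded_op_in[OF majorized_op])
next
  case (majorized_half f c)
  then show ?case
    by (simp only: cinner_scaleR_left cinner_scaleR_right)
qed (simp_all add: B_sym cinner_add_left cinner_add_right)

lemma sqrt_iter_Suc_diff:
  "x \<in> S \<Longrightarrow> sqrt_iter B (Suc n) x = sqrt_iter B n x + sqrt_incr B n x"
proof (induction n arbitrary: x)
  case (Suc n)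
  note maj = majorized_sqrt_iter majorized_sqrt_incr
  let ?y = "sqrt_iter B n" and ?z = "sqrt_iter B (Suc n)" and ?d = "sqrt_incr B n"
  have in_S: "?y x \<in> S" "?z x \<in> S" "?d x \<in> S" "?d (?y x) \<in> S" "?y (?y x) \<in> S"
    using Suc.prems by (intro bounded_op_in[OF majorized_op[OF maj(1)]]
        bounded_op_in[OF majorized_op[OF maj(2)]]; simp)+
  have "?z (?z x) = ?y (?z x) + ?d (?z x)"
    using in_S by (intro Suc.IH)
  also have "?y (?z x) = ?y (?y x) + ?d (?y x)"
    using Suc.IH[OF Suc.prems] in_S bounded_op_add[OF majorized_op[OF maj(1)] in_S(1,3)]
      majorized_commute[OF maj(1) maj(2) Suc.prems] by metis
  finally have "?z (?z x) = ?y (?y x) + ?d (?z x + ?y x)"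
    using bounded_op_add[OF majorized_op[OF maj(2)] in_S(2,1)] by simp
  then have "sqrt_iter B (Suc (Suc n)) x =
      (1 / 2) *\<^sub>R (B x + ?y (?y x)) + (1 / 2) *\<^sub>R ?d (?z x + ?y x)"
    by (simp only: sqrt_iter.simps(2)[of B "Suc n"] scaleR_add_right add.assoc)
  also have "(1 / 2) *\<^sub>R (B x + ?y (?y x)) = ?z x"
    by simp
  finally show ?case
    by (simp only: sqrt_incr.simps)
qed simp

lemma sqrt_bound_le: "sqrt_bound m \<le> sqrt_bound (m + k)"
proof (induction k)
  case (Suc k)
  then show ?case
    using majorized_nonneg[OF majorized_sqrt_incr, of "m + k"] by simp
qed simp

lemma sqrt_bound_le_1: "sqrt_bound n \<le> 1"
proof (induction n)
  case (Suc n)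
  then have "sqrt_bound n * sqrt_bound n \<le> 1"
    using majorized_nonneg[OF majorized_sqrt_iter, of n] by (intro mult_le_one)
  then show ?case
    by simp
qed simp

text \<open>The increments telescope and each is majorized by the scalar increment, so the operator
  sequence inherits the Cauchy property from the bounded monotone sequence
  \<open>sqrt_bound\<close>.\<close>

lemma sqrt_iter_diff_le:
  assumes "x \<in> S"
  shows "norm (sqrt_iter B (m + k) x - sqrt_iter B m x) \<le> (sqrt_bound (m + k) - sqrt_bound m) * norm x"
proof (induction k)
  case (Suc k)
  have "sqrt_iter B (m + Suc k) x - sqrt_iter B m x =
      (sqrt_iter B (m + k) x - sqrt_iter B m x) + sqrt_incr B (m + k) x"
    using sqrt_iter_Suc_diff[OF assms, of "m + k"] by (simp only: add_Suc_right) simp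
  then have "norm (sqrt_iter B (m + Suc k) x - sqrt_iter B m x) \<le>
      norm (sqrt_iter B (m + k) x - sqrt_iter B m x) + norm (sqrt_incr B (m + k) x)"
    by (metis norm_triangle_ineq)
  also have "\<dots> \<le> (sqrt_bound (m + k) - sqrt_bound m) * norm x +
      (sqrt_bound (Suc (m + k)) - sqrt_bound (m + k)) * norm x"
    by (intro add_mono Suc majorized_norm[OF majorized_sqrt_incr assms])
  finally show ?case
    by (simp only: add_Suc_right) (simp add: algebra_simps)
qed simp

lemma sqrt_iter_convergent:
  assumes "x \<in> S"
  shows "convergent (\<lambda>n. sqrt_iter B n x)"
proof -
  have "convergent sqrt_bound"
  proof (rule Bseq_monoseq_convergent)
    show "Bseq sqrt_bound"
      using sqrt_bound_le_1 majorized_nonneg[OF majorized_sqrt_iter]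
      by (intro BseqI'[where K = 1]) (simp add: abs_of_nonneg)
    show "monoseq sqrt_bound"
      using sqrt_bound_le by (intro monoI1 allI impI) (auto simp: le_iff_add)
  qed
  then have Cauchy: "Cauchy (\<lambda>n. sqrt_bound n * norm x)"
    by (intro convergent_Cauchy convergent_mult convergent_const)
  have "dist (sqrt_iter B m x) (sqrt_iter B n x) \<le> dist (sqrt_bound m * norm x) (sqrt_bound n * norm x)"
    if "m \<le> n" for m n
  proof -
    have "dist (sqrt_iter B m x) (sqrt_iter B n x) \<le> sqrt_bound n * norm x - sqrt_bound m * norm x"
      using sqrt_iter_diff_le[OF assms, of m "n - m"] that
      by (simp add: dist_norm norm_minus_commute[of "sqrt_iter B m x"] left_diff_distrib)
    then show ?thesis
      by (simp add: dist_real_def)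
  qed
  then have le: "dist (sqrt_iter B m x) (sqrt_iter B n x) \<le> dist (sqrt_bound m * norm x) (sqrt_bound n * norm x)"
    for m n
    by (metis dist_commute linear)
  have "Cauchy (\<lambda>n. sqrt_iter B n x)"
    using Cauchy unfolding Cauchy_def by (meson le le_less_trans)
  then show ?thesis
    by (simp add: Cauchy_convergent_iff)
qed

lemma sqrt_exists:
  "\<exists>R. bounded_op S S R \<and> op_le S (\<lambda>_. 0) R \<and> (\<forall>x\<in>S. R (R x) = x - B x)"
proof -
  define Y where "Y x = lim (\<lambda>n. sqrt_iter B n x)" for x
  note op = majorized_op[OF majorized_sqrt_iter]
  have Y: "(\<lambda>n. sqrt_iter B n x) \<longlonglongrightarrow> Y x" if "x \<in> S" for x
    using sqrt_iter_convergent[OF that] unfolding Y_def by (simp add: convergent_LIMSEQ_iff)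
  have Y_in: "Y x \<in> S" if "x \<in> S" for x
    using closed_sequentially[OF closed_csubspace_closed[OF S] _ Y[OF that]] bounded_op_in[OF op that]
    by blast
  have iter_le: "norm (sqrt_iter B n x) \<le> norm x" if "x \<in> S" for n x
    using majorized_norm[OF majorized_sqrt_iter that, of n] mult_right_mono[OF sqrt_bound_le_1[of n], of "norm x"]
    by simp
  have Y_le: "norm (Y x) \<le> norm x" if "x \<in> S" for x
    using iter_le[OF that] by (intro tendsto_upperbound[OF tendsto_norm[OF Y[OF that]]]) auto
  have Y_op: "bounded_op S S Y"
  proof (rule bounded_opI[where K = 1])
    show "Y (x + y) = Y x + Y y" if "x \<in> S" "y \<in> S" for x y
      using tendsto_add[OF Y[OF that(1)] Y[OF that(2)]] Y[OF csubspace_add[OF sub that]]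
      by (simp add: bounded_op_add[OF op that] LIMSEQ_unique)
    show "Y (a *\<^sub>C x) = a *\<^sub>C Y x" if "x \<in> S" for a x
      using bounded_linear.tendsto[OF bounded_linear_scaleC[of a] Y[OF that]]
        Y[OF csubspace_scaleC[OF sub that], of a]
      by (simp add: bounded_op_scaleC[OF op that] LIMSEQ_unique)
  qed (simp_all add: Y_in Y_le)
  have Y_sym: "cinner (Y x) y = cinner x (Y y)" if "x \<in> S" "y \<in> S" for x y
    using tendsto_cinner_left[OF Y[OF that(1)], of y] tendsto_cinner_right[OF Y[OF that(2)], of x]
      majorized_symmetric[OF majorized_sqrt_iter that] by (simp add: LIMSEQ_unique)
  have Y_rec: "2 *\<^sub>R Y x = B x + Y (Y x)" if "x \<in> S" for x
  proof -
    \<comment> \<open>Operator and argument vary together in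
      \<open>sqrt_iter B n (sqrt_iter B n x)\<close>; the uniform bound of the iterates removes the
      error in the argument, after which only pointwise convergence at \<open>Y x\<close> is
      needed.\<close>
    have "(\<lambda>n. sqrt_iter B n (sqrt_iter B n x - Y x)) \<longlonglongrightarrow> 0"
    proof (rule Lim_null_comparison)
      show "\<forall>\<^sub>F n in sequentially. norm (sqrt_iter B n (sqrt_iter B n x - Y x)) \<le> norm (sqrt_iter B n x - Y x)"
        by (intro always_eventually allI iter_le csubspace_diff[OF sub] Y_in bounded_op_in[OF op] that)
      show "(\<lambda>n. norm (sqrt_iter B n x - Y x)) \<longlonglongrightarrow> 0"
        using tendsto_norm[OF tendsto_diff[OF Y[OF that] tendsto_const[of "Y x"]]] by simp
    qed
    from tendsto_add[OF this Y[OF Y_in[OF that]]]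
    have "(\<lambda>n. sqrt_iter B n (sqrt_iter B n x)) \<longlonglongrightarrow> Y (Y x)"
      by (simp add: bounded_op_diff[OF op sub] bounded_op_in[OF op] Y_in that)
    then have "(\<lambda>n. sqrt_iter B (Suc n) x) \<longlonglongrightarrow> (1 / 2) *\<^sub>R (B x + Y (Y x))"
      unfolding sqrt_iter.simps by (intro tendsto_intros)
    from LIMSEQ_unique[OF LIMSEQ_Suc[OF Y[OF that]] this]
    have "2 *\<^sub>R Y x = 2 *\<^sub>R (1 / 2) *\<^sub>R (B x + Y (Y x))"
      by (rule arg_cong)
    then show ?thesis
      by (simp only: scaleR_scaleR) simp
  qed
  define R where "R x = x - Y x" for x
  have "bounded_op S S R"
    unfolding R_def by (intro bounded_op_minus_fun bounded_op_id Y_op sub)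
  moreover have "op_le S (\<lambda>_. 0) R"
    unfolding op_le_def nonneg_Reals_iff_Re
  proof (intro ballI conjI)
    fix x
    assume x: "x \<in> S"
    have "cnj (cinner (Y x) x) = cinner (Y x) x"
      using Y_sym[OF x x] by (subst cinner_commute) simp
    then show "cinner (R x - 0) x \<in> \<real>"
      by (simp add: R_def cinner_diff_left cinner_self Reals_cnj_iff)
    have "inner (Y x) x \<le> norm (Y x) * norm x"
      by (rule norm_cauchy_schwarz)
    also have "\<dots> \<le> norm x * norm x"
      by (intro mult_right_mono Y_le x) simp
    finally show "0 \<le> Re (cinner (R x - 0) x)"
      by (simp add: R_def Re_cinner inner_diff_left power2_norm_eq_inner flip: power2_eq_square)
  qed
  \<comment> \<open>Since 2 Y = B + Y^2, the square (I - Y)^2 = I - 2 Y + Y^2 equals I - B.\<close>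
  moreover have "R (R x) = x - B x" if "x \<in> S" for x
    using Y_rec[OF that] that
    by (simp add: R_def bounded_op_diff[OF Y_op sub] Y_in scaleR_2 algebra_simps)
  ultimately show ?thesis
    by blast
qed

end

lemma op_sqrt_exists:
  fixes S :: "'a :: chilbert_space set"
  assumes S: "closed_csubspace S" and A: "bounded_op S S A" and pos: "op_le S (\<lambda>_. 0) A"
  shows "\<exists>R. bounded_op S S R \<and> op_le S (\<lambda>_. 0) R \<and> (\<forall>x\<in>S. R (R x) = A x)"
proof -
  note sub = closed_csubspace_csubspace[OF S]
  have real: "cinner (A x) x \<in> \<real>" and nonneg: "0 \<le> Re (cinner (A x) x)" if "x \<in> S" for x
    using pos that by (auto simp: op_le_def nonneg_Reals_iff_Re)
  have sym: "cinner (A x) y = cinner x (A y)" if "x \<in> S" "y \<in> S" for x y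
    by (rule bounded_op_symmetric[OF A sub real that])
  obtain K' where K': "0 \<le> K'" "\<And>x. x \<in> S \<Longrightarrow> norm (A x) \<le> K' * norm x"
    using bounded_op_bound[OF A] by blast
  \<comment> \<open>The summand 1 makes \<open>K\<close> positive even when the bound
    \<open>K'\<close> is 0, because \<open>A\<close> is divided by \<open>K\<close> to reach a
    contraction I - A / K.\<close>
  define K where "K = K' + 1"
  have K: "K > 0" "norm (A x) \<le> K * norm x" if "x \<in> S" for x
    using K'(1) K'(2)[OF that] norm_ge_zero[of x] unfolding K_def distrib_right by linarith+
  have K0: "K > 0"
    using K'(1) by (simp add: K_def)
  define B where "B x = x - (1 / K) *\<^sub>R A x" for x
  have B: "bounded_op S S B"
    unfolding B_def by (intro bounded_op_minus_fun bounded_op_id bounded_op_scaleR A sub)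
  interpret symmetric_contraction S B
  proof
    show "cinner (B x) y = cinner x (B y)" if "x \<in> S" "y \<in> S" for x y
      using sym[OF that] by (simp add: B_def cinner_diff_left cinner_diff_right cinner_scaleR_left
          cinner_scaleR_right)
    show "norm (B x) \<le> norm x" if x: "x \<in> S" for x
    proof (rule power2_le_imp_le)
      let ?a = "(1 / K) *\<^sub>R A x"
      have a: "?a \<in> S"
        by (intro csubspace_scaleR sub bounded_op_in[OF A] x)
      have Aa: "A ?a = (1 / K) *\<^sub>R A (A x)"
        using bounded_op_scaleC[OF A bounded_op_in[OF A x], of "complex_of_real (1 / K)"]
        by (simp only: scaleC_of_real)
      have "inner (A ?a) ?a \<le> norm (A ?a) * norm ?a"
        by (rule norm_cauchy_schwarz)
      also have "\<dots> \<le> K * norm ?a * norm ?a"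
        using K(2)[OF a] by (intro mult_right_mono) auto
      finally have 1: "inner (A ?a) ?a \<le> K * (norm ?a)\<^sup>2"
        by (simp only: power2_eq_square mult.assoc)
      have Ax: "A x = K *\<^sub>R ?a"
        using K0 by simp
      \<comment> \<open>With A x = K ?a, the four terms are K <?a, x>, twice -K |?a|^2, and a last
        one of at most K |?a|^2. Hence |?a|^2 is at most <?a, x>, which is more than the expansion
        of |x - ?a|^2 requires.\<close>
      have "0 \<le> Re (cinner (A (x - ?a)) (x - ?a))"
        by (intro nonneg csubspace_diff sub x a)
      also have "\<dots> = inner (A x) x - inner (A x) ?a - inner (A ?a) x + inner (A ?a) ?a"
        by (simp only: Re_cinner bounded_op_diff[OF A sub x a] inner_diff_left inner_diff_right)
      also have "inner (A ?a) x = inner (A x) ?a"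
        using sym[OF a x] by (metis Re_cinner inner_commute)
      also have "inner (A x) ?a = K * (norm ?a)\<^sup>2"
        by (subst Ax) (simp only: inner_scaleR_left power2_norm_eq_inner)
      also have "inner (A x) x = K * inner ?a x"
        by (subst Ax) (simp only: inner_scaleR_left)
      finally have "0 \<le> K * (inner ?a x - (norm ?a)\<^sup>2)"
        using 1 by (simp add: right_diff_distrib)
      then have "(norm ?a)\<^sup>2 \<le> inner ?a x"
        using K0 by (simp only: zero_le_mult_iff) auto
      moreover have "(norm (B x))\<^sup>2 = (norm x)\<^sup>2 - 2 * inner ?a x + (norm ?a)\<^sup>2"
        by (simp only: B_def power2_norm_eq_inner inner_diff_left inner_diff_right)
          (simp add: inner_commute)
      moreover have "0 \<le> (norm ?a)\<^sup>2"
        by simp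
      ultimately show "(norm (B x))\<^sup>2 \<le> (norm x)\<^sup>2"
        by linarith
    qed simp
  qed (fact S B)+
  obtain R where R: "bounded_op S S R" "op_le S (\<lambda>_. 0) R" "\<And>x. x \<in> S \<Longrightarrow> R (R x) = (1 / K) *\<^sub>R A x"
    using sqrt_exists by (auto simp: B_def)
  have "bounded_op S S (\<lambda>x. sqrt K *\<^sub>R R x)"
    by (intro bounded_op_scaleR R sub)
  moreover have "op_le S (\<lambda>_. 0) (\<lambda>x. sqrt K *\<^sub>R R x)"
    using R(2) K0 by (auto simp: op_le_def nonneg_Reals_iff_Re cinner_scaleR_left)
  moreover have "sqrt K *\<^sub>R R (sqrt K *\<^sub>R R x) = A x" if "x \<in> S" for x
    using bounded_op_scaleC[OF R(1) bounded_op_in[OF R(1) that], of "complex_of_real (sqrt K)"] K0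
      R(3)[OF that] by (simp add: scaleC_of_real)
  ultimately show ?thesis
    by (intro exI[of _ "\<lambda>x. sqrt K *\<^sub>R R x"]) simp
qed

context
  fixes S :: "'a :: chilbert_space set" and A :: "'a \<Rightarrow> 'a"
  assumes S: "closed_csubspace S" and A: "bounded_op S S A" and pos: "op_le S (\<lambda>_. 0) A"
begin

lemma bounded_op_op_sqrt: "bounded_op S S (op_sqrt S A)"
  and op_sqrt_positive: "op_le S (\<lambda>_. 0) (op_sqrt S A)"
  and op_sqrt_square: "x \<in> S \<Longrightarrow> op_sqrt S A (op_sqrt S A x) = A x"
  using someI_ex[OF op_sqrt_exists[OF S A pos]] unfolding op_sqrt_def by blast+

lemma op_sqrt_symmetric:
  assumes "x \<in> S" "y \<in> S"
  shows "cinner (op_sqrt S A x) y = cinner x (op_sqrt S A y)"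
  using op_sqrt_positive assms
  by (intro bounded_op_symmetric[OF bounded_op_op_sqrt closed_csubspace_csubspace[OF S]])
    (auto simp: op_le_def nonneg_Reals_iff_Re)

text \<open>Apart from boundedness, this is what the later sections take from the root, so they are
  insensitive to which root \<open>op_sqrt\<close> picks.\<close>

lemma cinner_op_sqrt:
  assumes "x \<in> S" "y \<in> S"
  shows "cinner (op_sqrt S A x) (op_sqrt S A y) = cinner (A x) y"
  using op_sqrt_symmetric[OF bounded_op_in[OF bounded_op_op_sqrt assms(1)] assms(2)]
  by (simp add: op_sqrt_square assms)

end

section \<open>Unitaries from equal Gram matrices\<close>

lemma unitary_op_cinner: "unitary_op S R U \<Longrightarrow> x \<in> S \<Longrightarrow> y \<in> S \<Longrightarrow> cinner (U x) (U y) = cinner x y"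
  and unitary_op_bounded: "unitary_op S R U \<Longrightarrow> bounded_op S R U"
  and unitary_op_image: "unitary_op S R U \<Longrightarrow> U ` S = R"
  by (auto simp: unitary_op_def)

text \<open>Negating the second component turns equality of two inner products into one
  orthogonality relation between pairs, and orthogonality passes to closed spans, one argument at a
  time.\<close>

lemma cspan_Gram_eq:
  assumes gram: "\<And>i j. i \<in> I \<Longrightarrow> j \<in> I \<Longrightarrow> cinner (u i) (u j) = cinner (v i) (v j)"
    and "p \<in> closed_cspan ((\<lambda>i. (u i, v i)) ` I)" "q \<in> closed_cspan ((\<lambda>i. (u i, v i)) ` I)"
  shows "cinner (fst p) (fst q) = cinner (snd p) (snd q)"
proof -
  have neg: "cinner (a, b) (c, - d) = cinner a c - cinner b d" for a c and b d
    by (simp add: cinner_prod_def)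
  have 1: "cinner (fst p) (u j) = cinner (snd p) (v j)"
    if "p \<in> closed_cspan ((\<lambda>i. (u i, v i)) ` I)" "j \<in> I" for p j
  proof -
    have "cinner p (u j, - v j) = 0"
      using gram that(2) by (intro closed_cspan_cinner_eq_0[OF that(1)]) (auto simp: neg)
    then show ?thesis
      by (simp add: cinner_prod_def)
  qed
  have 2: "cinner (u i) (fst p) = cinner (v i) (snd p)" if "i \<in> I" for i
    using 1[OF assms(2) that] by (metis cinner_commute)
  have "cinner q (fst p, - snd p) = 0"
    by (rule closed_cspan_cinner_eq_0[OF assms(3)]) (auto simp: cinner_prod_def 2)
  then have "cinner (fst q) (fst p) = cinner (snd q) (snd p)"
    by (simp add: cinner_prod_def)
  then show ?thesis
    by (metis cinner_commute)
qed

text \<open>The graph of the unitary is the closed span of the pairs \<open>(u i, v i)\<close>.\<close>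

lemma unitary_op_Gram:
  fixes u :: "'i \<Rightarrow> 'a :: chilbert_space" and v :: "'i \<Rightarrow> 'b :: chilbert_space"
  assumes gram: "\<And>i j. i \<in> I \<Longrightarrow> j \<in> I \<Longrightarrow> cinner (u i) (u j) = cinner (v i) (v j)"
  shows "\<exists>U. unitary_op (closed_cspan (u ` I)) (closed_cspan (v ` I)) U \<and> (\<forall>i\<in>I. U (u i) = v i)"
proof -
  define G where "G = closed_cspan ((\<lambda>i. (u i, v i)) ` I)"
  have G: "closed_csubspace G"
    by (simp add: G_def closed_csubspace_closed_cspan)
  note subG = closed_csubspace_csubspace[OF G]
  have gen: "(u i, v i) \<in> G" if "i \<in> I" for i
    using closed_cspan_superset[of "(\<lambda>i. (u i, v i)) ` I"] that by (auto simp: G_def)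
  have G_cinner: "cinner (fst p) (fst q) = cinner (snd p) (snd q)" if "p \<in> G" "q \<in> G" for p q
    by (rule cspan_Gram_eq[where I = I and u = u and v = v]) (use gram that in \<open>simp_all add: G_def\<close>)
  have G_norm: "norm (fst p) = norm (snd p)" if "p \<in> G" for p
    using G_cinner[OF that that] by (rule norm_eqI_cinner)
  have G_sub: "G \<subseteq> closed_cspan (u ` I) \<times> closed_cspan (v ` I)"
    unfolding G_def using closed_cspan_superset[of "u ` I"] closed_cspan_superset[of "v ` I"]
    by (intro closed_cspan_minimal closed_csubspace_Times closed_csubspace_closed_cspan) auto
  have proj_closed: "closed_csubspace (fst ` G)" "closed_csubspace (snd ` G)"
  proof -
    have "csubspace (fst ` G)" "csubspace (snd ` G)"
      using subG unfolding csubspace_def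
      by (auto simp: image_iff zero_prod_def scaleC_prod_def) force+
    moreover have lim: "\<exists>z\<in>G. fst z = a \<and> snd z = b"
      if "\<forall>n. X n \<in> G" "(\<lambda>n. fst (X n)) \<longlonglongrightarrow> a" "(\<lambda>n. snd (X n)) \<longlonglongrightarrow> b" for X a b
      using closed_sequentially[OF closed_csubspace_closed[OF G], of X "(a, b)"]
        tendsto_Pair[OF that(2,3)] that(1) by force
    \<comment> \<open>The two components of a difference in \<open>G\<close> have equal norms, so
      convergence of one component forces convergence of the other; this is why both projections of
      \<open>G\<close> are closed.\<close>
    have Cau: "Cauchy (\<lambda>n. fst (X n)) \<longleftrightarrow> Cauchy (\<lambda>n. snd (X n))" if "\<forall>n. X n \<in> G" for X
    proof -
      have "norm (fst (X m) - fst (X n)) = norm (snd (X m) - snd (X n))" for m n :: nat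
        using G_norm[OF csubspace_diff[OF subG], of "X m" "X n"] that by simp
      then show ?thesis
        by (simp add: Cauchy_iff)
    qed
    have "closed (fst ` G)"
      unfolding closed_sequential_limits
    proof (intro allI impI)
      fix f a
      assume f: "(\<forall>n. f n \<in> fst ` G) \<and> f \<longlonglongrightarrow> a"
      then have "\<forall>n. \<exists>p. p \<in> G \<and> f n = fst p"
        by blast
      then obtain X where "\<forall>n. X n \<in> G \<and> f n = fst (X n)"
        by metis
      then have X: "\<forall>n. X n \<in> G" "f = (\<lambda>n. fst (X n))"
        by (simp_all add: fun_eq_iff)
      then have "Cauchy (\<lambda>n. snd (X n))"
        using f LIMSEQ_imp_Cauchy by (auto simp flip: Cau)
      then obtain b where "(\<lambda>n. snd (X n)) \<longlonglongrightarrow> b"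
        by (auto simp: Cauchy_convergent_iff convergent_def)
      with lim[OF X(1) _ this] f X show "a \<in> fst ` G"
        by blast
    qed
    moreover have "closed (snd ` G)"
      unfolding closed_sequential_limits
    proof (intro allI impI)
      fix f b
      assume f: "(\<forall>n. f n \<in> snd ` G) \<and> f \<longlonglongrightarrow> b"
      then have "\<forall>n. \<exists>p. p \<in> G \<and> f n = snd p"
        by blast
      then obtain X where "\<forall>n. X n \<in> G \<and> f n = snd (X n)"
        by metis
      then have X: "\<forall>n. X n \<in> G" "f = (\<lambda>n. snd (X n))"
        by (simp_all add: fun_eq_iff)
      then have "Cauchy (\<lambda>n. fst (X n))"
        using f LIMSEQ_imp_Cauchy by (auto simp: Cau)
      then obtain a where "(\<lambda>n. fst (X n)) \<longlonglongrightarrow> a"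
        by (auto simp: Cauchy_convergent_iff convergent_def)
      with lim[OF X(1) this] f X show "b \<in> snd ` G"
        by blast
    qed
    ultimately show "closed_csubspace (fst ` G)" "closed_csubspace (snd ` G)"
      by (simp_all add: closed_csubspace_def)
  qed
  have fst_G: "fst ` G = closed_cspan (u ` I)" and snd_G: "snd ` G = closed_cspan (v ` I)"
  proof -
    have "u i \<in> fst ` G" "v i \<in> snd ` G" if "i \<in> I" for i
      using imageI[OF gen[OF that], of fst] imageI[OF gen[OF that], of snd] by simp_all
    then have "closed_cspan (u ` I) \<subseteq> fst ` G" "closed_cspan (v ` I) \<subseteq> snd ` G"
      using proj_closed by (intro closed_cspan_minimal image_subsetI; blast)+
    then show "fst ` G = closed_cspan (u ` I)" "snd ` G = closed_cspan (v ` I)"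
      using G_sub by auto
  qed
  define U where "U x = (THE y. (x, y) \<in> G)" for x
  have U: "U x = y" if "(x, y) \<in> G" for x y
    unfolding U_def
  proof (rule the_equality[where P = "\<lambda>y. (x, y) \<in> G", OF that])
    fix z
    assume "(x, z) \<in> G"
    \<comment> \<open>A pair in \<open>G\<close> with first component 0 also has second component 0
      because the norms agree: the graph is single-valued.\<close>
    from csubspace_diff[OF subG this that] have "(0, z - y) \<in> G"
      by simp
    from G_norm[OF this] show "z = y"
      by simp
  qed
  have UG: "(x, U x) \<in> G" if "x \<in> closed_cspan (u ` I)" for x
    using that U unfolding fst_G[symmetric] by auto
  have "unitary_op (closed_cspan (u ` I)) (closed_cspan (v ` I)) U"
    unfolding unitary_op_def
  proof (intro conjI ballI)
    show "bounded_op (closed_cspan (u ` I)) (closed_cspan (v ` I)) U"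
    proof (rule bounded_opI[where K = 1])
      show "U (x + y) = U x + U y" if "x \<in> closed_cspan (u ` I)" "y \<in> closed_cspan (u ` I)" for x y
        using csubspace_add[OF subG UG[OF that(1)] UG[OF that(2)]] by (intro U) simp
      show "U (a *\<^sub>C x) = a *\<^sub>C U x" if "x \<in> closed_cspan (u ` I)" for a x
        using csubspace_scaleC[OF subG UG[OF that], of a] by (intro U) (simp add: scaleC_prod_def)
    qed (use UG G_sub G_norm in force)+
    show "U ` closed_cspan (u ` I) = closed_cspan (v ` I)"
      using UG U unfolding fst_G[symmetric] snd_G[symmetric] by (auto simp: image_iff) force+
    show "cinner (U x) (U y) = cinner x y" if "x \<in> closed_cspan (u ` I)" "y \<in> closed_cspan (u ` I)" for x y
      using G_cinner[OF UG[OF that(1)] UG[OF that(2)]] by simp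
  qed
  moreover have "\<forall>i\<in>I. U (u i) = v i"
    using gen U by blast
  ultimately show ?thesis
    by blast
qed

lemma unitary_op_eq_iff:
  assumes "unitary_op S R U" "csubspace S" "x \<in> S" "y \<in> S"
  shows "U x = U y \<longleftrightarrow> x = y"
proof
  assume eq: "U x = U y"
  have "cinner (x - y) (x - y) = cinner (U (x - y)) (U (x - y))"
    using assms by (simp add: unitary_op_cinner csubspace_diff)
  also have "U (x - y) = 0"
    using eq bounded_op_diff[OF unitary_op_bounded[OF assms(1)] assms(2-4)] by simp
  finally show "x = y"
    by simp
qed simp

lemma unitary_op_bounded_into: "unitary_op S R U \<Longrightarrow> R \<subseteq> R' \<Longrightarrow> bounded_op S R' U"
  using bounded_op_mono[OF unitary_op_bounded order_refl] .

text \<open>Preservation of inner products already forces linearity: \<open>f\<close> agrees on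
  \<open>S\<close> with a unitary obtained from the Gram criterion.\<close>

lemma isometry_image:
  fixes f :: "'a :: chilbert_space \<Rightarrow> 'b :: chilbert_space"
  assumes S: "closed_csubspace S" and iso: "\<And>x y. x \<in> S \<Longrightarrow> y \<in> S \<Longrightarrow> cinner (f x) (f y) = cinner x y"
  shows "unitary_op S (f ` S) f" and "closed_csubspace (f ` S)"
proof -
  from unitary_op_Gram[of S "\<lambda>x. x" f] iso
  obtain U where U: "unitary_op (closed_cspan S) (closed_cspan (f ` S)) U" "\<And>x. x \<in> S \<Longrightarrow> U x = f x"
    by auto
  have "closed_cspan (f ` S) = U ` S"
    using unitary_op_image[OF U(1)] by (simp add: closed_cspan_closed_csubspace[OF S])
  also have "U ` S = f ` S"
    using U(2) by auto
  finally have eq: "closed_cspan (f ` S) = f ` S" .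
  then show "closed_csubspace (f ` S)"
    by (metis closed_csubspace_closed_cspan)
  note sub = closed_csubspace_csubspace[OF S]
  have "unitary_op S (f ` S) U"
    using U(1) by (simp add: closed_cspan_closed_csubspace[OF S] eq)
  note U' = unitary_op_bounded[OF this]
  have "bounded_op S (f ` S) f"
  proof (rule bounded_op_isometry)
    show "f (x + y) = f x + f y" if "x \<in> S" "y \<in> S" for x y
      using bounded_op_add[OF U' that] by (simp add: U(2) csubspace_add[OF sub] that)
    show "f (a *\<^sub>C x) = a *\<^sub>C f x" if "x \<in> S" for a x
      using bounded_op_scaleC[OF U' that] by (simp add: U(2) csubspace_scaleC[OF sub] that)
  qed (simp_all add: iso)
  then show "unitary_op S (f ` S) f"
    by (simp add: unitary_op_def iso)
qed

text \<open>Supplies the identification of the coefficient space with the defect space: compose the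
  embedding \<open>w\<close> with the inverse of the canonical unitary.\<close>

lemma unitary_op_inv_into:
  fixes w :: "'e :: chilbert_space \<Rightarrow> 'b :: complex_inner" and \<kappa> :: "'a :: chilbert_space \<Rightarrow> 'b"
  assumes \<kappa>: "unitary_op S R \<kappa>" and w: "unitary_op D R w" and S: "closed_csubspace S" "closed_csubspace D"
  shows "unitary_op D S (\<lambda>\<delta>. inv_into S \<kappa> (w \<delta>))"
    and "\<delta> \<in> D \<Longrightarrow> \<kappa> (inv_into S \<kappa> (w \<delta>)) = w \<delta>"
proof -
  let ?U = "\<lambda>\<delta>. inv_into S \<kappa> (w \<delta>)"
  have w_in: "w \<delta> \<in> \<kappa> ` S" if "\<delta> \<in> D" for \<delta>
    using that unitary_op_image[OF \<kappa>] unitary_op_image[OF w] by auto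
  show \<kappa>U: "\<kappa> (?U \<delta>) = w \<delta>" if "\<delta> \<in> D" for \<delta>
    by (rule f_inv_into_f[OF w_in[OF that]])
  have U_in: "?U \<delta> \<in> S" if "\<delta> \<in> D" for \<delta>
    by (rule inv_into_into[OF w_in[OF that]])
  have "cinner (?U \<delta>) (?U \<delta>') = cinner \<delta> \<delta>'" if "\<delta> \<in> D" "\<delta>' \<in> D" for \<delta> \<delta>'
    using unitary_op_cinner[OF \<kappa> U_in[OF that(1)] U_in[OF that(2)]] unitary_op_cinner[OF w that]
    by (simp add: \<kappa>U that)
  from isometry_image(1)[OF S(2), of ?U, OF this] have "unitary_op D (?U ` D) ?U" .
  moreover have "?U ` D = S"
  proof
    show "S \<subseteq> ?U ` D"
    proof
      fix s
      assume s: "s \<in> S"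
      then have "\<kappa> s \<in> w ` D"
        using unitary_op_image[OF \<kappa>] unitary_op_image[OF w] by auto
      then obtain \<delta> where \<delta>: "\<delta> \<in> D" "\<kappa> s = w \<delta>"
        by blast
      then have "\<kappa> (?U \<delta>) = \<kappa> s"
        by (simp add: \<kappa>U)
      then have "?U \<delta> = s"
        using unitary_op_eq_iff[OF \<kappa> closed_csubspace_csubspace[OF S(1)] U_in[OF \<delta>(1)] s] by blast
      with \<delta> show "s \<in> ?U ` D"
        by blast
    qed
  qed (use U_in in blast)
  ultimately show "unitary_op D S ?U"
    by simp
qed

lemma cinner_Pair [simp]: "cinner (a, b) (c, d) = cinner a c + cinner b d"
  by (simp add: cinner_prod_def)

lemma scaleC_Pair [simp]: "c *\<^sub>C (a, b) = (c *\<^sub>C a, c *\<^sub>C b)"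
  by (simp add: scaleC_prod_def)

section \<open>Words and row isometries\<close>

lemma word_op_Nil [simp]: "word_op T [] x = x"
  by (simp add: word_op_def)

lemma word_op_Cons [simp]: "word_op T (j # \<alpha>) x = T j (word_op T \<alpha> x)"
  by (simp add: word_op_def)

lemma word_op_append: "word_op T (\<alpha> @ \<beta>) x = word_op T \<alpha> (word_op T \<beta> x)"
  by (induction \<alpha>) auto

lemma bounded_op_word_op: "(\<And>j. bounded_op S S (T j)) \<Longrightarrow> bounded_op S S (word_op T \<alpha>)"
proof (induction \<alpha>)
  case (Cons j \<alpha>)
  have "bounded_op S S (\<lambda>x. T j (word_op T \<alpha> x))"
    by (rule bounded_op_compose[OF Cons.IH[OF Cons.prems] Cons.prems])
  also have "(\<lambda>x. T j (word_op T \<alpha> x)) = word_op T (j # \<alpha>)"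
    by (simp add: fun_eq_iff)
  finally show ?case .
qed (simp add: bounded_op_id word_op_def id_def)

locale row_isometry =
  fixes K :: "'v :: chilbert_space set" and V :: "'d :: finite \<Rightarrow> 'v \<Rightarrow> 'v"
  assumes closed_K: "closed_csubspace K"
    and bounded_V: "bounded_op K K (V j)"
    and cinner_V: "x \<in> K \<Longrightarrow> y \<in> K \<Longrightarrow> cinner (V i x) (V j y) = (if i = j then cinner x y else 0)"
begin

lemma sub_K: "csubspace K"
  by (rule closed_csubspace_csubspace[OF closed_K])

lemma V_in: "x \<in> K \<Longrightarrow> V j x \<in> K"
  by (rule bounded_op_in[OF bounded_V])

lemma bounded_word: "bounded_op K K (word_op V \<alpha>)"
  by (intro bounded_op_word_op bounded_V)

lemma word_in: "x \<in> K \<Longrightarrow> word_op V \<alpha> x \<in> K"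
  by (rule bounded_op_in[OF bounded_word])

text \<open>Equal first letters cancel and different ones give 0. When one word is exhausted first,
  a nonempty word is left on the other side, which is where the two orthogonality hypotheses
  enter.\<close>

lemma cinner_word_wandering:
  assumes "x \<in> K" "y \<in> K"
    and "\<And>\<gamma>. \<gamma> \<noteq> [] \<Longrightarrow> cinner (word_op V \<gamma> x) y = 0"
    and "\<And>\<gamma>. \<gamma> \<noteq> [] \<Longrightarrow> cinner (word_op V \<gamma> y) x = 0"
  shows "cinner (word_op V \<alpha> x) (word_op V \<beta> y) = (if \<alpha> = \<beta> then cinner x y else 0)"
proof (induction \<alpha> arbitrary: \<beta>)
  case Nil
  then show ?case
    using assms(4)[of \<beta>] by (cases \<beta>) (auto simp: cinner_eq_0_sym[of x])
next
  case (Cons j \<alpha>)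
  then show ?case
    using assms(3)[of "j # \<alpha>"] by (cases \<beta>) (auto simp: cinner_V word_in assms(1,2))
qed

end

section \<open>Creation operators\<close>

lemma infsum_supported:
  fixes f :: "'a \<Rightarrow> 'b :: {comm_monoid_add, t2_space}"
  assumes "\<And>x. x \<noteq> a \<Longrightarrow> f x = 0"
  shows "(\<Sum>\<^sub>\<infinity>x. f x) = f a"
proof -
  have "(\<Sum>\<^sub>\<infinity>x. f x) = (\<Sum>\<^sub>\<infinity>x\<in>{a}. f x)"
    using assms by (intro infsum_cong_neutral) auto
  then show ?thesis
    by simp
qed

lemma cinner_creation:
  "cinner (creation i f) (creation j g) = (if i = j then cinner f g else 0)"
proof (cases "i = j")
  case True
  have "cinner (creation j f) (creation j g) =
      (\<Sum>\<^sub>\<infinity>\<alpha>\<in>range ((#) j). cinner (fock_coeff f (tl \<alpha>)) (fock_coeff g (tl \<alpha>)))"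
    unfolding cinner_fock_def
    by (intro infsum_cong_neutral) (auto simp: creation.rep_eq split: list.split)
  also have "\<dots> = cinner f g"
    by (subst infsum_reindex) (auto simp: inj_on_def cinner_fock_def o_def)
  finally show ?thesis
    using True by simp
next
  case False
  have "cinner (creation i f) (creation j g) = (\<Sum>\<^sub>\<infinity>\<alpha> :: 'a list. 0)"
    unfolding cinner_fock_def
    by (intro infsum_cong) (use False in \<open>auto simp: creation.rep_eq split: list.split\<close>)
  then show ?thesis
    using False by simp
qed

lemma creation_add: "creation j (f + g) = creation j f + creation j g"
  by (rule fock_eqI) (auto simp: creation.rep_eq plus_fock.rep_eq split: list.split)

lemma creation_scaleC: "creation j (a *\<^sub>C f) = a *\<^sub>C creation j f"
  by (rule fock_eqI) (auto simp: creation.rep_eq scaleC_fock.rep_eq split: list.split)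

lemma creation_zero [simp]: "creation j 0 = 0"
  using creation_scaleC[of j 0 0] by simp

lemma bounded_creation: "bounded_op UNIV UNIV (creation j)"
  by (rule bounded_op_isometry) (auto simp: creation_add creation_scaleC cinner_creation)

lemma creation_fock_on: "csubspace D \<Longrightarrow> f \<in> fock_on D \<Longrightarrow> creation j f \<in> fock_on D"
  by (auto simp: fock_on_def creation.rep_eq csubspace_0 split: list.split)

lemma fock_coeff_vacuum: "fock_coeff (vacuum \<otimes>\<^sub>F v) \<alpha> = (if \<alpha> = [] then v else 0)"
  by (simp add: fock_tensor.rep_eq fock_single.rep_eq)

text \<open>So creation words applied to vacuum tensors are the elementary tensors e_\<alpha>
  \<otimes> v; pairing with them reads off single coefficients.\<close>

lemma fock_coeff_word_vacuum:
  "fock_coeff (word_op creation \<alpha> (vacuum \<otimes>\<^sub>F v)) \<beta> = (if \<beta> = \<alpha> then v else 0)"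
  by (induction \<alpha> arbitrary: \<beta>) (auto simp: creation.rep_eq fock_coeff_vacuum split: list.split)

lemma cinner_word_vacuum:
  "cinner f (word_op creation \<alpha> (vacuum \<otimes>\<^sub>F v)) = cinner (fock_coeff f \<alpha>) v"
  unfolding cinner_fock_def
  by (subst infsum_supported[where a = \<alpha>]) (auto simp: fock_coeff_word_vacuum)

lemma cinner_vacuum: "cinner f (vacuum \<otimes>\<^sub>F v) = cinner (fock_coeff f []) v"
  using cinner_word_vacuum[of f "[]" v] by simp

lemma cinner_vacuum_vacuum: "cinner (vacuum \<otimes>\<^sub>F u) (vacuum \<otimes>\<^sub>F v) = cinner u v"
  by (simp add: cinner_vacuum fock_coeff_vacuum)

lemma cinner_creation_vacuum [simp]: "cinner (creation j f) (vacuum \<otimes>\<^sub>F v) = 0"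
  by (simp add: cinner_vacuum creation.rep_eq)

lemma cinner_vacuum_creation [simp]: "cinner (vacuum \<otimes>\<^sub>F v) (creation j f) = 0"
  by (subst cinner_eq_0_sym) simp

lemma vacuum_add: "vacuum \<otimes>\<^sub>F (u + v) = vacuum \<otimes>\<^sub>F u + vacuum \<otimes>\<^sub>F v"
  by (rule fock_eqI) (simp add: fock_coeff_vacuum plus_fock.rep_eq)

lemma vacuum_scaleC: "vacuum \<otimes>\<^sub>F (a *\<^sub>C v) = a *\<^sub>C (vacuum \<otimes>\<^sub>F v)"
  by (rule fock_eqI) (simp add: fock_coeff_vacuum scaleC_fock.rep_eq)

lemma vacuum_zero [simp]: "vacuum \<otimes>\<^sub>F 0 = 0"
  using vacuum_scaleC[of 0 0] by simp

lemma vacuum_fock_on: "csubspace D \<Longrightarrow> v \<in> D \<Longrightarrow> vacuum \<otimes>\<^sub>F v \<in> fock_on D"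
  by (simp add: fock_on_def fock_coeff_vacuum csubspace_0)

text \<open>A family orthogonal to all e_\<alpha> \<otimes> v has each coefficient orthogonal to
  \<open>X\<close>, and these coefficients lie in the closed span of \<open>X\<close>.\<close>

lemma fock_on_closed_cspan:
  fixes X :: "'a :: chilbert_space set"
  shows "fock_on (closed_cspan X) =
    closed_cspan ((\<lambda>(\<alpha> :: 'd :: finite list, v). word_op creation \<alpha> (vacuum \<otimes>\<^sub>F v)) ` (UNIV \<times> X))"
proof (rule closed_cspan_eqI[symmetric])
  note closed = closed_csubspace_closed_cspan[of X]
  note sub = closed_csubspace_csubspace[OF closed]
  show "closed_csubspace (fock_on (closed_cspan X))"
    by (rule closed_csubspace_fock_on[OF closed])
  show "(\<lambda>(\<alpha> :: 'd list, v). word_op creation \<alpha> (vacuum \<otimes>\<^sub>F v)) ` (UNIV \<times> X) \<subseteq> fock_on (closed_cspan X)"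
    using closed_cspan_superset[of X]
    by (auto simp: fock_on_def fock_coeff_word_vacuum csubspace_0[OF sub])
  fix f :: "('d, 'a) fock"
  assume f: "f \<in> fock_on (closed_cspan X)"
    and orth: "\<And>x. x \<in> (\<lambda>(\<alpha> :: 'd list, v). word_op creation \<alpha> (vacuum \<otimes>\<^sub>F v)) ` (UNIV \<times> X) \<Longrightarrow> cinner f x = 0"
  have "fock_coeff f \<alpha> = 0" for \<alpha>
  proof (rule closed_cspan_orthogonal_self)
    show "fock_coeff f \<alpha> \<in> closed_cspan X"
      using f by (simp add: fock_on_def)
    show "cinner v (fock_coeff f \<alpha>) = 0" if "v \<in> X" for v
      using orth[of "word_op creation \<alpha> (vacuum \<otimes>\<^sub>F v)"] that
      by (subst cinner_eq_0_sym) (force simp: cinner_word_vacuum)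
  qed
  then show "f = 0"
    by (intro fock_eqI) (simp add: zero_fock.rep_eq)
qed

lemma word_vacuum_fock_on:
  "csubspace D \<Longrightarrow> v \<in> D \<Longrightarrow> word_op creation \<alpha> (vacuum \<otimes>\<^sub>F v) \<in> fock_on D"
  by (simp add: fock_on_def fock_coeff_word_vacuum csubspace_0)

text \<open>The vacuum tensors form the wandering subspace of the creation tuple. The coefficient at
  a nonempty word vanishes because \<open>f\<close> is tested against the elementary tensor carrying
  that very coefficient.\<close>

lemma fock_vacuumI:
  assumes D: "csubspace D" and f: "f \<in> fock_on D"
    and orth: "\<And>j g. g \<in> fock_on D \<Longrightarrow> cinner f (creation j g) = 0"
  shows "f = vacuum \<otimes>\<^sub>F fock_coeff f []"
proof (rule fock_eqI)
  fix \<alpha>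
  show "fock_coeff f \<alpha> = fock_coeff (vacuum \<otimes>\<^sub>F fock_coeff f []) \<alpha>"
  proof (cases \<alpha>)
    case (Cons j \<beta>)
    have "fock_coeff f \<alpha> \<in> D"
      using f by (simp add: fock_on_def)
    then have "cinner f (word_op creation \<alpha> (vacuum \<otimes>\<^sub>F fock_coeff f \<alpha>)) = 0"
      using orth[OF word_vacuum_fock_on[OF D]] by (simp add: Cons)
    then have "fock_coeff f \<alpha> = 0"
      unfolding cinner_word_vacuum by simp
    then show ?thesis
      by (simp add: fock_coeff_vacuum Cons)
  qed (simp add: fock_coeff_vacuum)
qed

lemma fock_coeff_fock_map:
  assumes U: "bounded_op D D' U" and f: "f \<in> fock_on D"
  shows "fock_coeff (fock_map U f) \<alpha> = U (fock_coeff f \<alpha>)"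
proof -
  obtain B where B: "\<And>x. x \<in> D \<Longrightarrow> norm (U x) \<le> B * norm x"
    using bounded_op_bound[OF U] by blast
  have "square_summable (\<lambda>\<alpha>. U (fock_coeff f \<alpha>))"
    by (rule square_summable_mono[OF square_summable_coeff, of _ B f])
      (use f B in \<open>simp add: fock_on_def\<close>)
  then show ?thesis
    by (simp add: fock_map_def Abs_fock_inverse)
qed

lemma bounded_op_fock_map:
  assumes U: "unitary_op D D' U" and D: "csubspace D"
  shows "bounded_op (fock_on D) (fock_on D') (fock_map U)"
proof (rule bounded_op_isometry)
  note U' = unitary_op_bounded[OF U]
  note coeff = fock_coeff_fock_map[OF U']
  have in_D: "fock_coeff f \<alpha> \<in> D" if "f \<in> fock_on D" for f \<alpha>
    using that by (simp add: fock_on_def)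
  show "fock_map U f \<in> fock_on D'" if "f \<in> fock_on D" for f
    using bounded_op_in[OF U' in_D[OF that]] coeff[OF that] by (simp add: fock_on_def)
  show "fock_map U (f + g) = fock_map U f + fock_map U g" if "f \<in> fock_on D" "g \<in> fock_on D" for f g
    by (rule fock_eqI)
      (simp add: coeff that csubspace_add[OF csubspace_fock_on[OF D]] plus_fock.rep_eq
        bounded_op_add[OF U'] in_D)
  show "fock_map U (a *\<^sub>C f) = a *\<^sub>C fock_map U f" if "f \<in> fock_on D" for a f
    by (rule fock_eqI)
      (simp add: coeff that csubspace_scaleC[OF csubspace_fock_on[OF D]] scaleC_fock.rep_eq
        bounded_op_scaleC[OF U'] in_D)
  show "cinner (fock_map U f) (fock_map U f) = cinner f f" if "f \<in> fock_on D" for f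
    by (simp add: cinner_fock_def coeff that unitary_op_cinner[OF U] in_D)
qed

lemma fock_map_word_vacuum:
  assumes U: "bounded_op D D' U" and D: "csubspace D" and v: "v \<in> D"
  shows "fock_map U (word_op creation \<alpha> (vacuum \<otimes>\<^sub>F v)) = word_op creation \<alpha> (vacuum \<otimes>\<^sub>F U v)"
  by (rule fock_eqI)
    (simp add: fock_coeff_fock_map[OF U word_vacuum_fock_on[OF D v]] fock_coeff_word_vacuum
      bounded_op_0[OF U D])

section \<open>Row contractions and defect operators\<close>

definition row_op :: "('d :: finite \<Rightarrow> 'a \<Rightarrow> 'b :: complex_inner) \<Rightarrow> 'a ^ 'd \<Rightarrow> 'b"
  where "row_op T x = (\<Sum>j\<in>UNIV. T j (x $ j))"

lemma scaleC_vec_nth [simp]: "(a *\<^sub>C x :: 'a :: complex_inner ^ 'd) $ i = a *\<^sub>C x $ i"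
  by (simp add: scaleC_vec_def)

lemma column_space_nth: "x \<in> column_space H \<Longrightarrow> x $ i \<in> H"
  by (simp add: column_space_def)

lemma closed_csubspace_column_space:
  assumes "closed_csubspace (H :: 'a :: complex_inner set)"
  shows "closed_csubspace (column_space H :: ('a ^ 'd :: finite) set)"
proof -
  have "closed {x :: 'a ^ 'd. x $ i \<in> H}" for i
    using continuous_closed_vimage[OF closed_csubspace_closed[OF assms], of "\<lambda>x :: 'a ^ 'd. x $ i"]
    by (simp add: vimage_def continuous_component)
  then have "closed (column_space H :: ('a ^ 'd) set)"
    unfolding column_space_def by (intro closed_Collect_all)
  then show ?thesis
    using closed_csubspace_csubspace[OF assms]
    by (auto simp: closed_csubspace_def csubspace_def column_space_def)
qed

lemma axis_column_space: "csubspace H \<Longrightarrow> h \<in> H \<Longrightarrow> axis j h \<in> column_space H"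
  by (simp add: column_space_def axis_def csubspace_0)

lemma row_op_axis:
  assumes "\<And>i. T i 0 = 0"
  shows "row_op T (axis j h) = T j h"
proof -
  have "T i (axis j h $ i) = (if i = j then T j h else 0)" for i
    by (simp add: axis_def assms)
  then show ?thesis
    by (simp add: row_op_def)
qed

lemma cinner_axis: "cinner (axis i x :: 'a :: complex_inner ^ 'd :: finite) y = cinner x (y $ i)"
proof -
  have "cinner (axis i x $ k) (y $ k) = (if k = i then cinner x (y $ i) else 0)" for k
    by (simp add: axis_def)
  then show ?thesis
    by (simp add: cinner_vec_def)
qed

lemma axis_add: "axis j (x + y) = axis j x + axis j (y :: 'a :: complex_inner)"
  by (simp add: vec_eq_iff axis_def)

lemma axis_scaleC: "axis j (a *\<^sub>C x) = a *\<^sub>C axis j (x :: 'a :: complex_inner)"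
  by (simp add: vec_eq_iff axis_def)

context
  fixes H :: "'a :: chilbert_space set" and T :: "'d :: finite \<Rightarrow> 'a \<Rightarrow> 'a"
  assumes H: "closed_csubspace H" and T: "\<And>j. bounded_op H H (T j)"
begin

lemma row_op_in: "x \<in> column_space H \<Longrightarrow> row_op T x \<in> H"
  unfolding row_op_def by (intro csubspace_sum closed_csubspace_csubspace[OF H] bounded_op_in[OF T] column_space_nth)

lemma cinner_row_op:
  assumes "x \<in> column_space H"
  shows "cinner (row_op T x) y = cinner x (\<chi> j. adj H H (T j) y)"
  using cinner_adj[OF H T column_space_nth[OF assms]]
  by (simp add: row_op_def cinner_vec_def cinner_sum_left)

lemma column_adj_in: "(\<chi> j. adj H H (T j) y) \<in> column_space H"
  using adj_in[OF H T] by (simp add: column_space_def)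

text \<open>The operator inequality says that the column \<open>c\<close> of adjoints is
  contractive. This column is the adjoint of the row operator, and Cauchy-Schwarz passes
  contractivity both ways.\<close>

lemma row_contraction_iff: "row_contraction H T \<longleftrightarrow> (\<forall>x\<in>column_space H. norm (row_op T x) \<le> norm x)"
proof -
  define c :: "'a \<Rightarrow> 'a ^ 'd" where "c y = (\<chi> j. adj H H (T j) y)" for y
  have c_in: "c y \<in> column_space H" for y
    by (simp add: c_def column_adj_in)
  have row_c: "row_op T (c y) = (\<Sum>j\<in>UNIV. T j (adj H H (T j) y))" for y
    by (simp add: row_op_def c_def)
  have cc: "cinner (row_op T (c y)) y = complex_of_real ((norm (c y))\<^sup>2)" for y
    using cinner_row_op[OF c_in] by (simp add: cinner_self flip: c_def)
  have "cinner (y - row_op T (c y)) y = complex_of_real ((norm y)\<^sup>2 - (norm (c y))\<^sup>2)" for y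
    by (simp add: cinner_diff_left cc cinner_self)
  then have *: "cinner (y - row_op T (c y)) y \<in> \<real>\<^sub>\<ge>\<^sub>0 \<longleftrightarrow> norm (c y) \<le> norm y" for y
    by (simp only: nonneg_Reals_of_real_iff) (simp add: power2_le_iff_abs_le)
  have "row_contraction H T \<longleftrightarrow> (\<forall>y\<in>H. norm (c y) \<le> norm y)"
    by (simp add: row_contraction_def T op_le_def * flip: row_c)
  also have "\<dots> \<longleftrightarrow> (\<forall>x\<in>column_space H. norm (row_op T x) \<le> norm x)"
  proof safe
    fix x :: "'a ^ 'd"
    assume le: "\<forall>y\<in>H. norm (c y) \<le> norm y" and x: "x \<in> column_space H"
    let ?y = "row_op T x"
    have "complex_of_real ((norm ?y)\<^sup>2) = cinner x (c ?y)"
      using cinner_row_op[OF x, of ?y] by (simp add: c_def cinner_self)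
    then have "(norm ?y)\<^sup>2 = Re (cinner x (c ?y))"
      by (metis Re_complex_of_real)
    also have "\<dots> \<le> norm x * norm (c ?y)"
      by (simp only: Re_cinner norm_cauchy_schwarz)
    also have "\<dots> \<le> norm x * norm ?y"
      using le row_op_in[OF x] by (intro mult_left_mono) auto
    finally show "norm ?y \<le> norm x"
      by (cases "?y = 0") (simp_all add: power2_eq_square)
  next
    fix y
    assume le: "\<forall>x\<in>column_space H. norm (row_op T x) \<le> norm x" and y: "y \<in> H"
    have "(norm (c y))\<^sup>2 = Re (cinner (row_op T (c y)) y)"
      by (simp add: cc)
    also have "\<dots> \<le> norm (row_op T (c y)) * norm y"
      by (simp only: Re_cinner norm_cauchy_schwarz)
    also have "\<dots> \<le> norm (c y) * norm y"
      using le c_in by (intro mult_right_mono) auto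
    finally show "norm (c y) \<le> norm y"
      by (cases "c y = 0") (simp_all add: power2_eq_square)
  qed
  finally show ?thesis .
qed

end

locale row_contraction_on =
  fixes H :: "'a :: chilbert_space set" and T :: "'d :: finite \<Rightarrow> 'a \<Rightarrow> 'a"
  assumes closed_H: "closed_csubspace H" and row_contraction: "row_contraction H T"
begin

lemma sub_H: "csubspace H"
  by (rule closed_csubspace_csubspace[OF closed_H])

lemma bounded_T: "bounded_op H H (T j)"
  using row_contraction by (simp add: row_contraction_def)

lemma T_in: "x \<in> H \<Longrightarrow> T j x \<in> H"
  by (rule bounded_op_in[OF bounded_T])

lemma bounded_word_T: "bounded_op H H (word_op T \<alpha>)"
  by (rule bounded_op_word_op[OF bounded_T])

lemma word_T_in: "x \<in> H \<Longrightarrow> word_op T \<alpha> x \<in> H"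
  by (rule bounded_op_in[OF bounded_word_T])

lemma closed_column: "closed_csubspace (column_space H :: ('a ^ 'd) set)"
  by (rule closed_csubspace_column_space[OF closed_H])

lemma sub_column: "csubspace (column_space H :: ('a ^ 'd) set)"
  by (rule closed_csubspace_csubspace[OF closed_column])

lemma norm_row_op_le: "x \<in> column_space H \<Longrightarrow> norm (row_op T x) \<le> norm x"
  using row_contraction row_contraction_iff[of H T, OF closed_H bounded_T] by blast

lemma row_op_add: "x \<in> column_space H \<Longrightarrow> y \<in> column_space H \<Longrightarrow> row_op T (x + y) = row_op T x + row_op T y"
  by (simp add: row_op_def bounded_op_add[OF bounded_T] column_space_nth sum.distrib)

lemma row_op_scaleC: "x \<in> column_space H \<Longrightarrow> row_op T (a *\<^sub>C x) = a *\<^sub>C row_op T x"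
  by (simp add: row_op_def bounded_op_scaleC[OF bounded_T] column_space_nth scaleC_sum_right)

definition defect_square :: "'a ^ 'd \<Rightarrow> 'a ^ 'd"
  where "defect_square x = (\<chi> i. \<Sum>j\<in>UNIV. (if i = j then x $ j else 0) - adj H H (T i) (T j (x $ j)))"

lemma defect_square_eq:
  assumes "x \<in> column_space H"
  shows "defect_square x = x - (\<chi> i. adj H H (T i) (row_op T x))"
proof -
  have "(\<Sum>j\<in>UNIV. adj H H (T i) (T j (x $ j))) = adj H H (T i) (row_op T x)" for i
    by (simp add: row_op_def bounded_op_sum[OF bounded_op_adj[OF closed_H bounded_T] csubspace_UNIV])
  then show ?thesis
    by (simp add: defect_square_def vec_eq_iff sum_subtractf)
qed

lemma defect_square_in: "x \<in> column_space H \<Longrightarrow> defect_square x \<in> column_space H"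
  unfolding defect_square_eq
  by (intro csubspace_diff sub_column column_adj_in closed_H bounded_T)

lemma cinner_defect_square:
  assumes "x \<in> column_space H" "y \<in> column_space H"
  shows "cinner (defect_square x) y = cinner x y - cinner (row_op T x) (row_op T y)"
proof -
  have "cinner (\<chi> i. adj H H (T i) (row_op T x)) y = cinner (row_op T x) (row_op T y)"
    using cinner_row_op[of H T y "row_op T x", OF closed_H bounded_T assms(2)] by (metis cinner_commute)
  then show ?thesis
    by (simp add: defect_square_eq assms cinner_diff_left)
qed

lemma bounded_op_defect_square: "bounded_op (column_space H) (column_space H) defect_square"
proof (rule bounded_opI[where K = 2])
  note adj = bounded_op_adj[OF closed_H bounded_T]
  show "defect_square (x + y) = defect_square x + defect_square y"
    if "x \<in> column_space H" "y \<in> column_space H" for x y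
    using that csubspace_add[OF sub_column that]
    by (simp add: defect_square_eq row_op_add bounded_op_add[OF adj] vec_eq_iff)
  show "defect_square (a *\<^sub>C x) = a *\<^sub>C defect_square x" if "x \<in> column_space H" for a x
    using that csubspace_scaleC[OF sub_column that]
    by (simp add: defect_square_eq row_op_scaleC bounded_op_scaleC[OF adj] vec_eq_iff scaleC_diff_right)
  show "norm (defect_square x) \<le> 2 * norm x" if x: "x \<in> column_space H" for x
  proof -
    let ?d = "defect_square x"
    note d = defect_square_in[OF x]
    have "complex_of_real ((norm ?d)\<^sup>2) = cinner x ?d - cinner (row_op T x) (row_op T ?d)"
      using cinner_defect_square[OF x d] by (simp add: cinner_self)
    then have "(norm ?d)\<^sup>2 = cmod (cinner x ?d - cinner (row_op T x) (row_op T ?d))"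
      by (metis norm_of_real abs_of_nonneg zero_le_power2)
    also have "\<dots> \<le> norm x * norm ?d + norm (row_op T x) * norm (row_op T ?d)"
      by (rule order_trans[OF norm_triangle_ineq4]) (intro add_mono cmod_cinner_le)
    also have "\<dots> \<le> norm x * norm ?d + norm x * norm ?d"
      by (intro add_mono mult_mono norm_row_op_le x d order_refl) auto
    finally show ?thesis
      by (cases "?d = 0") (simp_all add: power2_eq_square)
  qed
qed (rule defect_square_in)

lemma defect_square_positive: "op_le (column_space H) (\<lambda>_. 0) defect_square"
  unfolding op_le_def
proof
  fix x :: "'a ^ 'd"
  assume x: "x \<in> column_space H"
  have "cinner (defect_square x - 0) x = complex_of_real ((norm x)\<^sup>2 - (norm (row_op T x))\<^sup>2)"
    by (simp add: cinner_defect_square x cinner_self)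
  moreover have "(norm (row_op T x))\<^sup>2 \<le> (norm x)\<^sup>2"
    by (intro power_mono norm_row_op_le x) simp
  ultimately show "cinner (defect_square x - 0) x \<in> \<real>\<^sub>\<ge>\<^sub>0"
    by (simp only: nonneg_Reals_of_real_iff)
qed

lemma defect_op_eq: "defect_op H T = op_sqrt (column_space H) defect_square"
  by (simp add: defect_op_def defect_square_def[abs_def])

lemma bounded_op_defect_op: "bounded_op (column_space H) (column_space H) (defect_op H T)"
  unfolding defect_op_eq
  by (rule bounded_op_op_sqrt[OF closed_column bounded_op_defect_square defect_square_positive])

lemma cinner_defect_op:
  assumes "x \<in> column_space H" "y \<in> column_space H"
  shows "cinner (defect_op H T x) (defect_op H T y) = cinner x y - cinner (row_op T x) (row_op T y)"
  unfolding defect_op_eq cinner_defect_square[OF assms, symmetric]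
  by (rule cinner_op_sqrt[OF closed_column bounded_op_defect_square defect_square_positive assms])

lemma defect_space_eq: "defect_space H T = closed_cspan (defect_op H T ` column_space H)"
  unfolding defect_space_def
  by (rule closed_cspan_eq_closure[OF bounded_op_image_csubspace[OF bounded_op_defect_op sub_column], symmetric])

lemma closed_defect_space: "closed_csubspace (defect_space H T)"
  by (simp add: defect_space_eq closed_csubspace_closed_cspan)

lemma sub_defect_space: "csubspace (defect_space H T)"
  by (rule closed_csubspace_csubspace[OF closed_defect_space])

lemma defect_op_in: "x \<in> column_space H \<Longrightarrow> defect_op H T x \<in> defect_space H T"
  unfolding defect_space_eq using closed_cspan_superset[of "defect_op H T ` column_space H"] by blast

text \<open>Columns with one nonzero entry suffice as generators. They match single letters: the
  canonical unitary will send \<open>defect_op H T (axis i h)\<close> to V_i h - T_i h.\<close>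

lemma defect_space_axis:
  "defect_space H T = closed_cspan ((\<lambda>(i, h). defect_op H T (axis i h)) ` (UNIV \<times> H))"
proof (rule closed_cspan_eqI[symmetric, OF closed_defect_space])
  show "(\<lambda>(i, h). defect_op H T (axis i h)) ` (UNIV \<times> H) \<subseteq> defect_space H T"
    by (auto intro!: defect_op_in axis_column_space sub_H)
  fix z
  assume z: "z \<in> defect_space H T"
    and orth: "\<And>x. x \<in> (\<lambda>(i, h). defect_op H T (axis i h)) ` (UNIV \<times> H) \<Longrightarrow> cinner z x = 0"
  have "cinner (defect_op H T \<xi>) z = 0" if "\<xi> \<in> column_space H" for \<xi>
  proof -
    have "defect_op H T (\<Sum>i\<in>UNIV. axis i (\<xi> $ i)) = (\<Sum>i\<in>UNIV. defect_op H T (axis i (\<xi> $ i)))"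
      by (intro bounded_op_sum[OF bounded_op_defect_op sub_column] axis_column_space sub_H
          column_space_nth that)
    also have "(\<Sum>i\<in>UNIV. axis i (\<xi> $ i)) = \<xi>"
    proof (rule vec_eq_iff[THEN iffD2, rule_format])
      fix k
      have "axis i (\<xi> $ i) $ k = (if i = k then \<xi> $ k else 0)" for i
        by (simp add: axis_def)
      then show "(\<Sum>i\<in>UNIV. axis i (\<xi> $ i)) $ k = \<xi> $ k"
        by simp
    qed
    finally have "defect_op H T \<xi> = (\<Sum>i\<in>UNIV. defect_op H T (axis i (\<xi> $ i)))" .
    moreover have "cinner (defect_op H T (axis i (\<xi> $ i))) z = 0" for i
      using column_space_nth[OF that, of i] by (subst cinner_eq_0_sym) (force intro!: orth)
    ultimately show ?thesis
      by (simp add: cinner_sum_left)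
  qed
  then show "z = 0"
    by (intro closed_cspan_orthogonal_self[OF z[unfolded defect_space_eq]]) blast
qed

end

section \<open>Isometric dilations\<close>

text \<open>Compression is expressed by inner products and an embedding \<open>\<iota>\<close>, so
  that one row isometry can dilate both a lifting and its base, and so that the minimal and the
  model dilation are treated alike.\<close>

locale isometric_dilation = row_isometry K V + row_contraction_on H T
  for K :: "'v :: chilbert_space set" and V :: "'d :: finite \<Rightarrow> 'v \<Rightarrow> 'v"
    and H :: "'a :: chilbert_space set" and T :: "'d \<Rightarrow> 'a \<Rightarrow> 'a" +
  fixes \<iota> :: "'a \<Rightarrow> 'v"
  assumes bounded_\<iota>: "bounded_op H K \<iota>"
    and dilation: "x \<in> H \<Longrightarrow> y \<in> H \<Longrightarrow> cinner (word_op V \<alpha> (\<iota> x)) (\<iota> y) = cinner (word_op T \<alpha> x) y"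
begin

lemma \<iota>_in: "x \<in> H \<Longrightarrow> \<iota> x \<in> K"
  by (rule bounded_op_in[OF bounded_\<iota>])

lemma cinner_\<iota>: "x \<in> H \<Longrightarrow> y \<in> H \<Longrightarrow> cinner (\<iota> x) (\<iota> y) = cinner x y"
  using dilation[of x y "[]"] by simp

lemma cinner_V_\<iota>: "x \<in> H \<Longrightarrow> y \<in> H \<Longrightarrow> cinner (V i (\<iota> x)) (\<iota> y) = cinner (T i x) y"
  using dilation[of x y "[i]"] by simp

lemma cinner_\<iota>_V: "x \<in> H \<Longrightarrow> y \<in> H \<Longrightarrow> cinner (\<iota> y) (V i (\<iota> x)) = cinner y (T i x)"
  by (metis cinner_V_\<iota> cinner_commute)

text \<open>This is the value that the canonical unitary must take at
  \<open>defect_op H T \<xi>\<close>.\<close>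

definition wander :: "'a ^ 'd \<Rightarrow> 'v"
  where "wander \<xi> = (\<Sum>i\<in>UNIV. V i (\<iota> (\<xi> $ i)) - \<iota> (T i (\<xi> $ i)))"

lemma wander_in_K: "\<xi> \<in> column_space H \<Longrightarrow> wander \<xi> \<in> K"
  unfolding wander_def
  by (intro csubspace_sum csubspace_diff sub_K V_in \<iota>_in T_in column_space_nth)

lemma wander_axis: "x \<in> H \<Longrightarrow> wander (axis i x) = V i (\<iota> x) - \<iota> (T i x)"
proof -
  assume x: "x \<in> H"
  have "V j (\<iota> (axis i x $ j)) - \<iota> (T j (axis i x $ j)) = (if j = i then V i (\<iota> x) - \<iota> (T i x) else 0)" for j
    by (auto simp: axis_def bounded_op_0[OF bounded_V sub_K] bounded_op_0[OF bounded_T sub_H]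
        bounded_op_0[OF bounded_\<iota> sub_H])
  then show ?thesis
    by (simp add: wander_def)
qed

text \<open>Both V_\<alpha> V_i x and V_\<alpha> T_i x compress to T_\<alpha> T_i x, so their
  difference is orthogonal to the embedded space.\<close>

lemma cinner_word_wander_\<iota>:
  assumes "\<xi> \<in> column_space H" "y \<in> H"
  shows "cinner (word_op V \<alpha> (wander \<xi>)) (\<iota> y) = 0"
proof -
  have "cinner (word_op V \<alpha> (V i (\<iota> (\<xi> $ i)) - \<iota> (T i (\<xi> $ i)))) (\<iota> y) = 0" for i
  proof -
    note \<xi> = column_space_nth[OF assms(1), of i]
    have "cinner (word_op V \<alpha> (V i (\<iota> (\<xi> $ i)))) (\<iota> y) = cinner (word_op T \<alpha> (T i (\<xi> $ i))) y"
      using dilation[OF \<xi> assms(2), of "\<alpha> @ [i]"] by (simp add: word_op_append)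
    then show ?thesis
      by (simp add: bounded_op_diff[OF bounded_word sub_K] V_in \<iota>_in T_in \<xi> cinner_diff_left
          dilation assms(2))
  qed
  then show ?thesis
    unfolding wander_def
    by (subst bounded_op_sum[OF bounded_word sub_K])
      (auto simp: cinner_sum_left intro!: csubspace_diff sub_K V_in \<iota>_in T_in column_space_nth assms)
qed

lemma cinner_wander_\<iota>: "\<xi> \<in> column_space H \<Longrightarrow> y \<in> H \<Longrightarrow> cinner (wander \<xi>) (\<iota> y) = 0"
  using cinner_word_wander_\<iota>[of \<xi> y "[]"] by simp

text \<open>Orthogonality to the embedded space drops the subtracted terms of the second factor.
  What remains is the identity, from the orthogonal ranges of the V_i, minus <T_i \<xi>_i, T_j
  \<zeta>_j>: the square of the defect operator.\<close>

lemma cinner_wander: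
  assumes "\<xi> \<in> column_space H" "\<zeta> \<in> column_space H"
  shows "cinner (wander \<xi>) (wander \<zeta>) = cinner (defect_op H T \<xi>) (defect_op H T \<zeta>)"
proof -
  note nth = column_space_nth[OF assms(1)] column_space_nth[OF assms(2)]
  have "cinner (wander \<xi>) (\<iota> (T j (\<zeta> $ j))) = 0" for j
    by (intro cinner_wander_\<iota> assms T_in nth)
  then have "cinner (wander \<xi>) (wander \<zeta>) = (\<Sum>j\<in>UNIV. cinner (wander \<xi>) (V j (\<iota> (\<zeta> $ j))))"
    by (subst (2) wander_def) (simp add: cinner_sum_right cinner_diff_right)
  also have "\<dots> = (\<Sum>j\<in>UNIV. \<Sum>i\<in>UNIV. (if i = j then cinner (\<xi> $ i) (\<zeta> $ j) else 0) -
      cinner (T i (\<xi> $ i)) (T j (\<zeta> $ j)))"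
    by (simp add: wander_def cinner_sum_left cinner_diff_left cinner_V \<iota>_in nth cinner_\<iota> cinner_\<iota>_V T_in
        cong: if_cong)
  also have "\<dots> = cinner \<xi> \<zeta> - cinner (row_op T \<xi>) (row_op T \<zeta>)"
    by (simp add: row_op_def cinner_vec_def cinner_sum_left cinner_sum_right sum_subtractf)
  also have "\<dots> = cinner (defect_op H T \<xi>) (defect_op H T \<zeta>)"
    by (rule cinner_defect_op[OF assms, symmetric])
  finally show ?thesis .
qed

text \<open>A vector orthogonal to the embedded space and to all V_i x - T_i x is orthogonal to all
  V_i x, hence to everything that spans the ambient subspace.\<close>

lemma wandering_eq: "wandering H \<iota> V = closed_cspan (wander ` column_space H)"
proof (rule closed_cspan_eqI[symmetric])
  let ?Y = "\<iota> ` H \<union> (\<Union>j. V j ` \<iota> ` H)"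
  note Y = closed_csubspace_closed_cspan[of ?Y]
  show "closed_csubspace (wandering H \<iota> V)"
    unfolding wandering_def by (rule closed_csubspace_ominus[OF Y])
  have "\<iota> x \<in> closed_cspan ?Y" "V j (\<iota> x) \<in> closed_cspan ?Y" if "x \<in> H" for x j
    using that by (auto intro!: subsetD[OF closed_cspan_superset[of ?Y]])
  then have "wander \<xi> \<in> closed_cspan ?Y" if "\<xi> \<in> column_space H" for \<xi>
    unfolding wander_def using that
    by (intro csubspace_sum csubspace_diff closed_csubspace_csubspace[OF Y])
      (auto intro: T_in column_space_nth)
  then show "wander ` column_space H \<subseteq> wandering H \<iota> V"
    by (auto simp: wandering_def ominus_def cinner_wander_\<iota>)
  fix z
  assume z: "z \<in> wandering H \<iota> V" and orth: "\<And>x. x \<in> wander ` column_space H \<Longrightarrow> cinner z x = 0"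
  have z\<iota>: "cinner z (\<iota> x) = 0" if "x \<in> H" for x
    using z that by (auto simp: wandering_def ominus_def)
  have zV: "cinner z (V i (\<iota> x)) = 0" if "x \<in> H" for x i
    using orth[OF imageI[OF axis_column_space[OF sub_H that, of i]]] z\<iota>[OF T_in[OF that]]
    by (simp add: wander_axis that cinner_diff_right)
  show "z = 0"
  proof (rule closed_cspan_orthogonal_self)
    show "z \<in> closed_cspan ?Y"
      using z by (simp add: wandering_def ominus_def)
    show "cinner y z = 0" if "y \<in> ?Y" for y
      using that z\<iota> zV by (subst cinner_eq_0_sym) auto
  qed
qed

lemma closed_wandering: "closed_csubspace (wandering H \<iota> V)"
  by (simp add: wandering_eq closed_csubspace_closed_cspan)

lemma wandering_in_K: "l \<in> wandering H \<iota> V \<Longrightarrow> l \<in> K"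
  unfolding wandering_eq
  using closed_cspan_minimal[OF _ closed_K, of "wander ` column_space H"] wander_in_K by blast

lemma wander_in: "\<xi> \<in> column_space H \<Longrightarrow> wander \<xi> \<in> wandering H \<iota> V"
  unfolding wandering_eq using closed_cspan_superset[of "wander ` column_space H"] by blast

lemma cinner_word_wandering_\<iota>:
  assumes "l \<in> wandering H \<iota> V" "y \<in> H"
  shows "cinner (word_op V \<alpha> l) (\<iota> y) = 0"
proof (rule bounded_op_eq_on_closed_cspan[where f = "\<lambda>l. cinner (word_op V \<alpha> l) (\<iota> y)" and g = "\<lambda>_. 0"
        and X = "wander ` column_space H"])
  show "bounded_op K UNIV (\<lambda>l. cinner (word_op V \<alpha> l) (\<iota> y))"
    by (rule bounded_op_compose[OF bounded_word bounded_op_cinner])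
  show "bounded_op K UNIV (\<lambda>l. 0 :: complex)"
    by (rule bounded_op_zero) simp
qed (use assms in \<open>auto simp: sub_K wander_in_K wandering_in_K cinner_word_wander_\<iota> simp flip: wandering_eq\<close>)

text \<open>Cancelling the first letter against V_i x leaves an inner product of V_\<beta> l with
  the embedded space, which is 0; \<open>l'\<close> is a limit of combinations of V_i x and embedded
  vectors.\<close>

lemma cinner_word_wandering_0:
  assumes l: "l \<in> wandering H \<iota> V" "l' \<in> wandering H \<iota> V" and "\<gamma> \<noteq> []"
  shows "cinner (word_op V \<gamma> l) l' = 0"
proof -
  obtain j \<beta> where \<gamma>: "\<gamma> = j # \<beta>"
    using \<open>\<gamma> \<noteq> []\<close> by (cases \<gamma>) auto
  note lK = wandering_in_K[OF l(1)]
  have "cinner (word_op V \<gamma> l) (V i (\<iota> x)) = 0" if "x \<in> H" for i x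
    using cinner_word_wandering_\<iota>[OF l(1) that] by (simp add: \<gamma> cinner_V word_in[OF lK] \<iota>_in that)
  then have "cinner (word_op V \<gamma> l) (wander \<xi>) = 0" if "\<xi> \<in> column_space H" for \<xi>
    using cinner_word_wandering_\<iota>[OF l(1)] column_space_nth[OF that]
    by (simp add: wander_def cinner_sum_right cinner_diff_right T_in)
  then have "cinner l' (word_op V \<gamma> l) = 0"
    by (intro closed_cspan_cinner_eq_0[OF l(2)[unfolded wandering_eq]]) (auto simp: cinner_eq_0_sym)
  then show ?thesis
    by (simp add: cinner_eq_0_sym)
qed

lemma cinner_words_wandering:
  assumes "l \<in> wandering H \<iota> V" "l' \<in> wandering H \<iota> V"
  shows "cinner (word_op V \<alpha> l) (word_op V \<beta> l') = (if \<alpha> = \<beta> then cinner l l' else 0)"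
  using assms by (intro cinner_word_wandering wandering_in_K cinner_word_wandering_0)

text \<open>The defect vectors and the \<open>wander\<close> vectors have the same Gram matrix and
  span the two spaces, so the choice defining \<open>canonical_kappa\<close> has a witness.\<close>

lemma
  shows unitary_kappa: "unitary_op (defect_space H T) (wandering H \<iota> V) (canonical_kappa H T \<iota> V)"
    and kappa_defect_op: "\<xi> \<in> column_space H \<Longrightarrow> canonical_kappa H T \<iota> V (defect_op H T \<xi>) = wander \<xi>"
proof -
  have "\<exists>\<kappa>. unitary_op (defect_space H T) (wandering H \<iota> V) \<kappa> \<and>
      (\<forall>\<xi>\<in>column_space H. \<kappa> (defect_op H T \<xi>) = (\<Sum>i\<in>UNIV. V i (\<iota> (\<xi> $ i)) - \<iota> (T i (\<xi> $ i))))"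
    unfolding defect_space_eq wandering_eq wander_def[symmetric]
    by (rule unitary_op_Gram) (simp add: cinner_wander)
  from someI_ex[OF this]
  show "unitary_op (defect_space H T) (wandering H \<iota> V) (canonical_kappa H T \<iota> V)"
    and "\<xi> \<in> column_space H \<Longrightarrow> canonical_kappa H T \<iota> V (defect_op H T \<xi>) = wander \<xi>"
    unfolding canonical_kappa_def[symmetric] wander_def by blast+
qed

abbreviation "\<kappa> \<equiv> canonical_kappa H T \<iota> V"

lemma kappa_in: "\<delta> \<in> defect_space H T \<Longrightarrow> \<kappa> \<delta> \<in> wandering H \<iota> V"
  using unitary_op_image[OF unitary_kappa] by blast

text \<open>Different words give orthogonal copies both in the Fock space and in the dilation space,
  and equal words are compared by the unitary \<open>\<kappa>\<close>; the Gram criterion then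
  provides a witness for \<open>canonical_K\<close>.\<close>

lemma
  shows unitary_K: "unitary_op (fock_on (defect_space H T)) (wandering_sum H \<iota> V) (canonical_K H T \<iota> V)"
    and K_word: "\<delta> \<in> defect_space H T \<Longrightarrow>
      canonical_K H T \<iota> V (word_op creation \<alpha> (vacuum \<otimes>\<^sub>F \<delta>)) = word_op V \<alpha> (\<kappa> \<delta>)"
proof -
  let ?D = "defect_space H T"
  let ?u = "\<lambda>(\<alpha> :: 'd list, v). word_op creation \<alpha> (vacuum \<otimes>\<^sub>F v)"
  let ?v = "\<lambda>(\<alpha>, v). word_op V \<alpha> (\<kappa> v)"
  have dom: "fock_on ?D = closed_cspan (?u ` (UNIV \<times> ?D))"
    using fock_on_closed_cspan[of ?D] by (simp only: closed_cspan_closed_csubspace[OF closed_defect_space])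
  have "?v ` (UNIV \<times> ?D) = (\<Union>\<alpha>. word_op V \<alpha> ` wandering H \<iota> V)"
    unfolding unitary_op_image[OF unitary_kappa, symmetric] by (auto simp: image_iff)
  then have ran: "wandering_sum H \<iota> V = closed_cspan (?v ` (UNIV \<times> ?D))"
    by (simp add: wandering_sum_def)
  have "\<exists>K. unitary_op (closed_cspan (?u ` (UNIV \<times> ?D))) (closed_cspan (?v ` (UNIV \<times> ?D))) K \<and>
      (\<forall>i\<in>UNIV \<times> ?D. K (?u i) = ?v i)"
  proof (rule unitary_op_Gram)
    fix i j :: "'d list \<times> ('a ^ 'd)"
    assume ij: "i \<in> UNIV \<times> ?D" "j \<in> UNIV \<times> ?D"
    obtain \<alpha> v \<beta> w where eq: "i = (\<alpha>, v)" "j = (\<beta>, w)"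
      by (metis surj_pair)
    with ij have "v \<in> ?D" "w \<in> ?D"
      by auto
    then show "cinner (?u i) (?u j) = cinner (?v i) (?v j)"
      unfolding eq by (simp add: cinner_word_vacuum fock_coeff_word_vacuum cinner_words_wandering
          kappa_in unitary_op_cinner[OF unitary_kappa])
  qed
  then have "\<exists>K. unitary_op (fock_on ?D) (wandering_sum H \<iota> V) K \<and>
      (\<forall>\<alpha>. \<forall>\<delta>\<in>?D. K (word_op creation \<alpha> (vacuum \<otimes>\<^sub>F \<delta>)) = word_op V \<alpha> (\<kappa> \<delta>))"
    unfolding dom ran by auto
  from someI_ex[OF this]
  show "unitary_op (fock_on ?D) (wandering_sum H \<iota> V) (canonical_K H T \<iota> V)"
    and "\<delta> \<in> ?D \<Longrightarrow> canonical_K H T \<iota> V (word_op creation \<alpha> (vacuum \<otimes>\<^sub>F \<delta>)) = word_op V \<alpha> (\<kappa> \<delta>)"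
    unfolding canonical_K_def[symmetric] by blast+
qed

lemma K_vacuum: "\<delta> \<in> defect_space H T \<Longrightarrow> canonical_K H T \<iota> V (vacuum \<otimes>\<^sub>F \<delta>) = \<kappa> \<delta>"
  using K_word[of \<delta> "[]"] by simp

lemma closed_wandering_sum: "closed_csubspace (wandering_sum H \<iota> V)"
  by (simp add: wandering_sum_def closed_csubspace_closed_cspan)

lemma wandering_orthogonal_\<iota>: "l \<in> wandering H \<iota> V \<Longrightarrow> y \<in> H \<Longrightarrow> cinner l (\<iota> y) = 0"
  using cinner_word_wandering_\<iota>[of l y "[]"] by simp

text \<open>
  The difference \<open>V\<^sub>\<alpha> x - T\<^sub>\<alpha> x\<close> is orthogonal to \<open>H\<close>, hence shifting it makes it orthogonal to \<open>H\<close> and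
  to all \<open>V\<^sub>i H\<close>.
\<close>

lemma cinner_wandering_V_word:
  assumes "l \<in> wandering H \<iota> V" "x \<in> H"
  shows "cinner l (V j (word_op V \<alpha> (\<iota> x))) = cinner l (V j (\<iota> (word_op T \<alpha> x)))"
proof -
  let ?z = "word_op V \<alpha> (\<iota> x) - \<iota> (word_op T \<alpha> x)"
  have zK: "?z \<in> K"
    by (intro csubspace_diff sub_K word_in \<iota>_in word_T_in assms)
  have Vz: "V j ?z = V j (word_op V \<alpha> (\<iota> x)) - V j (\<iota> (word_op T \<alpha> x))"
    by (intro bounded_op_diff[OF bounded_V] sub_K word_in \<iota>_in word_T_in assms)
  have 1: "cinner ?z (\<iota> y) = 0" if "y \<in> H" for y
    by (simp add: cinner_diff_left dilation cinner_\<iota> word_T_in assms(2) that)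
  have 2: "cinner (V j ?z) (\<iota> y) = 0" if "y \<in> H" for y
    using dilation[OF assms(2) that, of "j # \<alpha>"]
    by (simp add: Vz cinner_diff_left cinner_V_\<iota> word_T_in assms(2) that)
  have 3: "cinner (V j ?z) (V i (\<iota> y)) = 0" if "y \<in> H" for i y
    by (simp add: cinner_V zK \<iota>_in that 1)
  have "l \<in> closed_cspan (\<iota> ` H \<union> (\<Union>j. V j ` \<iota> ` H))"
    using assms(1) by (simp add: wandering_def ominus_def)
  then have "cinner l (V j ?z) = 0"
    by (rule closed_cspan_cinner_eq_0) (auto simp: 2 3 cinner_eq_0_sym[of _ "V j ?z"])
  then show ?thesis
    by (simp add: Vz cinner_diff_right)
qed

lemma wandering_eq_0:
  assumes l: "l \<in> wandering H \<iota> V" and orth: "\<And>j x. x \<in> H \<Longrightarrow> cinner l (V j (\<iota> x)) = 0"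
  shows "l = 0"
proof (rule closed_cspan_orthogonal_self)
  show "l \<in> closed_cspan (\<iota> ` H \<union> (\<Union>j. V j ` \<iota> ` H))"
    using l by (simp add: wandering_def ominus_def)
  show "cinner y l = 0" if "y \<in> \<iota> ` H \<union> (\<Union>j. V j ` \<iota> ` H)" for y
    using that orth wandering_orthogonal_\<iota>[OF l] by (auto simp: cinner_eq_0_sym[of _ l])
qed

end

text \<open>Common first letters are stripped from both words, and distinct ones give 0. Once a word
  is empty, the dilation property expresses the value through \<open>T\<close> alone.\<close>

lemma isometric_dilations_Gram:
  assumes "isometric_dilation K V H T \<iota>" "isometric_dilation K' V' H T \<iota>'"
    and "x \<in> H" "y \<in> H"
  shows "cinner (word_op V \<alpha> (\<iota> x)) (word_op V \<beta> (\<iota> y)) =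
    cinner (word_op V' \<alpha> (\<iota>' x)) (word_op V' \<beta> (\<iota>' y))"
proof -
  interpret V: isometric_dilation K V H T \<iota> by fact
  interpret V': isometric_dilation K' V' H T \<iota>' by fact
  show ?thesis
  proof (induction \<alpha> arbitrary: \<beta>)
    case Nil
    have "cinner (\<iota> x) (word_op V \<beta> (\<iota> y)) = cnj (cinner (word_op T \<beta> y) x)"
      by (subst cinner_commute) (simp add: V.dilation assms)
    moreover have "cinner (\<iota>' x) (word_op V' \<beta> (\<iota>' y)) = cnj (cinner (word_op T \<beta> y) x)"
      by (subst cinner_commute) (simp add: V'.dilation assms)
    ultimately show ?case
      by simp
  next
    case (Cons i \<alpha>)
    show ?case
    proof (cases \<beta>)
      case Nil
      then show ?thesis
        using V.dilation[OF assms(3,4), of "i # \<alpha>"] V'.dilation[OF assms(3,4), of "i # \<alpha>"] by simp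
    next
      case (Cons j \<gamma>)
      then show ?thesis
        by (simp add: V.cinner_V V.word_in V.\<iota>_in V'.cinner_V V'.word_in V'.\<iota>_in assms(3,4) Cons.IH)
    qed
  qed
qed

text \<open>On generators, \<open>\<kappa>\<close> gives V_i h - T_i h, so the values are
  differences of entries of the common Gram matrix. This permits replacing the minimal dilation by
  the model dilation inside inner products.\<close>

lemma isometric_dilations_kappa:
  assumes "isometric_dilation K V H T \<iota>" "isometric_dilation K' V' H T \<iota>'"
    and "\<delta> \<in> defect_space H T" "y \<in> H"
  shows "cinner (word_op V \<alpha> (canonical_kappa H T \<iota> V \<delta>)) (word_op V \<beta> (\<iota> y)) =
    cinner (word_op V' \<alpha> (canonical_kappa H T \<iota>' V' \<delta>)) (word_op V' \<beta> (\<iota>' y))"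
proof -
  interpret V: isometric_dilation K V H T \<iota> by fact
  interpret V': isometric_dilation K' V' H T \<iota>' by fact
  let ?f = "\<lambda>\<delta>. cinner (word_op V \<alpha> (V.\<kappa> \<delta>)) (word_op V \<beta> (\<iota> y))"
  let ?g = "\<lambda>\<delta>. cinner (word_op V' \<alpha> (V'.\<kappa> \<delta>)) (word_op V' \<beta> (\<iota>' y))"
  let ?X = "(\<lambda>(i, h). defect_op H T (axis i h)) ` (UNIV \<times> H)"
  have \<kappa>: "bounded_op (defect_space H T) K V.\<kappa>" "bounded_op (defect_space H T) K' V'.\<kappa>"
    using bounded_op_mono[OF unitary_op_bounded[OF V.unitary_kappa] order_refl]
      bounded_op_mono[OF unitary_op_bounded[OF V'.unitary_kappa] order_refl]
      V.wandering_in_K V'.wandering_in_K by blast+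
  show ?thesis
  proof (rule bounded_op_eq_on_closed_cspan[where f = ?f and g = ?g and X = ?X])
    show "bounded_op (defect_space H T) UNIV ?f"
      by (rule bounded_op_compose[OF bounded_op_compose[OF \<kappa>(1) V.bounded_word] bounded_op_cinner])
    show "bounded_op (defect_space H T) UNIV ?g"
      by (rule bounded_op_compose[OF bounded_op_compose[OF \<kappa>(2) V'.bounded_word] bounded_op_cinner])
    show "?X \<subseteq> defect_space H T"
      by (auto intro!: V.defect_op_in axis_column_space V.sub_H)
    show "\<delta> \<in> closed_cspan ?X"
      using assms(3) by (simp add: V.defect_space_axis)
    fix x
    assume "x \<in> ?X"
    then obtain i h where h: "h \<in> H" and x: "x = defect_op H T (axis i h)"
      by auto
    have "word_op V \<alpha> (V.\<kappa> x) = word_op V (\<alpha> @ [i]) (\<iota> h) - word_op V \<alpha> (\<iota> (T i h))"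
      by (simp add: x V.kappa_defect_op axis_column_space V.sub_H h V.wander_axis word_op_append
          bounded_op_diff[OF V.bounded_word V.sub_K] V.V_in V.\<iota>_in V.T_in)
    moreover have "word_op V' \<alpha> (V'.\<kappa> x) = word_op V' (\<alpha> @ [i]) (\<iota>' h) - word_op V' \<alpha> (\<iota>' (T i h))"
      by (simp add: x V'.kappa_defect_op axis_column_space V.sub_H h V'.wander_axis word_op_append
          bounded_op_diff[OF V'.bounded_word V'.sub_K] V'.V_in V'.\<iota>_in V.T_in)
    ultimately show "?f x = ?g x"
      by (simp only: cinner_diff_left
          isometric_dilations_Gram[OF assms(1,2) h assms(4)]
          isometric_dilations_Gram[OF assms(1,2) V.T_in[OF h] assms(4)])
  qed (use assms V.sub_defect_space in auto)
qed

section \<open>The minimal isometric dilation\<close>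

context row_contraction_on
begin

abbreviation "dilation_space \<equiv> H \<times> fock_on (defect_space H T)"

lemma defect_axis_add:
  "x \<in> H \<Longrightarrow> y \<in> H \<Longrightarrow>
    defect_op H T (axis j (x + y)) = defect_op H T (axis j x) + defect_op H T (axis j y)"
  by (simp add: axis_add bounded_op_add[OF bounded_op_defect_op] axis_column_space sub_H)

lemma defect_axis_scaleC:
  "x \<in> H \<Longrightarrow> defect_op H T (axis j (a *\<^sub>C x)) = a *\<^sub>C defect_op H T (axis j x)"
  by (simp add: axis_scaleC bounded_op_scaleC[OF bounded_op_defect_op] axis_column_space sub_H)

lemma row_op_axis_T: "row_op T (axis j x) = T j x"
  by (rule row_op_axis) (rule bounded_op_0[OF bounded_T sub_H])

lemma cinner_defect_axis:
  assumes "x \<in> H" "y \<in> H"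
  shows "cinner (defect_op H T (axis i x)) (defect_op H T (axis j y)) =
    (if i = j then cinner x y else 0) - cinner (T i x) (T j y)"
proof -
  have "cinner (axis i x) (axis j y) = (if i = j then cinner x y else 0)"
    by (simp add: cinner_axis) (simp add: axis_def)
  then show ?thesis
    by (simp add: cinner_defect_op axis_column_space sub_H assms row_op_axis_T)
qed

text \<open>The defect term at the vacuum restores exactly the part <T_i h, T_j h'> that the first
  components contribute, and it is orthogonal to the range of the creation operators.\<close>

lemma cinner_min_dilation:
  assumes "h \<in> H" "h' \<in> H"
  shows "cinner (min_dilation H T i (h, \<eta>)) (min_dilation H T j (h', \<eta>')) =
    (if i = j then cinner (h, \<eta>) (h', \<eta>') else 0)"
  by (simp add: min_dilation_def cinner_add_left cinner_add_right cinner_creation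
      cinner_vacuum_vacuum cinner_defect_axis assms)

lemma min_dilation_in:
  "h \<in> H \<Longrightarrow> \<eta> \<in> fock_on (defect_space H T) \<Longrightarrow> min_dilation H T j (h, \<eta>) \<in> dilation_space"
  by (auto simp: min_dilation_def intro!: T_in csubspace_add csubspace_fock_on sub_defect_space
      vacuum_fock_on defect_op_in axis_column_space sub_H creation_fock_on)

lemma row_isometry_min_dilation: "row_isometry dilation_space (min_dilation H T)"
proof
  show "closed_csubspace dilation_space"
    by (intro closed_csubspace_Times closed_csubspace_fock_on closed_H closed_defect_space)
  show iso: "cinner (min_dilation H T i x) (min_dilation H T j y) = (if i = j then cinner x y else 0)"
    if "x \<in> dilation_space" "y \<in> dilation_space" for i j x y
    using that cinner_min_dilation by (cases x; cases y) auto
  show "bounded_op dilation_space dilation_space (min_dilation H T j)" for j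
  proof (rule bounded_op_isometry)
    show "min_dilation H T j x \<in> dilation_space" if "x \<in> dilation_space" for x
      using that min_dilation_in by (cases x) auto
    show "min_dilation H T j (x + y) = min_dilation H T j x + min_dilation H T j y"
      if "x \<in> dilation_space" "y \<in> dilation_space" for x y
      using that by (cases x; cases y)
        (simp add: min_dilation_def bounded_op_add[OF bounded_T] defect_axis_add vacuum_add creation_add)
    show "min_dilation H T j (a *\<^sub>C x) = a *\<^sub>C min_dilation H T j x"
      if "x \<in> dilation_space" for a x
      using that by (cases x)
        (simp add: min_dilation_def bounded_op_scaleC[OF bounded_T] defect_axis_scaleC vacuum_scaleC
          creation_scaleC scaleC_add_right)
  qed (simp add: iso)
qed

lemma fst_word_min_dilation: "fst (word_op (min_dilation H T) \<alpha> x) = word_op T \<alpha> (fst x)"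
  by (induction \<alpha>) (auto simp: min_dilation_def split_beta)

lemma isometric_dilation_min_dilation:
  "isometric_dilation dilation_space (min_dilation H T) H T (\<lambda>x. (x, 0))"
proof -
  interpret row_isometry dilation_space "min_dilation H T"
    by (rule row_isometry_min_dilation)
  show ?thesis
  proof
    show "bounded_op H dilation_space (\<lambda>x. (x, 0))"
      by (rule bounded_op_isometry)
        (auto simp: csubspace_0 csubspace_fock_on sub_defect_space)
    show "cinner (word_op (min_dilation H T) \<alpha> (x, 0)) (y, 0) = cinner (word_op T \<alpha> x) y" for \<alpha> x y
      by (simp add: cinner_prod_def fst_word_min_dilation)
  qed
qed

end

section \<open>The characteristic function of a lifting\<close>

text \<open>The block form of a lifting is recorded as \<open>fst_E\<close>: taking first components
  carries \<open>E\<close> to \<open>C\<close>. Two successive compressions then make the minimal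
  dilation of \<open>E\<close> an isometric dilation of \<open>C\<close> too.\<close>

locale contractive_lift =
  base: row_contraction_on HC C + lift: row_contraction_on "HC \<times> HA" E
  for HC :: "'c :: chilbert_space set" and C :: "'d :: finite \<Rightarrow> 'c \<Rightarrow> 'c"
    and HA :: "'a :: chilbert_space set" and E :: "'d \<Rightarrow> 'c \<times> 'a \<Rightarrow> 'c \<times> 'a" +
  assumes closed_HA: "closed_csubspace HA"
    and fst_E: "x \<in> HC \<times> HA \<Longrightarrow> fst (E j x) = C j (fst x)"
begin

abbreviation "V \<equiv> min_dilation (HC \<times> HA) E"
abbreviation "\<iota>E \<equiv> (\<lambda>x :: 'c \<times> 'a. (x, 0 :: ('d, ('c \<times> 'a) ^ 'd) fock))"
abbreviation "\<iota>C \<equiv> (\<lambda>h :: 'c. ((h, 0 :: 'a), 0 :: ('d, ('c \<times> 'a) ^ 'd) fock))"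

lemma sub_HA: "csubspace HA"
  by (rule closed_csubspace_csubspace[OF closed_HA])

lemma incl_in: "h \<in> HC \<Longrightarrow> (h, 0) \<in> HC \<times> HA"
  by (simp add: csubspace_0[OF sub_HA])

lemma fst_word_E: "x \<in> HC \<times> HA \<Longrightarrow> fst (word_op E \<alpha> x) = word_op C \<alpha> (fst x)"
  by (induction \<alpha>) (simp_all add: fst_E lift.word_T_in del: mem_Times_iff)

sublocale E: isometric_dilation lift.dilation_space V "HC \<times> HA" E \<iota>E
  by (rule lift.isometric_dilation_min_dilation)

sublocale C: isometric_dilation lift.dilation_space V HC C \<iota>C
proof
  show "bounded_op HC lift.dilation_space \<iota>C"
    by (rule bounded_op_isometry)
      (auto simp: csubspace_0 sub_HA csubspace_fock_on lift.sub_defect_space)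
  show "cinner (word_op V \<alpha> (\<iota>C x)) (\<iota>C y) = cinner (word_op C \<alpha> x) y" if "x \<in> HC" "y \<in> HC" for \<alpha> x y
    using fst_word_E[OF incl_in[OF that(1)], of \<alpha>]
    by (simp add: cinner_prod_def lift.fst_word_min_dilation)
qed

abbreviation "DE \<equiv> defect_space (HC \<times> HA) E"
abbreviation "DC \<equiv> defect_space HC C"
abbreviation "KE \<equiv> canonical_K (HC \<times> HA) E \<iota>E V"
abbreviation "KC \<equiv> canonical_K HC C \<iota>C V"

text \<open>Paired with \<open>g\<close>, the adjoint moves \<open>KC\<close> to the other side, and
  the projection disappears because \<open>KC g\<close> lies in its range.\<close>

lemma
  assumes f: "f \<in> fock_on DE"
  shows char_fun_in: "char_fun HC HA C E f \<in> fock_on DC"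
    and cinner_char_fun: "g \<in> fock_on DC \<Longrightarrow> cinner g (char_fun HC HA C E f) = cinner (KC g) (KE f)"
proof -
  note closed = closed_csubspace_fock_on[OF base.closed_defect_space]
  note KC = unitary_op_bounded[OF C.unitary_K]
  have eq: "char_fun HC HA C E f = adj (fock_on DC) (wandering_sum HC \<iota>C V) KC (proj (wandering_sum HC \<iota>C V) (KE f))"
    by (simp add: char_fun_def Let_def)
  show "char_fun HC HA C E f \<in> fock_on DC"
    unfolding eq by (rule adj_in[OF closed KC])
  show "cinner g (char_fun HC HA C E f) = cinner (KC g) (KE f)" if "g \<in> fock_on DC"
    unfolding eq cinner_adj[OF closed KC that]
    by (rule cinner_proj_right[OF C.closed_wandering_sum bounded_op_in[OF KC that]])
qed

lemma inj_on_symbol_char_fun: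
  assumes minimal: "minimal_lifting HC HA E"
  shows "inj_on (symbol (char_fun HC HA C E)) DE"
proof (rule inj_onI)
  fix \<delta> \<delta>'
  assume \<delta>: "\<delta> \<in> DE" "\<delta>' \<in> DE" and eq: "symbol (char_fun HC HA C E) \<delta> = symbol (char_fun HC HA C E) \<delta>'"
  define l where "l = E.\<kappa> \<delta> - E.\<kappa> \<delta>'"
  have l: "l \<in> wandering (HC \<times> HA) \<iota>E V"
    unfolding l_def by (intro csubspace_diff closed_csubspace_csubspace[OF E.closed_wandering] E.kappa_in \<delta>)
  \<comment> \<open>Pairing the two equal symbols with an elementary tensor moves the equality into
    the dilation space, where \<open>KC\<close> turns that tensor into the word \<beta> applied to
    \<kappa>_C \<gamma>.\<close>
  have orth: "cinner (word_op V \<beta> (C.\<kappa> \<gamma>)) l = 0" if "\<gamma> \<in> DC" for \<beta> \<gamma>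
  proof -
    let ?g = "word_op creation \<beta> (vacuum \<otimes>\<^sub>F \<gamma>)"
    have g: "?g \<in> fock_on DC"
      by (intro word_vacuum_fock_on base.sub_defect_space that)
    have "cinner (KC ?g) (KE (vacuum \<otimes>\<^sub>F \<delta>)) = cinner (KC ?g) (KE (vacuum \<otimes>\<^sub>F \<delta>'))"
      using eq by (simp add: symbol_def g \<delta> vacuum_fock_on lift.sub_defect_space flip: cinner_char_fun)
    then show ?thesis
      by (simp add: l_def E.K_vacuum \<delta> C.K_word that cinner_diff_right)
  qed
  have l_C: "cinner (word_op V \<alpha> (\<iota>C h)) l = 0" if "h \<in> HC" for \<alpha> h
    using that
  proof (induction \<alpha> arbitrary: h rule: rev_induct)
    case Nil
    then show ?case
      using E.wandering_orthogonal_\<iota>[OF l incl_in] by (simp add: cinner_eq_0_sym[of l])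
  next
    \<comment> \<open>The last letter is split off because V_\<beta> V_i h differs from V_\<beta>
      C_i h by V_\<beta> applied to a wandering vector of \<open>C\<close>; the shorter word then
      acts on the base vector C_i h.\<close>
    case (snoc i \<beta>)
    let ?a = "axis i h :: 'c ^ 'd"
    have a: "?a \<in> column_space HC"
      by (rule axis_column_space[OF base.sub_H snoc.prems])
    have "cinner (word_op V \<beta> (V i (\<iota>C h) - \<iota>C (C i h))) l = 0"
      using orth[OF base.defect_op_in[OF a], of \<beta>] C.kappa_defect_op[OF a]
      by (simp add: C.wander_axis snoc.prems)
    then show ?case
      using snoc.IH[OF base.T_in[OF snoc.prems]]
        bounded_op_diff[OF E.bounded_word E.sub_K E.V_in[OF C.\<iota>_in[OF snoc.prems]] C.\<iota>_in[OF base.T_in[OF snoc.prems]]]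
      by (simp add: word_op_append cinner_diff_left)
  qed
  have l_E: "cinner (V j (\<iota>E (word_op E \<alpha> (h, 0)))) l = 0" if "h \<in> HC" for \<alpha> j h
    using E.cinner_wandering_V_word[OF l incl_in[OF that], of j \<alpha>] l_C[OF that, of "j # \<alpha>", unfolded word_op_Cons]
    by (metis cinner_eq_0_sym)
  \<comment> \<open>Quantifying over all words, and not only the empty one, makes the set invariant
    under \<open>E\<close>; the empty word is what is extracted at the end.\<close>
  let ?S = "{x \<in> HC \<times> HA. \<forall>i\<in>UNIV. cinner (V (fst i) (\<iota>E (word_op E (snd i) x))) l = 0}"
  have "bounded_op (HC \<times> HA) UNIV (\<lambda>x. cinner (V j (\<iota>E (word_op E \<alpha> x))) l)" for j \<alpha>
    by (intro bounded_op_compose[OF lift.bounded_word_T]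
        bounded_op_compose[OF E.bounded_\<iota>] bounded_op_compose[OF E.bounded_V] bounded_op_cinner)
  then have "closed_csubspace ?S"
    by (intro closed_csubspace_kernels lift.closed_H)
  moreover have "E j ` ?S \<subseteq> ?S" for j
  proof
    fix y
    assume "y \<in> E j ` ?S"
    then obtain x where x: "x \<in> ?S" "y = E j x"
      by blast
    have "cinner (V i (\<iota>E (word_op E \<alpha> y))) l = 0" for i \<alpha>
    proof -
      have "cinner (V i (\<iota>E (word_op E (\<alpha> @ [j]) x))) l = 0"
        using x(1) by (simp del: word_op_append)
      then show ?thesis
        by (simp add: x(2) word_op_append)
    qed
    moreover have "y \<in> HC \<times> HA"
      using x lift.T_in[of x j] by blast
    ultimately show "y \<in> ?S"
      by simp
  qed
  moreover have "HC \<times> {0} \<subseteq> ?S"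
    using l_E incl_in by auto
  ultimately have "(\<lambda>S. closed_csubspace S \<and> S \<subseteq> HC \<times> HA \<and> (\<forall>j. E j ` S \<subseteq> S)) hull (HC \<times> {0}) \<subseteq> ?S"
    by (intro hull_minimal) auto
  then have "HC \<times> HA \<subseteq> ?S"
    using minimal by (simp add: minimal_lifting_def)
  have "cinner l (V j (\<iota>E x)) = 0" if "x \<in> HC \<times> HA" for x j
  proof -
    have "x \<in> ?S"
      using that \<open>HC \<times> HA \<subseteq> ?S\<close> by (rule subsetD[rotated])
    then have "\<forall>i\<in>UNIV. cinner (V (fst i) (\<iota>E (word_op E (snd i) x))) l = 0"
      unfolding mem_Collect_eq by (rule conjunct2)
    from bspec[OF this, of "(j, [])"] show ?thesis
      by (simp add: cinner_eq_0_sym[of l])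
  qed
  then have "l = 0"
    by (rule E.wandering_eq_0[OF l])
  then show "\<delta> = \<delta>'"
    by (simp add: l_def unitary_op_eq_iff[OF E.unitary_kappa lift.sub_defect_space] \<delta>)
qed

end

lemma contractive_lift_intro:
  assumes HC: "closed_csubspace HC" and C: "row_contraction HC C" and E: "contractive_lifting HC HA C E"
  shows "contractive_lift HC C HA E"
proof
  show "closed_csubspace HA" "row_contraction (HC \<times> HA) E" "row_contraction HC C" "closed_csubspace HC"
    using assms by (auto simp: contractive_lifting_def lifting_def)
  then show "closed_csubspace (HC \<times> HA)"
    using HC by (intro closed_csubspace_Times)
  show "fst (E j x) = C j (fst x)" if "x \<in> HC \<times> HA" for j x
    using E that by (cases x) (auto simp: contractive_lifting_def lifting_def)
qed

section \<open>The model of a contractive multi-analytic operator\<close>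

locale model = row_contraction_on HC C
  for HC :: "'c :: chilbert_space set" and C :: "'d :: finite \<Rightarrow> 'c \<Rightarrow> 'c" +
  fixes D :: "'e :: chilbert_space set" and M :: "('d, 'e) fock \<Rightarrow> ('d, 'c ^ 'd) fock"
  assumes closed_D: "closed_csubspace D"
    and multi_analytic: "multi_analytic D (defect_space HC C) M"
    and contractive: "contractive (fock_on D) M"
begin

abbreviation "DC \<equiv> defect_space HC C"
abbreviation "\<Delta> \<equiv> model_defect D DC M"
abbreviation "K0 \<equiv> model_space D DC M"
abbreviation "shift \<equiv> model_shift D DC M"
abbreviation "W \<equiv> model_W D DC M"
abbreviation "HA \<equiv> model_HA D DC M"
abbreviation "V \<equiv> model_dilation HC C D M"
abbreviation "E \<equiv> lifting_of HC C D M"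
abbreviation "d j h \<equiv> defect_op HC C (axis j h)"

lemma sub_D: "csubspace D"
  by (rule closed_csubspace_csubspace[OF closed_D])

lemma closed_FD: "closed_csubspace (fock_on D :: ('d, 'e) fock set)"
  by (rule closed_csubspace_fock_on[OF closed_D])

lemma sub_FD: "csubspace (fock_on D :: ('d, 'e) fock set)"
  by (rule closed_csubspace_csubspace[OF closed_FD])

lemma closed_FL: "closed_csubspace (fock_on DC :: ('d, 'c ^ 'd) fock set)"
  by (rule closed_csubspace_fock_on[OF closed_defect_space])

lemma sub_FL: "csubspace (fock_on DC :: ('d, 'c ^ 'd) fock set)"
  by (rule closed_csubspace_csubspace[OF closed_FL])

lemma bounded_M: "bounded_op (fock_on D) (fock_on DC) M"
  and M_creation: "f \<in> fock_on D \<Longrightarrow> M (creation j f) = creation j (M f)"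
  and M_le: "f \<in> fock_on D \<Longrightarrow> norm (M f) \<le> norm f"
  using multi_analytic contractive by (auto simp: multi_analytic_def contractive_def)

lemma M_in: "f \<in> fock_on D \<Longrightarrow> M f \<in> fock_on DC"
  by (rule bounded_op_in[OF bounded_M])

definition defect_M :: "('d, 'e) fock \<Rightarrow> ('d, 'e) fock"
  where "defect_M \<xi> = \<xi> - adj (fock_on D) (fock_on DC) M (M \<xi>)"

lemma model_defect_eq: "\<Delta> = op_sqrt (fock_on D) defect_M"
  by (simp add: model_defect_def defect_M_def[abs_def])

lemma cinner_defect_M:
  "\<xi> \<in> fock_on D \<Longrightarrow> \<zeta> \<in> fock_on D \<Longrightarrow> cinner (defect_M \<xi>) \<zeta> = cinner \<xi> \<zeta> - cinner (M \<xi>) (M \<zeta>)"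
  by (simp add: defect_M_def cinner_diff_left cinner_adj_left[OF closed_FD bounded_M])

lemma bounded_defect_M: "bounded_op (fock_on D) (fock_on D) defect_M"
  unfolding defect_M_def
  by (intro bounded_op_minus_fun bounded_op_id sub_FD
      bounded_op_compose[OF bounded_op_mono[OF bounded_M order_refl subset_UNIV]]
      bounded_op_adj[OF closed_FD bounded_M])

lemma defect_M_positive: "op_le (fock_on D) (\<lambda>_. 0) defect_M"
  unfolding op_le_def
proof
  fix \<xi> :: "('d, 'e) fock"
  assume \<xi>: "\<xi> \<in> fock_on D"
  have "cinner (defect_M \<xi> - 0) \<xi> = complex_of_real ((norm \<xi>)\<^sup>2 - (norm (M \<xi>))\<^sup>2)"
    by (simp add: cinner_defect_M \<xi> cinner_self)
  moreover have "(norm (M \<xi>))\<^sup>2 \<le> (norm \<xi>)\<^sup>2"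
    by (intro power_mono M_le \<xi>) simp
  ultimately show "cinner (defect_M \<xi> - 0) \<xi> \<in> \<real>\<^sub>\<ge>\<^sub>0"
    by (simp only: nonneg_Reals_of_real_iff)
qed

lemma bounded_\<Delta>: "bounded_op (fock_on D) (fock_on D) \<Delta>"
  unfolding model_defect_eq by (rule bounded_op_op_sqrt[OF closed_FD bounded_defect_M defect_M_positive])

lemma cinner_\<Delta>:
  assumes "\<xi> \<in> fock_on D" "\<zeta> \<in> fock_on D"
  shows "cinner (\<Delta> \<xi>) (\<Delta> \<zeta>) = cinner \<xi> \<zeta> - cinner (M \<xi>) (M \<zeta>)"
  unfolding model_defect_eq cinner_defect_M[OF assms, symmetric]
  by (rule cinner_op_sqrt[OF closed_FD bounded_defect_M defect_M_positive assms])

lemma cinner_\<Delta>_creation: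
  "\<xi> \<in> fock_on D \<Longrightarrow> \<zeta> \<in> fock_on D \<Longrightarrow>
    cinner (\<Delta> (creation i \<xi>)) (\<Delta> (creation j \<zeta>)) = (if i = j then cinner (\<Delta> \<xi>) (\<Delta> \<zeta>) else 0)"
  by (simp add: cinner_\<Delta> creation_fock_on sub_D cinner_creation M_creation)

lemma \<Delta>_0 [simp]: "\<Delta> 0 = 0"
  by (rule bounded_op_0[OF bounded_\<Delta> sub_FD])

section \<open>The model space and its shift\<close>

lemma model_space_eq: "K0 = fock_on DC \<times> closed_cspan (\<Delta> ` fock_on D)"
  unfolding model_space_def
  by (simp add: closed_cspan_eq_closure[OF bounded_op_image_csubspace[OF bounded_\<Delta> sub_FD]])

lemma closed_K0: "closed_csubspace K0"
  unfolding model_space_eq by (intro closed_csubspace_Times closed_FL closed_csubspace_closed_cspan)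

lemma sub_K0: "csubspace K0"
  by (rule closed_csubspace_csubspace[OF closed_K0])

lemma model_space_pair: "\<eta> \<in> fock_on DC \<Longrightarrow> \<xi> \<in> fock_on D \<Longrightarrow> (\<eta>, \<Delta> \<xi>) \<in> K0"
  unfolding model_space_eq using closed_cspan_superset[of "\<Delta> ` fock_on D"] by auto

abbreviation "gens \<equiv> (\<lambda>(\<eta>, \<xi>). (\<eta>, \<Delta> \<xi>)) ` (fock_on DC \<times> fock_on D)"

lemma model_space_generated: "closed_cspan gens = K0"
proof (rule closed_cspan_eqI[OF closed_K0])
  show "gens \<subseteq> K0"
    using model_space_pair by auto
  fix z
  assume z: "z \<in> K0" and orth: "\<And>x. x \<in> gens \<Longrightarrow> cinner z x = 0"
  obtain \<eta> \<zeta> where z_eq: "z = (\<eta>, \<zeta>)"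
    by (cases z)
  have o: "cinner \<eta> \<eta>' + cinner \<zeta> (\<Delta> \<xi>) = 0" if "\<eta>' \<in> fock_on DC" "\<xi> \<in> fock_on D" for \<eta>' \<xi>
    using orth[of "(\<eta>', \<Delta> \<xi>)"] that by (force simp: z_eq)
  have "\<eta> = 0"
    using o[of \<eta> 0] z by (simp add: z_eq model_space_eq csubspace_0[OF sub_FD])
  moreover have "\<zeta> = 0"
  proof (rule closed_cspan_orthogonal_self)
    show "\<zeta> \<in> closed_cspan (\<Delta> ` fock_on D)"
      using z by (simp add: z_eq model_space_eq)
    show "cinner x \<zeta> = 0" if "x \<in> \<Delta> ` fock_on D" for x
      using o[OF csubspace_0[OF sub_FL]] that by (subst cinner_eq_0_sym) auto
  qed
  ultimately show "z = 0"
    by (simp add: z_eq zero_prod_def)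
qed

text \<open>Since \<open>M\<close> commutes with creation, the vectors \<Delta>(L_j \<xi>) have the
  same Gram matrix as the vectors \<Delta> \<xi>. The Gram criterion therefore yields a well-defined
  isometry although \<Delta> need not be injective.\<close>

lemma
  shows bounded_shift: "bounded_op K0 K0 (shift j)"
    and shift_pair: "\<eta> \<in> fock_on DC \<Longrightarrow> \<xi> \<in> fock_on D \<Longrightarrow>
      shift j (\<eta>, \<Delta> \<xi>) = (creation j \<eta>, \<Delta> (creation j \<xi>))"
proof -
  let ?v = "\<lambda>(\<eta>, \<xi>). (creation j \<eta>, \<Delta> (creation j \<xi>))"
  have "\<exists>U. unitary_op (closed_cspan gens) (closed_cspan (?v ` (fock_on DC \<times> fock_on D))) U \<and>
      (\<forall>p\<in>fock_on DC \<times> fock_on D. U (case p of (\<eta>, \<xi>) \<Rightarrow> (\<eta>, \<Delta> \<xi>)) = ?v p)"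
    by (rule unitary_op_Gram) (auto simp: cinner_creation cinner_\<Delta>_creation)
  then obtain U where U: "unitary_op K0 (closed_cspan (?v ` (fock_on DC \<times> fock_on D))) U"
    "\<And>\<eta> \<xi>. \<eta> \<in> fock_on DC \<Longrightarrow> \<xi> \<in> fock_on D \<Longrightarrow> U (\<eta>, \<Delta> \<xi>) = (creation j \<eta>, \<Delta> (creation j \<xi>))"
    unfolding model_space_generated by auto
  have "?v ` (fock_on DC \<times> fock_on D) \<subseteq> K0"
    by (auto intro!: model_space_pair creation_fock_on sub_defect_space sub_D)
  then have "closed_cspan (?v ` (fock_on DC \<times> fock_on D)) \<subseteq> K0"
    by (rule closed_cspan_minimal[OF _ closed_K0])
  then have "bounded_op K0 K0 U"
    by (rule unitary_op_bounded_into[OF U(1)])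
  with U(2) have "\<exists>V. bounded_op K0 K0 V \<and> (\<forall>\<eta>\<in>fock_on DC. \<forall>\<xi>\<in>fock_on D.
      V (\<eta>, \<Delta> \<xi>) = (creation j \<eta>, \<Delta> (creation j \<xi>)))"
    by blast
  from someI_ex[OF this]
  show "bounded_op K0 K0 (shift j)"
    and "\<eta> \<in> fock_on DC \<Longrightarrow> \<xi> \<in> fock_on D \<Longrightarrow>
      shift j (\<eta>, \<Delta> \<xi>) = (creation j \<eta>, \<Delta> (creation j \<xi>))"
    unfolding model_shift_def[symmetric] by blast+
qed

lemma shift_in: "x \<in> K0 \<Longrightarrow> shift j x \<in> K0"
  by (rule bounded_op_in[OF bounded_shift])

lemma bounded_op_eq_on_model_space:
  assumes "bounded_op K0 R f" "bounded_op K0 R g" "x \<in> K0"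
    and "\<And>\<eta> \<xi>. \<eta> \<in> fock_on DC \<Longrightarrow> \<xi> \<in> fock_on D \<Longrightarrow> f (\<eta>, \<Delta> \<xi>) = g (\<eta>, \<Delta> \<xi>)"
  shows "f x = g x"
  by (rule bounded_op_eq_on_closed_cspan[OF assms(1,2) sub_K0, where X = gens])
    (use assms(3,4) model_space_pair in \<open>auto simp: model_space_generated\<close>)

text \<open>Needed to see that the shift is orthogonal to the vacuum vectors which the base feeds
  into the first component.\<close>

lemma fst_shift: "x \<in> K0 \<Longrightarrow> fst (shift j x) = creation j (fst x)"
  by (rule bounded_op_eq_on_model_space[where f = "\<lambda>x. fst (shift j x)"])
    (auto simp: shift_pair intro: bounded_op_compose[OF bounded_shift bounded_op_fst]
      bounded_op_compose[OF bounded_op_fst bounded_creation])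

lemma cinner_shift:
  assumes "x \<in> K0" "y \<in> K0"
  shows "cinner (shift i x) (shift j y) = (if i = j then cinner x y else 0)"
proof -
  have bd: "bounded_op K0 UNIV (\<lambda>x. cinner (shift i x) z)" for i z
    by (rule bounded_op_compose[OF bounded_shift bounded_op_cinner])
  have bd': "bounded_op K0 UNIV (\<lambda>x. if i = j then cinner x z else 0)" for i j :: 'd and z
    by (cases "i = j") (simp_all add: bounded_op_cinner bounded_op_zero)
  \<comment> \<open>Density is used one argument at a time: \<open>x\<close> is extended first,
    against pairs; after conjugation the same argument extends \<open>y\<close>.\<close>
  have 1: "cinner (shift i x) (shift j (\<eta>, \<Delta> \<xi>)) = (if i = j then cinner x (\<eta>, \<Delta> \<xi>) else 0)"
    if "x \<in> K0" "\<eta> \<in> fock_on DC" "\<xi> \<in> fock_on D" for x \<eta> \<xi> i j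
    by (rule bounded_op_eq_on_model_space[OF bd, where g = "\<lambda>x. if i = j then cinner x (\<eta>, \<Delta> \<xi>) else 0"])
      (use that bd' in \<open>auto simp: shift_pair cinner_creation cinner_\<Delta>_creation\<close>)
  have 2: "cinner (shift j (\<eta>, \<Delta> \<xi>)) (shift i x) = (if j = i then cinner (\<eta>, \<Delta> \<xi>) x else 0)"
    if "x \<in> K0" "\<eta> \<in> fock_on DC" "\<xi> \<in> fock_on D" for x \<eta> \<xi> i j
    using 1[OF that, of i j] by (metis cinner_commute complex_cnj_zero)
  have "cinner (shift j y) (shift i x) = (if j = i then cinner y x else 0)"
    by (rule bounded_op_eq_on_model_space[OF bd, where g = "\<lambda>y. if j = i then cinner y x else 0"])
      (use assms 2 bd' in auto)
  then show ?thesis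
    by (metis cinner_commute complex_cnj_zero)
qed

section \<open>The row isometry on the base space plus the model space\<close>

abbreviation "K \<equiv> HC \<times> K0"

text \<open>The definition sends \<eta> through the minimal dilation of \<open>C\<close> and \<zeta>
  through the shift. On \<eta> the shift is creation, so linearity reunites the two pieces.\<close>

lemma model_dilation_eq:
  assumes "x \<in> K0"
  shows "V j (h, x) = (C j h, (vacuum \<otimes>\<^sub>F d j h, 0) + shift j x)"
proof -
  obtain \<eta> \<zeta> where x: "x = (\<eta>, \<zeta>)"
    by (cases x)
  have \<eta>: "\<eta> \<in> fock_on DC" "(\<eta>, 0) \<in> K0" "(0, \<zeta>) \<in> K0"
    using assms csubspace_0[OF sub_FL]
    by (auto simp: x model_space_eq csubspace_0 closed_csubspace_csubspace closed_csubspace_closed_cspan)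
  have "shift j x = shift j (\<eta>, 0) + shift j (0, \<zeta>)"
    using bounded_op_add[OF bounded_shift \<eta>(2,3)] by (simp add: x)
  also have "shift j (\<eta>, 0) = (creation j \<eta>, 0)"
    using shift_pair[OF \<eta>(1) csubspace_0[OF sub_FD]] by simp
  finally have "shift j x = (creation j \<eta>, 0) + shift j (0, \<zeta>)" .
  then show ?thesis
    by (simp add: model_dilation_def min_dilation_def x flip: add.assoc)
qed

lemma vacuum_d_in: "h \<in> HC \<Longrightarrow> vacuum \<otimes>\<^sub>F d j h \<in> fock_on DC"
  by (intro vacuum_fock_on sub_defect_space defect_op_in axis_column_space sub_H)

lemma vacuum_d_K0: "h \<in> HC \<Longrightarrow> (vacuum \<otimes>\<^sub>F d j h, 0) \<in> K0"
  using model_space_pair[OF vacuum_d_in csubspace_0[OF sub_FD]] by simp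

lemma row_isometry_V: "row_isometry K V"
proof
  show "closed_csubspace K"
    by (intro closed_csubspace_Times closed_H closed_K0)
  show iso: "cinner (V i x) (V j y) = (if i = j then cinner x y else 0)" if "x \<in> K" "y \<in> K" for i j x y
  proof -
    obtain h k h' k' where eq: "x = (h, k)" "y = (h', k')"
      by (cases x, cases y)
    with that have "h \<in> HC" "h' \<in> HC" "k \<in> K0" "k' \<in> K0"
      by simp_all
    then show ?thesis
      by (simp add: eq model_dilation_eq cinner_add_left cinner_add_right cinner_shift)
        (simp add: cinner_prod_def fst_shift cinner_vacuum_vacuum cinner_defect_axis)
  qed
  show "bounded_op K K (V j)" for j
  proof (rule bounded_op_isometry)
    show "V j x \<in> K" if "x \<in> K" for x
      using that
      by (auto simp: model_dilation_eq intro!: T_in csubspace_add sub_K0 vacuum_d_K0 shift_in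
          simp del: mem_Times_iff)
    show "V j (x + y) = V j x + V j y" if "x \<in> K" "y \<in> K" for x y
    proof -
      obtain h k h' k' where eq: "x = (h, k)" "y = (h', k')"
        by (cases x, cases y)
      with that have "h \<in> HC" "h' \<in> HC" "k \<in> K0" "k' \<in> K0"
        by simp_all
      then show ?thesis
        by (simp add: eq model_dilation_eq csubspace_add[OF sub_K0] bounded_op_add[OF bounded_T]
            bounded_op_add[OF bounded_shift] defect_axis_add vacuum_add algebra_simps
            flip: add_Pair[of _ 0 _ 0, simplified])
    qed
    show "V j (a *\<^sub>C x) = a *\<^sub>C V j x" if "x \<in> K" for a x
    proof -
      obtain h k where eq: "x = (h, k)"
        by (cases x)
      with that have "h \<in> HC" "k \<in> K0"
        by simp_all
      then show ?thesis
        by (simp add: eq model_dilation_eq csubspace_scaleC[OF sub_K0] bounded_op_scaleC[OF bounded_T]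
            bounded_op_scaleC[OF bounded_shift] defect_axis_scaleC vacuum_scaleC scaleC_add_right)
    qed
  qed (simp add: iso)
qed

sublocale V: row_isometry K V
  by (rule row_isometry_V)

end

section \<open>The lifting compressed from the model dilation\<close>

context model
begin

lemma cinner_W: "\<xi> \<in> fock_on D \<Longrightarrow> \<zeta> \<in> fock_on D \<Longrightarrow> cinner (W \<xi>) (W \<zeta>) = cinner \<xi> \<zeta>"
  by (simp add: model_W_def cinner_\<Delta>)

lemma W_in: "\<xi> \<in> fock_on D \<Longrightarrow> W \<xi> \<in> K0"
  by (simp add: model_W_def model_space_pair M_in)

lemma unitary_W: "unitary_op (fock_on D) (W ` fock_on D) W"
  and closed_W: "closed_csubspace (W ` fock_on D)"
  using isometry_image[OF closed_FD, of W] cinner_W by blast+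

lemma shift_W: "\<xi> \<in> fock_on D \<Longrightarrow> shift j (W \<xi>) = W (creation j \<xi>)"
  by (simp add: model_W_def shift_pair M_in M_creation)

lemma W_add: "\<xi> \<in> fock_on D \<Longrightarrow> \<zeta> \<in> fock_on D \<Longrightarrow> W (\<xi> + \<zeta>) = W \<xi> + W \<zeta>"
  by (rule bounded_op_add[OF unitary_op_bounded[OF unitary_W]])

lemma W_0 [simp]: "W 0 = 0"
  by (rule bounded_op_0[OF unitary_op_bounded[OF unitary_W] sub_FD])

lemma V_0: "x \<in> K0 \<Longrightarrow> V j (0, x) = (0, shift j x)"
  by (simp add: model_dilation_eq bounded_op_0[OF bounded_T sub_H]
      defect_axis_scaleC[of 0 j 0, simplified] csubspace_0[OF sub_H] zero_prod_def[symmetric])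

lemma V_W: "\<xi> \<in> fock_on D \<Longrightarrow> V j (0, W \<xi>) = (0, W (creation j \<xi>))"
  by (simp add: V_0 W_in shift_W)

lemma closed_HA: "closed_csubspace HA"
  unfolding model_HA_def by (rule closed_csubspace_ominus[OF closed_K0])

abbreviation "HE \<equiv> HC \<times> HA"

lemma closed_HE: "closed_csubspace HE"
  by (intro closed_csubspace_Times closed_H closed_HA)

lemma HA_K0: "HA \<subseteq> K0"
  by (auto simp: model_HA_def ominus_def)

lemma HE_K: "HE \<subseteq> K"
  using HA_K0 by blast

lemma cinner_HA_W: "a \<in> HA \<Longrightarrow> \<xi> \<in> fock_on D \<Longrightarrow> cinner a (W \<xi>) = 0"
  by (simp add: model_HA_def ominus_def)

lemma cinner_W_HE: "x \<in> HE \<Longrightarrow> \<xi> \<in> fock_on D \<Longrightarrow> cinner (0, W \<xi>) x = 0"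
  using cinner_HA_W by (cases x) (auto simp: cinner_eq_0_sym[of "W \<xi>"])

lemma proj_HE: "h \<in> HC \<Longrightarrow> proj HE (h, k) = (h, proj HA k)"
  by (rule proj_eqI[OF closed_csubspace_csubspace[OF closed_HE]])
    (auto simp: proj_in[OF closed_HA] proj_cinner_diff[OF closed_HA])

text \<open>The complement of \<open>HE\<close> is the copy of the Fock space over \<open>D\<close>
  under \<open>W\<close>: the residue \<open>z\<close> minus its projection onto that copy lies in
  \<open>HA\<close>, but both terms are orthogonal to \<open>HA\<close>, so it vanishes.\<close>

lemma HE_decomposition:
  assumes "x \<in> K"
  obtains \<xi> where "\<xi> \<in> fock_on D" "x = proj HE x + (0, W \<xi>)"
proof -
  obtain h k where x: "x = (h, k)"
    by (cases x)
  with assms have hk: "h \<in> HC" "k \<in> K0"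
    by simp_all
  define z where "z = k - proj HA k"
  have z: "z \<in> K0"
    unfolding z_def using subsetD[OF HA_K0 proj_in[OF closed_HA]] hk
    by (intro csubspace_diff sub_K0) auto
  let ?w = "proj (W ` fock_on D) z"
  have w: "?w \<in> W ` fock_on D"
    by (rule proj_in[OF closed_W])
  then have "?w \<in> K0"
    using W_in by auto
  then have zw: "z - ?w \<in> HA"
    using z proj_cinner_diff[OF closed_W] by (auto simp: model_HA_def ominus_def intro!: csubspace_diff sub_K0)
  have "cinner z (z - ?w) = 0"
    unfolding z_def using zw[unfolded z_def] by (rule proj_cinner_diff[OF closed_HA])
  moreover have "cinner ?w (z - ?w) = 0"
    using w cinner_HA_W[OF zw] by (subst cinner_eq_0_sym) auto
  ultimately have "cinner (z - ?w) (z - ?w) = 0"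
    by (simp add: cinner_diff_left)
  then have "z = ?w"
    by simp
  with w obtain \<xi> where "\<xi> \<in> fock_on D" "z = W \<xi>"
    by auto
  then show thesis
    using that hk(1) by (simp add: x proj_HE z_def algebra_simps)
qed

lemma lifting_of_eq: "E j x = proj HE (V j x)"
  by (simp add: lifting_of_def)

lemma bounded_E: "bounded_op HE HE (E j)"
  unfolding lifting_of_eq[abs_def]
  by (rule bounded_op_compose[OF bounded_op_mono[OF V.bounded_V HE_K order_refl]
        bounded_op_mono[OF bounded_op_proj[OF closed_HE] subset_UNIV order_refl]])

lemma E_in: "x \<in> HE \<Longrightarrow> E j x \<in> HE"
  by (rule bounded_op_in[OF bounded_E])

lemma word_E_in: "x \<in> HE \<Longrightarrow> word_op E \<alpha> x \<in> HE"
  by (rule bounded_op_in[OF bounded_op_word_op[OF bounded_E]])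

text \<open>The row operator of \<open>E\<close> is a projection applied to the row operator of
  \<open>V\<close>, which is isometric.\<close>

lemma row_contraction_E: "row_contraction HE E"
proof -
  have "norm (row_op E x) \<le> norm x" if x: "x \<in> column_space HE" for x
  proof -
    have xK: "x $ i \<in> K" for i
      using column_space_nth[OF x] HE_K by blast
    have "row_op E x = proj HE (row_op V x)"
      unfolding row_op_def lifting_of_eq
      by (rule bounded_op_sum[OF bounded_op_proj[OF closed_HE] csubspace_UNIV, symmetric]) simp
    then have "norm (row_op E x) \<le> norm (row_op V x)"
      by (simp add: norm_proj_le[OF closed_HE])
    also have "\<dots> = norm x"
      by (rule norm_eqI_cinner)
        (simp add: row_op_def cinner_sum_left cinner_sum_right V.cinner_V xK cinner_vec_def[of x] del: mem_Times_iff)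
    finally show ?thesis .
  qed
  then show ?thesis
    using row_contraction_iff[of HE E, OF closed_HE bounded_E] by blast
qed

lemma contractive_lifting_E: "contractive_lifting HC HA C E"
proof -
  let ?B = "\<lambda>j h. proj HA (vacuum \<otimes>\<^sub>F d j h, 0)"
  let ?A = "\<lambda>j a. proj HA (shift j a)"
  \<comment> \<open>The squared norm of the defect vector is |h|^2 - |C_j h|^2, hence the bound 1;
    this is what makes the lower left block a bounded operator.\<close>
  have V_bound: "bounded_op HC UNIV (\<lambda>h. (vacuum \<otimes>\<^sub>F d j h, 0) :: ('d, 'c ^ 'd) fock \<times> ('d, 'e) fock)" for j
  proof (rule bounded_opI[where K = 1])
    show "norm ((vacuum \<otimes>\<^sub>F d j h, 0) :: ('d, 'c ^ 'd) fock \<times> ('d, 'e) fock) \<le> 1 * norm h" if h: "h \<in> HC" for h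
    proof -
      let ?v = "vacuum \<otimes>\<^sub>F d j h :: ('d, 'c ^ 'd) fock"
      have "cinner ?v ?v = complex_of_real ((norm h)\<^sup>2 - (norm (C j h))\<^sup>2)"
        by (simp add: cinner_vacuum_vacuum cinner_defect_axis h) (simp add: cinner_self)
      then have "(norm ?v)\<^sup>2 = (norm h)\<^sup>2 - (norm (C j h))\<^sup>2"
        unfolding cinner_self of_real_eq_iff .
      then have "(norm ?v)\<^sup>2 \<le> (norm h)\<^sup>2"
        using zero_le_power2[of "norm (C j h)"] by linarith
      then have "norm ?v \<le> norm h"
        by (rule power2_le_imp_le) simp
      then show ?thesis
        by (simp add: norm_Pair)
    qed
  qed (simp_all add: defect_axis_add defect_axis_scaleC vacuum_add vacuum_scaleC)
  have "bounded_op HC HA (?B j)" for j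
    by (rule bounded_op_compose[OF V_bound bounded_op_proj[OF closed_HA]])
  moreover have "bounded_op HA HA (?A j)" for j
    by (rule bounded_op_compose[OF bounded_op_mono[OF bounded_shift HA_K0 subset_UNIV] bounded_op_proj[OF closed_HA]])
  moreover have "E j (h, a) = (C j h, ?B j h + ?A j a)" if "h \<in> HC" "a \<in> HA" for j h a
    using that HA_K0 by (simp add: lifting_of_eq model_dilation_eq subsetD proj_HE T_in proj_add[OF closed_HA])
  ultimately show ?thesis
    unfolding contractive_lifting_def lifting_def using closed_HA row_contraction_E
    by (intro conjI exI[of _ ?B] exI[of _ ?A]) simp_all
qed

text \<open>The complement {0} x W(fock_on D) is invariant under every V_j, so the error made by
  compressing after each letter never returns to \<open>HE\<close>. In particular E_\<alpha> is the
  compression of V_\<alpha>.\<close>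

lemma word_V_decomposition:
  assumes "x \<in> HE"
  obtains \<xi> where "\<xi> \<in> fock_on D" "word_op V \<alpha> x = word_op E \<alpha> x + (0, W \<xi>)"
proof -
  have "\<exists>\<xi>\<in>fock_on D. word_op V \<alpha> x = word_op E \<alpha> x + (0, W \<xi>)"
  proof (induction \<alpha>)
    case Nil
    then show ?case
      using csubspace_0[OF sub_FD] by (intro bexI[of _ 0]) (simp_all add: zero_prod_def[symmetric])
  next
    case (Cons j \<alpha>)
    then obtain \<xi> where \<xi>: "\<xi> \<in> fock_on D" "word_op V \<alpha> x = word_op E \<alpha> x + (0, W \<xi>)"
      by blast
    have y: "word_op E \<alpha> x \<in> K"
      using word_E_in[OF assms] HE_K by blast
    obtain \<zeta> where \<zeta>: "\<zeta> \<in> fock_on D" "V j (word_op E \<alpha> x) = E j (word_op E \<alpha> x) + (0, W \<zeta>)"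
      using HE_decomposition[OF V.V_in[OF y]] unfolding lifting_of_eq by blast
    have "V j (word_op V \<alpha> x) = V j (word_op E \<alpha> x) + V j (0, W \<xi>)"
      unfolding \<xi>(2) by (rule bounded_op_add[OF V.bounded_V y]) (simp add: csubspace_0[OF sub_H] W_in \<xi>(1))
    also have "\<dots> = E j (word_op E \<alpha> x) + (0, W \<zeta> + W (creation j \<xi>))"
      by (simp add: \<zeta>(2) V_W \<xi>(1) add.assoc)
    also have "W \<zeta> + W (creation j \<xi>) = W (\<zeta> + creation j \<xi>)"
      by (simp add: W_add \<zeta>(1) \<xi>(1) creation_fock_on sub_D)
    finally show ?case
      using \<zeta>(1) \<xi>(1) by (intro bexI[of _ "\<zeta> + creation j \<xi>"])
        (simp_all add: csubspace_add[OF sub_FD] creation_fock_on sub_D)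
  qed
  with that show thesis
    by blast
qed

lemma isometric_dilation_V: "isometric_dilation K V HE E id"
proof
  show "closed_csubspace HE" "row_contraction HE E"
    by (rule closed_HE, rule row_contraction_E)
  show "bounded_op HE K id"
    using bounded_op_mono[OF bounded_op_id order_refl HE_K] by (simp add: id_def)
  show "cinner (word_op V \<alpha> (id x)) (id y) = cinner (word_op E \<alpha> x) y" if "x \<in> HE" "y \<in> HE" for \<alpha> x y
    by (rule word_V_decomposition[OF that(1), of \<alpha>]) (simp add: cinner_add_left cinner_W_HE that(2) del: cinner_Pair)
qed

sublocale dil: isometric_dilation K V HE E id
  by (rule isometric_dilation_V)

lemma incl_HE: "h \<in> HC \<Longrightarrow> (h, 0) \<in> HE"
  by (simp add: csubspace_0[OF closed_csubspace_csubspace[OF closed_HA]])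

lemma incl_K: "h \<in> HC \<Longrightarrow> (h, 0) \<in> K"
  using incl_HE HE_K by blast

section \<open>Vectors generated by the base space\<close>

lemma word_V_vacuum_d:
  assumes "h \<in> HC"
  shows "word_op V \<beta> (0, (vacuum \<otimes>\<^sub>F d i h, 0)) = (0, (word_op creation \<beta> (vacuum \<otimes>\<^sub>F d i h), 0))"
proof (induction \<beta>)
  case (Cons j \<beta>)
  have in_FL: "word_op creation \<beta> (vacuum \<otimes>\<^sub>F d i h) \<in> fock_on DC"
    by (intro word_vacuum_fock_on sub_defect_space defect_op_in axis_column_space sub_H assms)
  then show ?case
    using shift_pair[OF in_FL csubspace_0[OF sub_FD], of j] model_space_pair[OF in_FL csubspace_0[OF sub_FD]]
    by (simp add: Cons.IH V_0)
qed simp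

lemma V_vacuum_d: "h \<in> HC \<Longrightarrow> (0, (vacuum \<otimes>\<^sub>F d i h, 0)) = V i (h, 0) - (C i h, 0)"
  by (simp add: model_dilation_eq csubspace_0[OF sub_K0] bounded_op_0[OF bounded_shift sub_K0])

text \<open>Writes the generators of the middle component, the Fock space over the defect space of
  \<open>C\<close>, in terms of words in \<open>V\<close> applied to base vectors.\<close>

lemma word_V_vacuum_d_eq:
  assumes "h \<in> HC"
  shows "(0, (word_op creation \<beta> (vacuum \<otimes>\<^sub>F d i h), 0)) = word_op V (\<beta> @ [i]) (h, 0) - word_op V \<beta> (C i h, 0)"
  unfolding word_V_vacuum_d[OF assms, symmetric] V_vacuum_d[OF assms] word_op_append
  by (simp add: bounded_op_diff[OF V.bounded_word V.sub_K V.V_in[OF incl_K[OF assms]] incl_K[OF T_in[OF assms]]])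

lemma fock_on_DC: "fock_on DC = closed_cspan
    ((\<lambda>(\<alpha> :: 'd list, v). word_op creation \<alpha> (vacuum \<otimes>\<^sub>F v)) ` (UNIV \<times> (\<lambda>(i, h). d i h) ` (UNIV \<times> HC)))"
  unfolding defect_space_axis by (rule fock_on_closed_cspan)

text \<open>The words applied to base vectors generate the base space and the whole Fock space over
  the defect space of \<open>C\<close>, so the first two components of an orthogonal vector
  vanish.\<close>

lemma orthogonal_to_words:
  assumes x: "x \<in> K" and orth: "\<And>\<alpha> h. h \<in> HC \<Longrightarrow> cinner (word_op V \<alpha> (h, 0)) x = 0"
  shows "fst x = 0" and "fst (snd x) = 0"
proof -
  have "cinner (fst x) (fst x) = 0"
    using orth[of "fst x" "[]"] x by (simp add: cinner_prod_def mem_Times_iff)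
  then show "fst x = 0"
    by simp
  show "fst (snd x) = 0"
  proof (rule closed_cspan_orthogonal_self)
    have "snd x \<in> K0"
      using x by (simp add: mem_Times_iff)
    then show "fst (snd x) \<in> closed_cspan
        ((\<lambda>(\<alpha> :: 'd list, v). word_op creation \<alpha> (vacuum \<otimes>\<^sub>F v)) ` (UNIV \<times> (\<lambda>(i, h). d i h) ` (UNIV \<times> HC)))"
      by (simp add: model_space_eq mem_Times_iff flip: fock_on_DC)
    fix y
    assume "y \<in> (\<lambda>(\<alpha> :: 'd list, v). word_op creation \<alpha> (vacuum \<otimes>\<^sub>F v)) ` (UNIV \<times> (\<lambda>(i, h). d i h) ` (UNIV \<times> HC))"
    then obtain \<beta> i h where y: "y = word_op creation \<beta> (vacuum \<otimes>\<^sub>F d i h)" and h: "h \<in> HC"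
      by auto
    have "cinner (0, (y, 0)) x = 0"
      unfolding y word_V_vacuum_d_eq[OF h] by (simp add: cinner_diff_left orth h T_in del: cinner_Pair)
    then show "cinner y (fst (snd x)) = 0"
      by (simp add: cinner_prod_def)
  qed
qed

text \<open>A vector z of \<open>HE\<close> orthogonal to an invariant subspace containing the base
  is orthogonal to all V_\<alpha> h, so only its \<Delta>-component survives. Being in the
  complement of the vectors M \<xi> + \<Delta> \<xi>, it is then orthogonal to all \<Delta>
  \<xi>.\<close>

lemma minimal_lifting_E: "minimal_lifting HC HA E"
  unfolding minimal_lifting_def
proof (rule hull_unique)
  show "HC \<times> {0} \<subseteq> HE"
    using incl_HE by auto
  show "closed_csubspace HE \<and> HE \<subseteq> HC \<times> HA \<and> (\<forall>j. E j ` HE \<subseteq> HE)"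
    using closed_HE E_in by blast
  fix S
  assume sub: "HC \<times> {0} \<subseteq> S" and S: "closed_csubspace S \<and> S \<subseteq> HC \<times> HA \<and> (\<forall>j. E j ` S \<subseteq> S)"
  have word_S: "word_op E \<alpha> (h, 0) \<in> S" if "h \<in> HC" for \<alpha> h
  proof (induction \<alpha>)
    case Nil
    then show ?case
      using sub that by auto
  next
    case (Cons j \<alpha>)
    then show ?case
      using S by (auto simp: image_subset_iff)
  qed
  have "S = HE"
  proof (rule closed_csubspace_eqI[OF closed_HE])
    fix z
    assume z: "z \<in> HE" and orth: "\<And>x. x \<in> S \<Longrightarrow> cinner z x = 0"
    \<comment> \<open>For z in \<open>HE\<close> the dilation property exchanges V_\<alpha> h for
      E_\<alpha> h, which lies in \<open>S\<close>.\<close>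
    have "cinner (word_op V \<alpha> (h, 0)) z = 0" if "h \<in> HC" for \<alpha> h
      using dil.dilation[OF incl_HE[OF that] z, of \<alpha>] orth[OF word_S[OF that, of \<alpha>]]
      by (simp add: cinner_eq_0_sym[of z])
    then have fst: "fst z = 0" "fst (snd z) = 0"
      using orthogonal_to_words[of z] z HE_K by blast+
    have "snd (snd z) = 0"
    proof (rule closed_cspan_orthogonal_self)
      show "snd (snd z) \<in> closed_cspan (\<Delta> ` fock_on D)"
        using z HA_K0 by (auto simp: model_space_eq)
      fix y
      assume "y \<in> \<Delta> ` fock_on D"
      then obtain \<xi> where \<xi>: "\<xi> \<in> fock_on D" "y = \<Delta> \<xi>"
        by blast
      have "cinner (snd z) (W \<xi>) = 0"
        using z \<xi>(1) by (intro cinner_HA_W) auto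
      then show "cinner y (snd (snd z)) = 0"
        using fst by (subst cinner_eq_0_sym) (simp add: cinner_prod_def model_W_def \<xi>(2))
    qed
    with fst show "z = 0"
      by (simp add: prod_eq_iff)
  qed (use S in auto)
  then show "HE \<subseteq> S"
    by simp
qed

section \<open>The wandering subspace in the model and the characteristic function\<close>

definition w :: "'e \<Rightarrow> 'c \<times> ('d, 'c ^ 'd) fock \<times> ('d, 'e) fock"
  where "w \<delta> = (0, W (vacuum \<otimes>\<^sub>F \<delta>))"

lemma vacuum_FD: "\<delta> \<in> D \<Longrightarrow> vacuum \<otimes>\<^sub>F \<delta> \<in> fock_on D"
  by (rule vacuum_fock_on[OF sub_D])

lemma unitary_w: "unitary_op D (w ` D) w"
  and closed_w: "closed_csubspace (w ` D)"
proof -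
  have "cinner (w \<delta>) (w \<delta>') = cinner \<delta> \<delta>'" if "\<delta> \<in> D" "\<delta>' \<in> D" for \<delta> \<delta>'
    by (simp add: w_def cinner_W vacuum_FD that cinner_vacuum_vacuum)
  from isometry_image[OF closed_D, of w, OF this] show "unitary_op D (w ` D) w" "closed_csubspace (w ` D)"
    by blast+
qed

lemma word_V_w: "\<delta> \<in> D \<Longrightarrow> word_op V \<alpha> (w \<delta>) = (0, W (word_op creation \<alpha> (vacuum \<otimes>\<^sub>F \<delta>)))"
  by (induction \<alpha>) (simp_all add: w_def V_W word_vacuum_fock_on sub_D)

text \<open>Orthogonality to \<open>HE\<close> leaves a vector (0, W \<xi>). The vectors (0, W(L_j
  \<zeta>)) = V_j (0, W \<zeta>) are orthogonal to \<open>HE\<close> and to all V_i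
  \<open>HE\<close>, so \<xi> is orthogonal to the ranges of the creation operators and hence a
  vacuum tensor.\<close>

lemma wandering_subset_w: "wandering HE id V \<subseteq> w ` D"
proof
  fix l
  assume l: "l \<in> wandering HE id V"
  obtain \<xi> where \<xi>: "\<xi> \<in> fock_on D" "l = proj HE l + (0, W \<xi>)"
    using HE_decomposition[OF dil.wandering_in_K[OF l]] .
  have "proj HE l = 0"
    using dil.wandering_orthogonal_\<iota>[OF l] by (intro proj_eq_0[OF closed_HE]) simp
  with \<xi> have l_eq: "l = (0, W \<xi>)"
    by simp
  have "cinner \<xi> (creation j \<zeta>) = 0" if "\<zeta> \<in> fock_on D" for j \<zeta>
  proof -
    let ?y = "(0, W (creation j \<zeta>))"
    have j\<zeta>: "creation j \<zeta> \<in> fock_on D"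
      by (rule creation_fock_on[OF sub_D that])
    have W\<zeta>: "(0, W \<zeta>) \<in> K"
      using W_in[OF that] csubspace_0[OF sub_H] by simp
    have 1: "cinner ?y x = 0" if "x \<in> HE" for x
      by (rule cinner_W_HE[OF that j\<zeta>])
    have 2: "cinner ?y (V i x) = 0" if "x \<in> HE" for i x
      using V.cinner_V[OF W\<zeta>, of x j i] cinner_W_HE[OF that \<open>\<zeta> \<in> fock_on D\<close>] that HE_K
      by (auto simp: V_W[OF \<open>\<zeta> \<in> fock_on D\<close>] simp del: cinner_Pair split: if_splits)
    have "l \<in> closed_cspan (id ` HE \<union> (\<Union>j. V j ` id ` HE))"
      using l by (simp add: wandering_def ominus_def)
    then have "cinner l ?y = 0"
      by (rule closed_cspan_cinner_eq_0) (use 1 2 in \<open>auto simp: cinner_eq_0_sym[of _ ?y] simp del: cinner_Pair\<close>)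
    then show ?thesis
      by (simp add: l_eq cinner_W \<xi>(1) j\<zeta>)
  qed
  from fock_vacuumI[OF sub_D \<xi>(1) this] have "l = w (fock_coeff \<xi> [])"
    by (simp add: l_eq w_def)
  moreover have "fock_coeff \<xi> [] \<in> D"
    using \<xi>(1) by (simp add: fock_on_def)
  ultimately show "l \<in> w ` D"
    by blast
qed

lemma wandering_eq_w:
  assumes inj: "inj_on (symbol M) D"
  shows "wandering HE id V = w ` D"
proof (rule closed_csubspace_eqI[OF closed_w dil.closed_wandering wandering_subset_w])
  fix z
  assume "z \<in> w ` D" and orth: "\<And>x. x \<in> wandering HE id V \<Longrightarrow> cinner z x = 0"
  then obtain \<delta> where \<delta>: "\<delta> \<in> D" "z = w \<delta>"
    by blast
  have z_HE: "cinner z x = 0" if "x \<in> HE" for x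
    unfolding \<delta>(2) w_def by (rule cinner_W_HE[OF that vacuum_FD[OF \<delta>(1)]])
  have z_V: "cinner z (V j x) = 0" if "x \<in> HE" for j x
    using orth[OF dil.wander_in[OF axis_column_space[OF dil.sub_H that, of j]]] z_HE[OF E_in[OF that, of j]]
    by (simp add: dil.wander_axis[OF that] cinner_diff_right)
  have z_W: "cinner z (0, W (creation j \<xi>)) = 0" if "\<xi> \<in> fock_on D" for j \<xi>
    by (simp add: \<delta> w_def cinner_W vacuum_FD creation_fock_on[OF sub_D that])
  have "cinner (word_op V \<alpha> (h, 0)) z = 0" if h: "h \<in> HC" for \<alpha> h
  proof (cases \<alpha>)
    case Nil
    then show ?thesis
      using z_HE[OF incl_HE[OF h]] by (simp add: cinner_eq_0_sym[of z])
  next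
    \<comment> \<open>V_j V_\<beta> h splits into V_j of a vector of \<open>HE\<close>, orthogonal
      to \<open>z\<close> by \<open>z_V\<close>, and V_j (0, W \<xi>), which lies in W of the range
      of creation.\<close>
    case (Cons j \<beta>)
    obtain \<xi> where \<xi>: "\<xi> \<in> fock_on D" "word_op V \<beta> (h, 0) = word_op E \<beta> (h, 0) + (0, W \<xi>)"
      using word_V_decomposition[OF incl_HE[OF h]] .
    have y: "word_op E \<beta> (h, 0) \<in> HE"
      by (rule word_E_in[OF incl_HE[OF h]])
    have "V j (word_op V \<beta> (h, 0)) = V j (word_op E \<beta> (h, 0)) + V j (0, W \<xi>)"
      unfolding \<xi>(2) using y HE_K
      by (intro bounded_op_add[OF V.bounded_V]) (auto simp: csubspace_0[OF sub_H] W_in \<xi>(1))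
    then have "cinner z (word_op V \<alpha> (h, 0)) = 0"
      by (simp add: Cons cinner_add_right z_V[OF y] V_W \<xi>(1) z_W)
    then show ?thesis
      by (simp add: cinner_eq_0_sym[of z])
  qed
  moreover have "z \<in> K"
    unfolding \<delta>(2) w_def using W_in[OF vacuum_FD[OF \<delta>(1)]] csubspace_0[OF sub_H] by simp
  ultimately have "fst (snd z) = 0"
    by (intro orthogonal_to_words(2))
  \<comment> \<open>The middle component of \<open>w \<delta>\<close> is M applied to the vacuum
    tensor of \<delta>, that is, the symbol at \<delta>.\<close>
  then have "symbol M \<delta> = symbol M 0"
    by (simp add: \<delta>(2) w_def model_W_def symbol_def bounded_op_0[OF bounded_M sub_FD])
  then have "\<delta> = 0"
    using inj_onD[OF inj] \<delta>(1) csubspace_0[OF sub_D] by blast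
  then show "z = 0"
    by (simp add: \<delta>(2) w_def zero_prod_def[symmetric])
qed

sublocale lift: contractive_lift HC C HA E
  by (rule contractive_lift_intro[OF closed_H row_contraction contractive_lifting_E])

text \<open>Both sides are compared weakly against the Fock space over the defect space of
  \<open>C\<close>. The identity is proved for elementary tensors (\<open>gen\<close>) and extended
  by density, in the target argument (\<open>gen2\<close>) and then in the source argument
  (\<open>gen3\<close>).\<close>

lemma char_fun_lifting_of:
  assumes U: "unitary_op D lift.DE U"
    and \<kappa>U: "\<And>\<delta>. \<delta> \<in> D \<Longrightarrow> canonical_kappa HE E id V (U \<delta>) = w \<delta>"
    and \<xi>: "\<xi> \<in> fock_on D"
  shows "char_fun HC HA C E (fock_map U \<xi>) = M \<xi>"
proof -
  note fm = bounded_op_fock_map[OF U sub_D]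
  note KE = unitary_op_bounded[OF lift.E.unitary_K] and KC = unitary_op_bounded[OF lift.C.unitary_K]
  let ?XC = "(\<lambda>(\<alpha> :: 'd list, v). word_op creation \<alpha> (vacuum \<otimes>\<^sub>F v)) ` (UNIV \<times> (\<lambda>(i, h). d i h) ` (UNIV \<times> HC))"
  let ?XD = "(\<lambda>(\<alpha> :: 'd list, v). word_op creation \<alpha> (vacuum \<otimes>\<^sub>F v)) ` (UNIV \<times> D)"
  have XD: "?XD \<subseteq> fock_on D" "fock_on D = closed_cspan ?XD"
    using fock_on_closed_cspan[of D, where 'd = 'd]
    by (auto simp: closed_cspan_closed_csubspace[OF closed_D] intro!: word_vacuum_fock_on sub_D)
  have XC: "?XC \<subseteq> fock_on DC"
    by (auto intro!: word_vacuum_fock_on sub_defect_space defect_op_in axis_column_space sub_H)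
  have gen: "cinner (lift.KC (word_op creation \<beta> (vacuum \<otimes>\<^sub>F d i h)))
        (lift.KE (fock_map U (word_op creation \<alpha> (vacuum \<otimes>\<^sub>F \<delta>)))) =
      cinner (word_op creation \<beta> (vacuum \<otimes>\<^sub>F d i h)) (M (word_op creation \<alpha> (vacuum \<otimes>\<^sub>F \<delta>)))"
    if \<delta>: "\<delta> \<in> D" and h: "h \<in> HC" for \<alpha> \<beta> i h \<delta>
  proof -
    have U\<delta>: "U \<delta> \<in> lift.DE"
      by (rule bounded_op_in[OF unitary_op_bounded[OF U] \<delta>])
    have dh: "d i h \<in> DC"
      by (intro defect_op_in axis_column_space sub_H h)
    let ?l = "word_op lift.V \<alpha> (lift.E.\<kappa> (U \<delta>))"
    have "lift.KC (word_op creation \<beta> (vacuum \<otimes>\<^sub>F d i h)) = word_op lift.V \<beta> (lift.V i (lift.\<iota>C h) - lift.\<iota>C (C i h))"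
      using lift.C.kappa_defect_op[OF axis_column_space[OF sub_H h, of i]]
      by (simp add: lift.C.K_word dh lift.C.wander_axis h)
    also have "\<dots> = word_op lift.V (\<beta> @ [i]) (lift.\<iota>E (h, 0)) - word_op lift.V \<beta> (lift.\<iota>E (C i h, 0))"
      by (simp only: word_op_append word_op_Cons word_op_Nil
          bounded_op_diff[OF lift.E.bounded_word lift.E.sub_K lift.E.V_in[OF lift.C.\<iota>_in[OF h]] lift.C.\<iota>_in[OF T_in[OF h]]])
    finally have KC_eq: "lift.KC (word_op creation \<beta> (vacuum \<otimes>\<^sub>F d i h)) =
        word_op lift.V (\<beta> @ [i]) (lift.\<iota>E (h, 0)) - word_op lift.V \<beta> (lift.\<iota>E (C i h, 0))" .
    have KE_eq: "lift.KE (fock_map U (word_op creation \<alpha> (vacuum \<otimes>\<^sub>F \<delta>))) = ?l"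
      by (simp add: fock_map_word_vacuum[OF unitary_op_bounded[OF U] sub_D \<delta>] lift.E.K_word U\<delta>)
    \<comment> \<open>The passage from the minimal to the model dilation: inner products of a
      shifted wandering vector with words on \<open>HE\<close> agree in both, and the normalization
      of \<open>U\<close> turns the canonical image of \<open>U \<delta>\<close> into
      \<open>w \<delta>\<close>.\<close>
    have same: "cinner ?l (word_op lift.V \<gamma> (lift.\<iota>E y)) = cinner (word_op V \<alpha> (w \<delta>)) (word_op V \<gamma> y)"
      if "y \<in> HE" for \<gamma> y
      using isometric_dilations_kappa[OF lift.E.isometric_dilation_axioms isometric_dilation_V U\<delta> that, of \<alpha> \<gamma>]
      by (simp add: \<kappa>U \<delta>)
    have "cinner ?l (lift.KC (word_op creation \<beta> (vacuum \<otimes>\<^sub>F d i h))) =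
        cinner (word_op V \<alpha> (w \<delta>)) (0, (word_op creation \<beta> (vacuum \<otimes>\<^sub>F d i h), 0))"
      unfolding KC_eq word_V_vacuum_d_eq[OF h] cinner_diff_right
      by (simp only: same incl_HE h T_in)
    \<comment> \<open>In the model, the second vector sits in the middle component only, where W
      contributes exactly its M-part.\<close>
    also have "\<dots> = cinner (M (word_op creation \<alpha> (vacuum \<otimes>\<^sub>F \<delta>))) (word_op creation \<beta> (vacuum \<otimes>\<^sub>F d i h))"
      by (simp add: word_V_w \<delta> model_W_def)
    finally show ?thesis
      unfolding KE_eq by (metis cinner_commute)
  qed
  have gen2: "cinner (lift.KC g) (lift.KE (fock_map U (word_op creation \<alpha> (vacuum \<otimes>\<^sub>F \<delta>)))) =
      cinner g (M (word_op creation \<alpha> (vacuum \<otimes>\<^sub>F \<delta>)))" if "\<delta> \<in> D" "g \<in> fock_on DC" for g \<alpha> \<delta>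
    by (rule bounded_op_eq_on_closed_cspan[OF bounded_op_compose[OF KC bounded_op_cinner] bounded_op_cinner sub_FL XC])
      (use that gen in \<open>auto simp flip: fock_on_DC\<close>)
  have gen3: "cinner (lift.KE (fock_map U \<xi>)) (lift.KC g) = cinner (M \<xi>) g" if "g \<in> fock_on DC" for g
  proof (rule bounded_op_eq_on_closed_cspan[OF bounded_op_compose[OF bounded_op_compose[OF fm KE] bounded_op_cinner]
          bounded_op_compose[OF bounded_M bounded_op_cinner] sub_FD XD(1)])
    fix x
    assume "x \<in> ?XD"
    then obtain \<alpha> \<delta> where "x = word_op creation \<alpha> (vacuum \<otimes>\<^sub>F \<delta>)" "\<delta> \<in> D"
      by auto
    with gen2[OF _ that] show "cinner (lift.KE (fock_map U x)) (lift.KC g) = cinner (M x) g"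
      by (metis cinner_commute)
  qed (use \<xi> XD(2) in auto)
  note fm\<xi> = bounded_op_in[OF fm \<xi>]
  \<comment> \<open>Both functions take values in the test space, so their difference is itself an
    admissible test vector.\<close>
  let ?x = "char_fun HC HA C E (fock_map U \<xi>) - M \<xi>"
  have x: "?x \<in> fock_on DC"
    by (intro csubspace_diff sub_FL lift.char_fun_in fm\<xi> M_in \<xi>)
  have "cinner ?x (char_fun HC HA C E (fock_map U \<xi>)) = cinner ?x (M \<xi>)"
    unfolding lift.cinner_char_fun[OF fm\<xi> x] using gen3[OF x] by (metis cinner_commute)
  then have "cinner ?x ?x = 0"
    by (simp add: cinner_diff_right)
  then show ?thesis
    by simp
qed

lemma is_char_fun_of_lifting:
  assumes "inj_on (symbol M) D"
  shows "is_char_fun_of_lifting HC C D M"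
proof -
  note wand = wandering_eq_w[OF assms]
  \<comment> \<open>The unitary of the convention, the inverse of the canonical unitary after
    \<open>w\<close>; it is defined on all of \<open>D\<close> because \<open>w\<close> maps onto
    the wandering subspace.\<close>
  let ?U = "\<lambda>\<delta>. inv_into lift.DE (canonical_kappa HE E id V) (w \<delta>)"
  note U = unitary_op_inv_into[OF dil.unitary_kappa[unfolded wand] unitary_w dil.closed_defect_space closed_D]
  have w_eq: "(\<lambda>\<delta>. (0, W (vacuum \<otimes>\<^sub>F \<delta>))) = w"
    by (simp add: w_def fun_eq_iff)
  show ?thesis
    unfolding is_char_fun_of_lifting_def Let_def w_eq
    using wand U char_fun_lifting_of[OF U] by (intro conjI exI[of _ ?U]) (auto simp flip: w_def)
qed

end

theorem corollary3p3:
  fixes HC :: "'c :: chilbert_space set"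
    and C :: "'d :: finite \<Rightarrow> 'c \<Rightarrow> 'c"
  assumes "closed_csubspace HC" and "row_contraction HC C"
  shows
    "(\<forall>(HA :: 'a :: chilbert_space set) (E :: 'd \<Rightarrow> 'c \<times> 'a \<Rightarrow> 'c \<times> 'a).
        contractive_lifting HC HA C E \<and> minimal_lifting HC HA E \<longrightarrow>
        inj_on (symbol (char_fun HC HA C E)) (defect_space (HC \<times> HA) E)) \<and>
     (\<forall>(D :: 'e :: chilbert_space set) (M :: ('d, 'e) fock \<Rightarrow> ('d, 'c ^ 'd) fock).
        closed_csubspace D \<and>
        multi_analytic D (defect_space HC C) M \<and>
        contractive (fock_on D) M \<and>
        inj_on (symbol M) D \<longrightarrow>
        contractive_lifting HC (model_HA D (defect_space HC C) M) C (lifting_of HC C D M) \<and>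
        minimal_lifting HC (model_HA D (defect_space HC C) M) (lifting_of HC C D M) \<and>
        is_char_fun_of_lifting HC C D M)"
proof (intro conjI allI impI; elim conjE)
  show "inj_on (symbol (char_fun HC HA C E)) (defect_space (HC \<times> HA) E)"
    if "contractive_lifting HC HA C E" "minimal_lifting HC HA E"
    for HA :: "'a set" and E
    using contractive_lift.inj_on_symbol_char_fun[OF contractive_lift_intro[OF assms that(1)] that(2)] .
next
  fix D :: "'e set" and M :: "('d, 'e) fock \<Rightarrow> ('d, 'c ^ 'd) fock"
  assume D: "closed_csubspace D" "multi_analytic D (defect_space HC C) M" "contractive (fock_on D) M"
    and inj: "inj_on (symbol M) D"
  interpret model HC C D M
    by unfold_locales (use assms D in auto)
  show "contractive_lifting HC (model_HA D (defect_space HC C) M) C (lifting_of HC C D M)"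
    by (rule contractive_lifting_E)
  show "minimal_lifting HC (model_HA D (defect_space HC C) M) (lifting_of HC C D M)"
    by (rule minimal_lifting_E)
  show "is_char_fun_of_lifting HC C D M"
    by (rule is_char_fun_of_lifting[OF inj])
qed

end
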